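(* Let $\rho\in\mathcal H'=\overset{\circ}{W}{}_2^{-1}[0,1]$ be real. Then the spectrum of the pencil $T_\rho$ is purely discrete, and all its eigenvalues are simple. All eigenvalues of $T_\rho$ lying to the right of zero are of positive type, and all eigenvalues of $T_\rho$ lying to the left of zero are of negative type. For every $\lambda>0$ the number of eigenvalues of $T_\rho$ belonging to the interval $(0,\lambda)$ coincides with the index of inertia $\operatorname{ind}T_\rho(\lambda)$ of the operator $T_\rho(\lambda)$. Analogously, for every $\lambda<0$ the number of eigenvalues of $T_\rho$ belonging to the interval $(\lambda,0)$ coincides with the index of inertia $\operatorname{ind}T_\rho(\lambda)$ of the operator $T_\rho(\lambda)$.
   Context: $\mathcal H$ is the (complex) Sobolev space $\overset{\circ}{W}{}_2^1[0,1]$ of functions vanishing at $0$ and $1$, with norm $\|y\|_{\mathcal H}=\|y'\|_{L_2[0,1]}$. $\mathcal H'=\overset{\circ}{W}{}_2^{-1}[0,1]$ is its dual relative to $L_2[0,1]$, i.e. the completion of $L_2[0,1]$ in the norm $\|y\|_{\mathcal H'}=\sup_{\|z\|_{\mathcal H}=1}|\langle y,z\rangle_{L_2[0,1]}|$. $\mathfrak I[y,z]$ ($y\in\mathcal H'$, $z\in\mathcal H$) is the sesquilinear form extending by continuity $\mathfrak I[y,z]=\int_0^1 y\overline z\,dx$, $y\in L_2[0,1]$. An element $\rho\in\mathcal H'$ is real if $\mathfrak I[\rho,y]\in\mathbb R$ for every real-valued $y\in\mathcal H$. The linear pencil $T_\rho$ of bounded operators $T_\rho(\lambda):\mathcal H\to\mathcal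 H'$ is defined by $$\mathfrak I[T_\rho(\lambda)y,z]=\int_0^1 y'\overline{z'}\,dx-\lambda\,\mathfrak I[\rho,\overline yz],\qquad\lambda\in\mathbb C,\ y,z\in\mathcal H.$$ It is the operator model of the boundary value problem $-y''-\lambda\rho y=0$, $y(0)=y(1)=0$. The spectrum of $T_\rho$ is the set of $\lambda\in\mathbb C$ for which $T_\rho(\lambda)$ is not boundedly invertible; $\lambda$ is an eigenvalue if $\ker T_\rho(\lambda)\neq\{0\}$. The index of inertia $\operatorname{ind}S$ of an operator $S:\mathcal H\to\mathcal H'$ is the maximum of the dimensions of subspaces $\mathcal M\subset\mathcal H$ for which there is $\varepsilon>0$ such that $\mathfrak I[Sy,y]\le-\varepsilon\|y\|_{\mathcal H}^2$ for all $y\in\mathcal M$. An eigenvalue $\lambda\in\mathbb C$ of a linear pencil $S(\lambda)=A-\lambda B$ of operators $\mathcal H\to\mathcal H'$ is of positive (respectively, negative) type if there is $\varepsilon>0$ such that $\mathfrak I[By,y]\ge\varepsilon\|y\|_{\mathcal H}^2$ (respectively, $\mathfrak I[By,y]\le-\varepsilon\|y\|_{\mathcal H}^2$) for all $y\in\ker S(\lambda)$. *)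

theory Defs
  imports
    "HOL-Analysis.Analysis"
    "HOL-Library.Function_Algebras"
    "HOL-Library.Complex_Order"
begin

type_synonym cfun = "real \<Rightarrow> complex"
type_synonym functional = "cfun \<Rightarrow> complex"

interpretation cfun: vector_space "\<lambda>(c::complex) (y::cfun) x. c * y x"
  by unfold_locales (rule ext, simp add: distrib_left distrib_right mult.assoc)+

text \<open>The library's dimension is 0 for spaces without a finite spanning set; here
  it takes the value \<open>\<infinity>\<close> on them.\<close>

definition edim :: "cfun set \<Rightarrow> enat" where
  "edim M = (if \<exists>F. finite F \<and> F \<subseteq> M \<and> M \<subseteq> cfun.span F then enat (cfun.dim M) else \<infinity>)"

subsection \<open>The Sobolev space and its dual\<close>

definition L2 :: "cfun set" where
  "L2 = {f. f \<in> borel_measurable (lebesgue_on {0..1}) \<and>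
            integrable (lebesgue_on {0..1}) (\<lambda>x. (cmod (f x))\<^sup>2)}"

definition L2_norm :: "cfun \<Rightarrow> real" where
  "L2_norm f = sqrt (LINT x|lebesgue_on {0..1}. (cmod (f x))\<^sup>2)"

text \<open>A function has a derivative in \<open>L2\<close> if it is absolutely continuous
  on \<open>{0..1}\<close> with square integrable derivative. The derivative is determined up to a
  null set, and \<open>wderiv\<close> selects a representative.\<close>

definition has_wderiv :: "cfun \<Rightarrow> cfun \<Rightarrow> bool" where
  "has_wderiv y g \<longleftrightarrow>
     g \<in> L2 \<and> (\<forall>x\<in>{0..1}. y x = y 0 + (LINT t|lebesgue_on {0..x}. g t))"

definition wderiv :: "cfun \<Rightarrow> cfun" where
  "wderiv y = (SOME g. has_wderiv y g)"

text \<open>Elements of the space are continuous representatives, extended by zero outside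
  \<open>{0..1}\<close>, so that equality in the space is equality of functions.\<close>

definition sobolev :: "cfun set" where
  "sobolev = {y. (\<exists>g. has_wderiv y g) \<and> y 0 = 0 \<and> y 1 = 0 \<and> (\<forall>x. x \<notin> {0..1} \<longrightarrow> y x = 0)}"

definition sob_norm :: "cfun \<Rightarrow> real" where
  "sob_norm y = L2_norm (wderiv y)"

text \<open>Bounded antilinear functionals on the Sobolev space, extended by zero outside it.\<close>

definition antidual :: "functional set" where
  "antidual = {\<phi>. (\<forall>y\<in>sobolev. \<forall>z\<in>sobolev. \<phi> (y + z) = \<phi> y + \<phi> z) \<and>
                  (\<forall>c. \<forall>y\<in>sobolev. \<phi> (\<lambda>x. c * y x) = cnj c * \<phi> y) \<and>
                  (\<exists>C. \<forall>y\<in>sobolev. cmod (\<phi> y) \<le> C * sob_norm y) \<and>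
                  (\<forall>y. y \<notin> sobolev \<longrightarrow> \<phi> y = 0)}"

definition dual_norm :: "functional \<Rightarrow> real" where
  "dual_norm \<phi> = (SUP z\<in>{z\<in>sobolev. sob_norm z = 1}. cmod (\<phi> z))"

definition embed_L2 :: "cfun \<Rightarrow> functional" where
  "embed_L2 f = (\<lambda>z. if z \<in> sobolev then LINT x|lebesgue_on {0..1}. f x * cnj (z x) else 0)"

text \<open>The completion of \<open>L2\<close> in the dual norm, realised as a closure
  inside the (complete) space of bounded antilinear functionals.\<close>

definition sobolev_dual :: "functional set" where
  "sobolev_dual = {\<phi>\<in>antidual. \<forall>e>0. \<exists>f\<in>L2. dual_norm (\<phi> - embed_L2 f) < e}"

text \<open>In this realisation the sesquilinear form extending the \<open>L2\<close> inner product
  is evaluation.\<close>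

abbreviation (input) pairing :: "functional \<Rightarrow> cfun \<Rightarrow> complex" where
  "pairing \<phi> z \<equiv> \<phi> z"

definition real_functional :: "functional \<Rightarrow> bool" where
  "real_functional \<rho> \<longleftrightarrow> (\<forall>y\<in>sobolev. (\<forall>x. y x \<in> \<real>) \<longrightarrow> pairing \<rho> y \<in> \<real>)"

subsection \<open>Operators and linear pencils\<close>

definition kernel :: "(cfun \<Rightarrow> functional) \<Rightarrow> cfun set" where
  "kernel S = {y\<in>sobolev. S y = 0}"

definition boundedly_invertible :: "(cfun \<Rightarrow> functional) \<Rightarrow> bool" where
  "boundedly_invertible S \<longleftrightarrow>
     bij_betw S sobolev sobolev_dual \<and>
     (\<exists>C. \<forall>\<phi>\<in>sobolev_dual. sob_norm (inv_into sobolev S \<phi>) \<le> C * dual_norm \<phi>)"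

text \<open>Inequalities between complex numbers are those of \<open>Complex_Order\<close>: they
  include the assertion that the imaginary parts agree.\<close>

definition ind :: "(cfun \<Rightarrow> functional) \<Rightarrow> enat" where
  "ind S = (SUP M\<in>{M. cfun.subspace M \<and> M \<subseteq> sobolev \<and>
       (\<exists>\<epsilon>>0. \<forall>y\<in>M. pairing (S y) y \<le> complex_of_real (- \<epsilon> * (sob_norm y)\<^sup>2))}. edim M)"

definition pencil ::
    "(cfun \<Rightarrow> functional) \<Rightarrow> (cfun \<Rightarrow> functional) \<Rightarrow> complex \<Rightarrow> cfun \<Rightarrow> functional" where
  "pencil A B l y = (\<lambda>z. A y z - l * B y z)"

definition spectrum :: "(complex \<Rightarrow> cfun \<Rightarrow> functional) \<Rightarrow> complex set" where
  "spectrum S = {l. \<not> boundedly_invertible (S l)}"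

definition eigenvalues :: "(complex \<Rightarrow> cfun \<Rightarrow> functional) \<Rightarrow> complex set" where
  "eigenvalues S = {l. kernel (S l) \<noteq> {0}}"

text \<open>The root subspace of \<open>A - l B\<close>: its elements are the members of the chains
  \<open>c 0, c 1, \<dots>\<close> with \<open>(A - l B) (c 0) = 0\<close> and \<open>(A - l B) (c (j + 1)) = B (c j)\<close>,
  that is, of an eigenvector followed by associated vectors. Zero vectors are
  allowed at the beginning of a chain.\<close>

definition root_space ::
    "(cfun \<Rightarrow> functional) \<Rightarrow> (cfun \<Rightarrow> functional) \<Rightarrow> complex \<Rightarrow> cfun set" where
  "root_space A B l = {y. \<exists>(k::nat) c. (\<forall>j\<le>k. c j \<in> sobolev) \<and> pencil A B l (c 0) = 0 \<and>
       (\<forall>j<k. pencil A B l (c (Suc j)) = B (c j)) \<and> y = c k}"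

definition alg_mult :: "(cfun \<Rightarrow> functional) \<Rightarrow> (cfun \<Rightarrow> functional) \<Rightarrow> complex \<Rightarrow> enat" where
  "alg_mult A B l = edim (root_space A B l)"

definition purely_discrete_spectrum ::
    "(cfun \<Rightarrow> functional) \<Rightarrow> (cfun \<Rightarrow> functional) \<Rightarrow> bool" where
  "purely_discrete_spectrum A B \<longleftrightarrow>
     (\<forall>l\<in>spectrum (pencil A B). l isolated_in spectrum (pencil A B) \<and>
        l \<in> eigenvalues (pencil A B) \<and> alg_mult A B l < \<infinity>)"

definition simple_eigenvalue ::
    "(cfun \<Rightarrow> functional) \<Rightarrow> (cfun \<Rightarrow> functional) \<Rightarrow> complex \<Rightarrow> bool" where
  "simple_eigenvalue A B l \<longleftrightarrow> l \<in> eigenvalues (pencil A B) \<and> alg_mult A B l = 1"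

definition positive_type ::
    "(cfun \<Rightarrow> functional) \<Rightarrow> (cfun \<Rightarrow> functional) \<Rightarrow> complex \<Rightarrow> bool" where
  "positive_type A B l \<longleftrightarrow> l \<in> eigenvalues (pencil A B) \<and>
     (\<exists>\<epsilon>>0. \<forall>y\<in>kernel (pencil A B l).
        pairing (B y) y \<ge> complex_of_real (\<epsilon> * (sob_norm y)\<^sup>2))"

definition negative_type ::
    "(cfun \<Rightarrow> functional) \<Rightarrow> (cfun \<Rightarrow> functional) \<Rightarrow> complex \<Rightarrow> bool" where
  "negative_type A B l \<longleftrightarrow> l \<in> eigenvalues (pencil A B) \<and>
     (\<exists>\<epsilon>>0. \<forall>y\<in>kernel (pencil A B l).
        pairing (B y) y \<le> complex_of_real (- \<epsilon> * (sob_norm y)\<^sup>2))"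

subsection \<open>The pencil of the boundary value problem\<close>

definition dirichlet :: "cfun \<Rightarrow> functional" where
  "dirichlet y = (\<lambda>z. if z \<in> sobolev
     then LINT x|lebesgue_on {0..1}. wderiv y x * cnj (wderiv z x) else 0)"

definition weight :: "functional \<Rightarrow> cfun \<Rightarrow> functional" where
  "weight \<rho> y = (\<lambda>z. if z \<in> sobolev then pairing \<rho> (\<lambda>x. cnj (y x) * z x) else 0)"

abbreviation T_pencil :: "functional \<Rightarrow> complex \<Rightarrow> cfun \<Rightarrow> functional" where
  "T_pencil \<rho> \<equiv> pencil dirichlet (weight \<rho>)"

end

theory Submission
  imports Defs "HOL-Complex_Analysis.Great_Picard"
begin

text \<open>
  By the Riesz representation theorem the bounded antilinear functionals on the Sobolev space are
  the functionals \<open>z \<mapsto> \<integral> v' cnj z'\<close>, and a density argument identifies them with the dual space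
  (\<open>antidual_eq\<close>, \<open>sobolev_dual_eq\<close>). Under this identification \<open>T_pencil \<rho> l\<close> becomes \<open>1 - l K\<close>
  for a bounded operator \<open>K\<close> of the Sobolev space (\<open>T_pencil_fn\<close>). Since \<open>\<rho>\<close> is real, \<open>K\<close> is
  self-adjoint (\<open>K_selfadjoint\<close>). Since \<open>\<rho>\<close> is a limit of square integrable functions and the
  Sobolev space embeds compactly into the continuous functions, \<open>K\<close> is compact (\<open>K_compact\<close>).

  The rest is spectral theory of \<open>K\<close>. The Fredholm alternative shows that points other than
  eigenvalues are not in the spectrum, and compactness that only finitely many eigenvalues lie in a
  bounded set. For an eigenvector \<open>y\<close> the equation gives \<open>\<parallel>y\<parallel>\<^sup>2 = \<mu> \<rho>[y, y]\<close>; hence \<open>\<mu>\<close> is real and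
  nonzero, the form \<open>\<rho>[y, y]\<close> is definite with the sign of \<open>\<mu>\<close>, and there are no associated
  vectors (\<open>eigen_real\<close>, \<open>eigen_form\<close>, \<open>root_space_eq\<close>).

  Eigenspaces are one-dimensional because the distributional equation can be integrated once: if
  \<open>\<rho>\<close> is represented by \<open>v\<close>, an eigenfunction satisfies \<open>y' = c + l (v' y - \<integral>\<^sub>0\<^sup>x v' y')\<close> with a
  constant \<open>c\<close>, and \<open>c = 0\<close> forces \<open>y = 0\<close> by Gronwall's lemma (\<open>eigenspace_one_dimensional\<close>).

  For the index, the form of \<open>1 - l K\<close> is uniformly negative on the span of the eigenvectors with
  eigenvalues between \<open>0\<close> and \<open>l\<close> (\<open>negative_span\<close>) and nonnegative on its orthogonal complement
  (\<open>nonnegative_complement\<close>), by the variational characterisation of the largest eigenvalue. Thus a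
  negative subspace has at most the dimension of that span (\<open>ind_eq\<close>). Both signs of \<open>l\<close> are treated
  at once.
\<close>

section \<open>Hilbert spaces and compact operators\<close>

text \<open>A minimising sequence for the distance from \<open>x\<close> to \<open>S\<close> is Cauchy by the
  parallelogram identity; its limit is the projection.\<close>

lemma orthogonal_projection_exists:
  fixes S :: "'a::{real_inner,complete_space} set"
  assumes S: "subspace S" and cl: "closed S"
  shows "\<exists>p\<in>S. \<forall>s\<in>S. (x - p) \<bullet> s = 0"
proof -
  define d where "d = (INF s\<in>S. (norm (x - s))\<^sup>2)"
  have ne: "S \<noteq> {}" using subspace_0[OF S] by auto
  have bdd: "bdd_below ((\<lambda>s. (norm (x - s))\<^sup>2) ` S)" by (intro bdd_belowI2[of _ 0]) simp
  have dle: "d \<le> (norm (x - s))\<^sup>2" if "s \<in> S" for s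
    unfolding d_def by (rule cINF_lower[OF bdd that])
  have "\<exists>s\<in>S. (norm (x - s))\<^sup>2 < d + 1 / real (Suc n)" for n
    using cINF_less_iff[OF ne bdd, of "d + 1 / real (Suc n)"] unfolding d_def[symmetric] by auto
  then obtain s where s: "\<And>n. s n \<in> S" "\<And>n. (norm (x - s n))\<^sup>2 < d + 1 / real (Suc n)" by metis
  have key: "(norm (s m - s n))\<^sup>2 \<le> 2 / real (Suc m) + 2 / real (Suc n)" for m n
  proof -
    have "(1/2) *\<^sub>R (s m + s n) \<in> S" by (intro subspace_scale[OF S] subspace_add[OF S] s)
    from dle[OF this] have 1: "4 * d \<le> 4 * (norm (x - (1/2) *\<^sub>R (s m + s n)))\<^sup>2" by simp
    have "(norm (s m - s n))\<^sup>2 + 4 * (norm (x - (1/2) *\<^sub>R (s m + s n)))\<^sup>2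
        = 2 * (norm (x - s m))\<^sup>2 + 2 * (norm (x - s n))\<^sup>2"
      unfolding power2_norm_eq_inner
      by (simp add: inner_diff_left inner_diff_right inner_add_left inner_add_right inner_commute algebra_simps)
    with 1 s(2)[of m] s(2)[of n] show ?thesis by simp
  qed
  have "Cauchy s"
    unfolding Cauchy_iff
  proof (intro allI impI)
    fix e :: real assume e: "e > 0"
    obtain N where N: "4 / e\<^sup>2 < real N" using reals_Archimedean2 by blast
    show "\<exists>M. \<forall>m\<ge>M. \<forall>n\<ge>M. norm (s m - s n) < e"
    proof (intro exI[of _ N] allI impI)
      fix m n assume mn: "m \<ge> N" "n \<ge> N"
      have N0: "real N > 0" using N e by (smt (verit) divide_pos_pos zero_less_power)
      have "2 / real (Suc m) \<le> 2 / real N" "2 / real (Suc n) \<le> 2 / real N"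
        using mn N0 by (auto intro!: divide_left_mono)
      with key[of m n] have "(norm (s m - s n))\<^sup>2 \<le> 4 / real N" by simp
      also have "\<dots> < e\<^sup>2" using N N0 e by (simp add: field_simps)
      finally show "norm (s m - s n) < e" using e by (simp add: power2_less_imp_less)
    qed
  qed
  then obtain p where p: "s \<longlonglongrightarrow> p" using convergent_eq_Cauchy by blast
  have pS: "p \<in> S" using cl p s(1) closed_sequentially by blast
  have pd: "(norm (x - p))\<^sup>2 \<le> d"
  proof (rule LIMSEQ_le)
    show "(\<lambda>n. (norm (x - s n))\<^sup>2) \<longlonglongrightarrow> (norm (x - p))\<^sup>2" by (intro tendsto_intros p)
    show "(\<lambda>n. d + 1 / real (Suc n)) \<longlonglongrightarrow> d" using LIMSEQ_inverse_real_of_nat_add[of d] by (simp add: inverse_eq_divide)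
    show "\<exists>N. \<forall>n\<ge>N. (norm (x - s n))\<^sup>2 \<le> d + 1 / real (Suc n)" using s(2) less_imp_le by blast
  qed
  have "(x - p) \<bullet> t = 0" if t: "t \<in> S" for t
  proof (cases "t = 0")
    case False
    define a where "a = (x - p) \<bullet> t / (norm t)\<^sup>2"
    have "p + a *\<^sub>R t \<in> S" by (intro subspace_add[OF S] subspace_scale[OF S] pS t)
    from order_trans[OF pd dle[OF this]] have "(norm (x - p))\<^sup>2 \<le> (norm ((x - p) - a *\<^sub>R t))\<^sup>2" unfolding diff_diff_eq .
    also have "\<dots> = (norm (x - p))\<^sup>2 - 2 * a * ((x - p) \<bullet> t) + a\<^sup>2 * (norm t)\<^sup>2"
      unfolding power2_norm_eq_inner
      by (simp add: inner_diff_left inner_diff_right inner_commute algebra_simps power2_eq_square)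
    also have "a\<^sup>2 * (norm t)\<^sup>2 = a * ((x - p) \<bullet> t)" using False by (simp add: a_def power2_eq_square)
    finally have "a * ((x - p) \<bullet> t) \<le> 0" by simp
    moreover have "a * ((x - p) \<bullet> t) = ((x - p) \<bullet> t)\<^sup>2 / (norm t)\<^sup>2" by (simp add: a_def power2_eq_square)
    ultimately have "((x - p) \<bullet> t)\<^sup>2 \<le> 0" using False by (auto simp: divide_le_0_iff)
    then show ?thesis by simp
  qed simp
  with pS show ?thesis by blast
qed

lemma closed_subspace_eq_UNIV:
  fixes S :: "'a::{real_inner,complete_space} set"
  assumes "subspace S" "closed S" "\<And>v. (\<And>s. s \<in> S \<Longrightarrow> s \<bullet> v = 0) \<Longrightarrow> v = 0"
  shows "S = UNIV"
proof -
  have "x \<in> S" for x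
  proof -
    obtain p where p: "p \<in> S" "\<forall>s\<in>S. (x - p) \<bullet> s = 0" using orthogonal_projection_exists[OF assms(1,2)] by blast
    then have "x - p = 0" by (intro assms(3)) (simp add: inner_commute)
    with p show ?thesis by simp
  qed
  then show ?thesis by auto
qed

lemma riesz_representation:
  fixes f :: "'a::{real_inner,complete_space} \<Rightarrow> real"
  assumes "bounded_linear f"
  shows "\<exists>v. \<forall>z. f z = v \<bullet> z"
proof (cases "\<forall>x. f x = 0")
  case True then show ?thesis by (intro exI[of _ 0]) simp
next
  case False
  then obtain x where x: "f x \<noteq> 0" by blast
  interpret f: bounded_linear f by fact
  let ?S = "{z. f z = 0}"
  have S: "subspace ?S" by (auto simp: subspace_def f.add f.scaleR f.zero)
  have "closed ?S" by (intro closed_Collect_eq continuous_intros f.continuous_on)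
  then obtain p where p: "f p = 0" "\<And>s. f s = 0 \<Longrightarrow> (x - p) \<bullet> s = 0"
    using orthogonal_projection_exists[OF S, of x] by auto
  define w where "w = x - p"
  have fw: "f w \<noteq> 0" using x p by (simp add: w_def f.diff)
  have ww: "w \<bullet> w \<noteq> 0" using fw f.zero by auto
  have "f z = ((f w / (w \<bullet> w)) *\<^sub>R w) \<bullet> z" for z
  proof -
    have "f (z - (f z / f w) *\<^sub>R w) = 0" using fw by (simp add: f.diff f.scaleR)
    then have "w \<bullet> (z - (f z / f w) *\<^sub>R w) = 0" using p unfolding w_def by blast
    then show ?thesis using fw ww by (simp add: inner_diff_right field_simps)
  qed
  then show ?thesis by blast
qed

lemma bounded_below_dense_range_bij:
  fixes S :: "'a::{real_inner,complete_space} \<Rightarrow> 'a"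
  assumes S: "bounded_linear S" and c: "c > 0" "\<And>x. c * norm x \<le> norm (S x)"
    and dense: "\<And>v. (\<And>x. S x \<bullet> v = 0) \<Longrightarrow> v = 0"
  shows "bij S"
proof -
  interpret S: bounded_linear S by fact
  have "inj S"
  proof (rule injI)
    fix x y assume "S x = S y"
    then have "S (x - y) = 0" by (simp add: S.diff)
    with c(2)[of "x - y"] c(1) show "x = y" by (simp add: mult_le_0_iff)
  qed
  moreover have "complete (range S)"
    by (rule complete_isometric_image[OF c(1) _ S]) (use c in \<open>auto simp: complete_UNIV\<close>)
  then have "range S = UNIV"
    using dense by (intro closed_subspace_eq_UNIV complete_imp_closed)
      (auto simp: S.linear_axioms intro!: linear_subspace_image subspace_UNIV)
  ultimately show ?thesis by (simp add: bij_def)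
qed

text \<open>Sequential compactness of a map: it sends every bounded sequence to a sequence
  with a convergent subsequence.\<close>

definition compact_op :: "('a::real_normed_vector \<Rightarrow> 'b::real_normed_vector) \<Rightarrow> bool" where
  "compact_op K \<longleftrightarrow> (\<forall>s::nat \<Rightarrow> 'a. bounded (range s) \<longrightarrow> (\<exists>r. strict_mono r \<and> convergent (\<lambda>n. K (s (r n)))))"

text \<open>The compactness half of the Fredholm alternative: if \<open>1 - A\<close> were not bounded below,
  a normalised sequence on which it tends to zero would converge, along a subsequence, to a fixed
  vector of \<open>A\<close>.\<close>

lemma compact_op_bounded_below:
  fixes A :: "'a::real_normed_vector \<Rightarrow> 'a"
  assumes A: "bounded_linear A" and K: "compact_op A" and inj: "\<And>v. A v = v \<Longrightarrow> v = 0"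
  shows "\<exists>c>0. \<forall>x. c * norm x \<le> norm (x - A x)"
proof (rule ccontr)
  interpret A: bounded_linear A by fact
  assume no: "\<not> ?thesis"
  have "\<exists>x. norm x = 1 \<and> norm (x - A x) < 1 / real (Suc n)" for n
  proof -
    obtain x where x: "norm (x - A x) < 1 / real (Suc n) * norm x"
      using no by (metis not_le zero_less_divide_1_iff of_nat_0_less_iff zero_less_Suc)
    then have x0: "x \<noteq> 0" by auto
    have "sgn x - A (sgn x) = (x - A x) /\<^sub>R norm x" by (simp add: sgn_div_norm A.scaleR scaleR_diff_right)
    then have "norm (sgn x - A (sgn x)) = norm (x - A x) / norm x" by (simp add: divide_inverse_commute)
    also have "\<dots> < 1 / real (Suc n)" using x x0 by (simp add: divide_simps mult.commute)
    finally show ?thesis using x0 by (intro exI[of _ "sgn x"]) (simp add: norm_sgn)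
  qed
  then obtain x where x: "\<And>n. norm (x n) = 1" "\<And>n. norm (x n - A (x n)) < 1 / real (Suc n)" by metis
  have "bounded (range x)" by (rule boundedI[of _ 1]) (auto simp: x)
  then obtain r l where r: "strict_mono r" and l: "(\<lambda>n. A (x (r n))) \<longlonglongrightarrow> l"
    using K unfolding compact_op_def convergent_def by blast
  have "(\<lambda>n. x n - A (x n)) \<longlonglongrightarrow> 0"
    by (rule tendsto_norm_zero_cancel, rule tendsto_sandwich[OF _ _ tendsto_const LIMSEQ_inverse_real_of_nat])
      (use x(2) in \<open>auto simp: inverse_eq_divide intro!: always_eventually less_imp_le\<close>)
  from LIMSEQ_subseq_LIMSEQ[OF this r] have "(\<lambda>n. x (r n) - A (x (r n))) \<longlonglongrightarrow> 0" by (simp add: o_def)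
  from tendsto_add[OF this l] have xl: "(\<lambda>n. x (r n)) \<longlonglongrightarrow> l" by simp
  from LIMSEQ_unique[OF A.tendsto[OF this] l] have "l = 0" by (rule inj)
  with tendsto_norm[OF xl] show False by (simp add: x LIMSEQ_const_iff)
qed

text \<open>The variational principle on a closed invariant subspace \<open>W\<close>: if the Rayleigh quotient of \<open>A\<close>
  exceeds \<open>1\<close> somewhere on \<open>W\<close>, its supremum \<open>\<kappa>\<close> is attained and is an eigenvalue.\<close>

lemma compact_selfadjoint_eigenvector:
  fixes A :: "'a::real_inner \<Rightarrow> 'a"
  assumes A: "bounded_linear A" and K: "compact_op A"
    and sym: "\<And>x y. A x \<bullet> y = x \<bullet> A y"
    and W: "subspace W" "closed W" "\<And>x. x \<in> W \<Longrightarrow> A x \<in> W"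
    and w: "w \<in> W" "A w \<bullet> w > w \<bullet> w"
  shows "\<exists>\<kappa>>1. \<exists>v\<in>W. v \<noteq> 0 \<and> A v = \<kappa> *\<^sub>R v"
proof -
  interpret A: bounded_linear A by fact
  obtain C where C: "C > 0" "\<And>x. norm (A x) \<le> norm x * C" using A.pos_bounded by blast
  let ?U = "{x \<in> W. norm x = 1}"
  define \<kappa> where "\<kappa> = (SUP x\<in>?U. A x \<bullet> x)"
  have w0: "w \<noteq> 0" using w by auto
  have U: "sgn x \<in> ?U" if "x \<in> W" "x \<noteq> 0" for x
    using that by (simp add: sgn_div_norm subspace_scale[OF W(1)])
  have bdd: "bdd_above ((\<lambda>x. A x \<bullet> x) ` ?U)"
  proof (rule bdd_aboveI2)
    fix x assume "x \<in> ?U"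
    then show "A x \<bullet> x \<le> C" using norm_cauchy_schwarz[of "A x" x] C(2)[of x] by simp
  qed
  have le1: "A x \<bullet> x \<le> \<kappa>" if "x \<in> ?U" for x unfolding \<kappa>_def by (rule cSUP_upper[OF that bdd])
  have quad: "A (sgn x) \<bullet> sgn x = (A x \<bullet> x) / (x \<bullet> x)" for x
    by (simp add: sgn_div_norm A.scaleR power2_norm_eq_inner[symmetric] power2_eq_square divide_simps)
  have le: "A x \<bullet> x \<le> \<kappa> * (x \<bullet> x)" if "x \<in> W" for x
  proof (cases "x = 0")
    case False
    with le1[OF U[OF that False]] show ?thesis unfolding quad by (simp add: pos_divide_le_eq)
  qed simp
  have \<kappa>1: "\<kappa> > 1"
  proof -
    have "1 < A (sgn w) \<bullet> sgn w" unfolding quad using w w0 by (simp add: less_divide_eq_1)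
    then show ?thesis using le1[OF U[OF w(1) w0]] by simp
  qed
  have Une: "?U \<noteq> {}" using U[OF w(1) w0] by blast
  have "\<exists>x\<in>?U. \<kappa> - 1 / real (Suc n) < A x \<bullet> x" for n
    using less_cSUP_iff[OF Une bdd, of "\<kappa> - 1 / real (Suc n)"] unfolding \<kappa>_def[symmetric] by simp
  then obtain x where x: "\<And>n. x n \<in> W" "\<And>n. norm (x n) = 1" "\<And>n. \<kappa> - 1 / real (Suc n) < A (x n) \<bullet> x n"
    by (metis (mono_tags, lifting) mem_Collect_eq)
  define B where "B x = \<kappa> *\<^sub>R x - A x" for x
  define Q where "Q x y = B x \<bullet> y" for x y
  have Bl: "B (a *\<^sub>R x + b *\<^sub>R y) = a *\<^sub>R B x + b *\<^sub>R B y" for a b x y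
    by (simp add: B_def A.add A.scaleR algebra_simps)
  have BW: "x \<in> W \<Longrightarrow> B x \<in> W" for x
    unfolding B_def by (intro subspace_diff[OF W(1)] subspace_scale[OF W(1)] W(3))
  have Qsym: "Q x y = Q y x" for x y unfolding Q_def B_def inner_diff_left using sym[of x y] inner_commute[of y x] inner_commute[of "A y" x] by simp
  have Qpos: "x \<in> W \<Longrightarrow> Q x x \<ge> 0" for x using le[of x] by (simp add: Q_def B_def inner_diff_left)
  \<comment> \<open>The form \<open>Q\<close> is positive semidefinite; evaluating it at \<open>b x - B x\<close> bounds \<open>B x\<close> by \<open>Q x x\<close>.\<close>
  have QB: "(norm (B x))\<^sup>2 \<le> Q x x * (\<kappa> + C)" if "x \<in> W" for x
  proof -
    define b where "b = \<kappa> + C"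
    have b: "b > 0" using C \<kappa>1 by (simp add: b_def)
    let ?y = "b *\<^sub>R x - B x"
    have "0 \<le> Q ?y ?y" by (intro Qpos subspace_diff[OF W(1)] subspace_scale[OF W(1)] BW that)
    also have "Q ?y ?y = b\<^sup>2 * Q x x - 2 * b * Q x (B x) + Q (B x) (B x)"
    proof -
      have By: "B ?y = b *\<^sub>R B x - B (B x)" using Bl[of b x "-1" "B x"] by simp
      have BB: "B (B x) \<bullet> x = B x \<bullet> B x" using Qsym[of "B x" x] by (simp add: Q_def)
      have "Q ?y ?y = (b *\<^sub>R B x - B (B x)) \<bullet> ?y" by (simp only: Q_def By)
      also have "\<dots> = b * (b * (B x \<bullet> x)) - b * (B x \<bullet> B x) - b * (B (B x) \<bullet> x) + B (B x) \<bullet> B x"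
        by (simp add: inner_diff_left inner_diff_right algebra_simps)
      finally show ?thesis by (simp add: Q_def BB algebra_simps power2_eq_square)
    qed
    also have "Q x (B x) = (norm (B x))\<^sup>2" by (simp add: Q_def power2_norm_eq_inner)
    also have "Q (B x) (B x) \<le> b * (norm (B x))\<^sup>2"
    proof -
      have "norm (B (B x)) \<le> \<bar>\<kappa>\<bar> * norm (B x) + norm (B x) * C"
        unfolding B_def[of "B x"] using norm_triangle_ineq4[of "\<kappa> *\<^sub>R B x" "A (B x)"] C(2)[of "B x"] by simp
      then have "norm (B (B x)) \<le> b * norm (B x)" using \<kappa>1 by (simp add: b_def algebra_simps)
      then show ?thesis unfolding Q_def using norm_cauchy_schwarz[of "B (B x)" "B x"]
        by (smt (verit) mult.assoc mult_right_mono norm_ge_zero power2_eq_square)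
    qed
    finally have "0 \<le> b * (b * Q x x - (norm (B x))\<^sup>2)" by (simp add: algebra_simps power2_eq_square)
    then have "0 \<le> b * Q x x - (norm (B x))\<^sup>2" using b by (simp add: zero_le_mult_iff)
    then show ?thesis by (simp add: b_def mult.commute)
  qed
  have "(\<lambda>n. (norm (B (x n)))\<^sup>2) \<longlonglongrightarrow> 0"
  proof (rule tendsto_sandwich[OF _ _ tendsto_const])
    show "(\<lambda>n. inverse (real (Suc n)) * (\<kappa> + C)) \<longlonglongrightarrow> 0"
      using tendsto_mult_right[OF LIMSEQ_inverse_real_of_nat, of "\<kappa> + C"] by simp
    show "\<forall>\<^sub>F n in sequentially. (norm (B (x n)))\<^sup>2 \<le> inverse (real (Suc n)) * (\<kappa> + C)"
    proof (intro always_eventually allI)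
      fix n
      have "Q (x n) (x n) \<le> inverse (real (Suc n))"
        using x(2,3)[of n] by (simp add: Q_def B_def inner_diff_left power2_norm_eq_inner[symmetric] inverse_eq_divide)
      then have "Q (x n) (x n) * (\<kappa> + C) \<le> inverse (real (Suc n)) * (\<kappa> + C)" using C \<kappa>1 by (intro mult_right_mono) auto
      with QB[OF x(1)[of n]] show "(norm (B (x n)))\<^sup>2 \<le> inverse (real (Suc n)) * (\<kappa> + C)" by simp
    qed
  qed auto
  from tendsto_real_sqrt[OF this] have B0: "(\<lambda>n. B (x n)) \<longlonglongrightarrow> 0"
    by (simp add: tendsto_norm_zero_iff)
  have "bounded (range x)" by (rule boundedI[of _ 1]) (auto simp: x)
  then obtain r l where r: "strict_mono r" and l: "(\<lambda>n. A (x (r n))) \<longlonglongrightarrow> l"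
    using K unfolding compact_op_def convergent_def by blast
  from LIMSEQ_subseq_LIMSEQ[OF B0 r] have "(\<lambda>n. B (x (r n))) \<longlonglongrightarrow> 0" by (simp add: o_def)
  from tendsto_add[OF this l] have "(\<lambda>n. \<kappa> *\<^sub>R x (r n)) \<longlonglongrightarrow> l" by (simp add: B_def)
  from tendsto_scaleR[OF tendsto_const[of "1/\<kappa>"] this] have xl: "(\<lambda>n. x (r n)) \<longlonglongrightarrow> (1/\<kappa>) *\<^sub>R l"
    using \<kappa>1 by simp
  define v where "v = (1/\<kappa>) *\<^sub>R l"
  have "A v = l" using LIMSEQ_unique[OF A.tendsto[OF xl] l] by (simp add: v_def)
  then have "A v = \<kappa> *\<^sub>R v" using \<kappa>1 by (simp add: v_def)
  moreover have "v \<in> W" using closed_sequentially[OF W(2), of "\<lambda>n. x (r n)" v] xl x unfolding v_def by blast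
  moreover have "v \<noteq> 0" using tendsto_norm[OF xl] unfolding v_def[symmetric] by (auto simp: x LIMSEQ_const_iff)
  ultimately show ?thesis using \<kappa>1 by blast
qed

text \<open>The images of two members of an orthonormal family of eigenvectors with eigenvalues at least
  \<open>\<delta>\<close> in absolute value are at distance at least \<open>\<delta>\<close>, so an infinite family has no convergent
  subsequence of images.\<close>

lemma compact_op_orthonormal_finite:
  fixes K :: "'a::real_inner \<Rightarrow> 'a"
  assumes K: "compact_op K" and \<delta>: "\<delta> > 0"
    and e: "\<And>i. i \<in> I \<Longrightarrow> norm (e i) = 1" "\<And>i j. i \<in> I \<Longrightarrow> j \<in> I \<Longrightarrow> i \<noteq> j \<Longrightarrow> e i \<bullet> e j = 0"
    and ev: "\<And>i. i \<in> I \<Longrightarrow> K (e i) = a i *\<^sub>R e i" "\<And>i. i \<in> I \<Longrightarrow> \<bar>a i\<bar> \<ge> \<delta>"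
  shows "finite I"
proof (rule ccontr)
  assume "infinite I"
  then obtain f :: "nat \<Rightarrow> _" where f: "inj f" "range f \<subseteq> I" using infinite_countable_subset by blast
  then have fI: "f n \<in> I" for n by blast
  have "bounded (range (\<lambda>n. e (f n)))" by (rule boundedI[of _ 1]) (use e(1) fI in auto)
  then obtain r where r: "strict_mono r" and l: "convergent (\<lambda>n. K (e (f (r n))))"
    using K unfolding compact_op_def by blast
  from l have "Cauchy (\<lambda>n. K (e (f (r n))))" by (rule convergent_Cauchy)
  then obtain N where N: "\<And>m n. m \<ge> N \<Longrightarrow> n \<ge> N \<Longrightarrow> norm (K (e (f (r m))) - K (e (f (r n)))) < \<delta>"
    using \<delta> unfolding Cauchy_iff by blast
  define i j where ij: "i = f (r N)" "j = f (r (Suc N))"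
  have "i \<noteq> j" using f(1) r by (metis ij inj_eq n_not_Suc_n strict_mono_eq)
  have I: "i \<in> I" "j \<in> I" using fI by (auto simp: ij)
  have "(norm (K (e i) - K (e j)))\<^sup>2 = (a i)\<^sup>2 + (a j)\<^sup>2"
  proof -
    have "e i \<bullet> e i = 1" "e j \<bullet> e j = 1" "e i \<bullet> e j = 0" "e j \<bullet> e i = 0"
      using e I \<open>i \<noteq> j\<close> by (auto simp: norm_eq_1[symmetric])
    then show ?thesis using ev(1) I
      unfolding power2_norm_eq_inner by (simp add: inner_diff_left inner_diff_right power2_eq_square)
  qed
  moreover have "norm (K (e i) - K (e j)) < \<delta>" using N by (simp add: ij)
  then have "(norm (K (e i) - K (e j)))\<^sup>2 < \<delta>\<^sup>2" by (intro power_strict_mono) auto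
  moreover have "(a i)\<^sup>2 \<ge> \<delta>\<^sup>2" using ev(2)[OF I(1)] \<delta> by (metis abs_le_square_iff abs_of_pos)
  ultimately show False by (smt (verit) zero_le_power2)
qed

section \<open>Square integrable functions on the unit interval\<close>

text \<open>Lebesgue measure on the unit interval.\<close>

abbreviation U :: "real measure" where "U \<equiv> lebesgue_on {0..1}"

text \<open>The primitive of \<open>g\<close> that vanishes at \<open>0\<close>; it is used on \<open>{0..1}\<close> only.\<close>

definition prim :: "cfun \<Rightarrow> cfun" where
  "prim g x = (LINT t|lebesgue_on {0..x}. g t)"

lemma finite_measure_U: "finite_measure U"
  by (intro finite_measure_lebesgue_on) auto

interpretation U: finite_measure U by (rule finite_measure_U)

interpretation UU: pair_sigma_finite U U ..

lemma measure_U: "measure U {0..1} = 1" "measure U (space U) = 1"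
  by (auto simp: measure_restrict_space)

lemma L2_measurable [measurable_dest]: "f \<in> L2 \<Longrightarrow> f \<in> borel_measurable U"
  by (simp add: L2_def)

lemma L2_integrable_sq: "f \<in> L2 \<Longrightarrow> integrable U (\<lambda>x. (cmod (f x))\<^sup>2)"
  by (simp add: L2_def)

lemma L2I: 
  assumes [measurable]: "f \<in> borel_measurable U"
    and "integrable U h" "\<And>x. x \<in> {0..1} \<Longrightarrow> (cmod (f x))\<^sup>2 \<le> h x"
  shows "f \<in> L2"
  unfolding L2_def
proof (intro CollectI conjI assms(1))
  show "integrable U (\<lambda>x. (cmod (f x))\<^sup>2)"
    by (rule Bochner_Integration.integrable_bound[OF assms(2)])
      (use assms(3) in \<open>fastforce intro!: AE_I2\<close>)+
qed

lemma L2_bounded_mult: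
  assumes [measurable]: "b \<in> borel_measurable U" and f: "f \<in> L2"
    and C: "\<And>x. x \<in> {0..1} \<Longrightarrow> cmod (b x) \<le> C"
  shows "(\<lambda>x. b x * f x) \<in> L2"
proof (rule L2I)
  show "(\<lambda>x. b x * f x) \<in> borel_measurable U" using f by measurable
  show "integrable U (\<lambda>x. C\<^sup>2 * (cmod (f x))\<^sup>2)" using L2_integrable_sq[OF f] by simp
  show "(cmod (b x * f x))\<^sup>2 \<le> C\<^sup>2 * (cmod (f x))\<^sup>2" if "x \<in> {0..1}" for x
    unfolding norm_mult power_mult_distrib using C[OF that]
    by (intro mult_right_mono power_mono) auto
qed

lemma L2_add: assumes f: "f \<in> L2" "g \<in> L2" shows "(\<lambda>x. f x + g x) \<in> L2"
proof (rule L2I)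
  show "(\<lambda>x. f x + g x) \<in> borel_measurable U" using f by measurable
  show "integrable U (\<lambda>x. 2 * (cmod (f x))\<^sup>2 + 2 * (cmod (g x))\<^sup>2)" using f[THEN L2_integrable_sq] by simp
  show "(cmod (f x + g x))\<^sup>2 \<le> 2 * (cmod (f x))\<^sup>2 + 2 * (cmod (g x))\<^sup>2" for x
  proof -
    have "(cmod (f x + g x))\<^sup>2 \<le> (cmod (f x) + cmod (g x))\<^sup>2" by (intro power_mono norm_triangle_ineq) auto
    then show ?thesis using sum_squares_bound[of "cmod (f x)" "cmod (g x)"] by (simp add: power2_sum)
  qed
qed

lemma L2_scale: "f \<in> L2 \<Longrightarrow> (\<lambda>x. c * f x) \<in> L2"
  by (rule L2_bounded_mult[of "\<lambda>_. c" _ "cmod c"]) auto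

lemma L2_diff: "f \<in> L2 \<Longrightarrow> g \<in> L2 \<Longrightarrow> (\<lambda>x. f x - g x) \<in> L2"
  using L2_add[of f "\<lambda>x. (-1) * g x"] L2_scale[of g "-1"] by simp

lemma L2_cnj: "f \<in> L2 \<Longrightarrow> (\<lambda>x. cnj (f x)) \<in> L2"
  unfolding L2_def
  using measurable_compose[of f U borel cnj borel, OF _ borel_measurable_continuous_onI[OF continuous_on_cnj[OF continuous_on_id]]]
  by auto

lemma L2_bounded:
  assumes "b \<in> borel_measurable U" "\<And>x. x \<in> {0..1} \<Longrightarrow> cmod (b x) \<le> C"
  shows "b \<in> L2"
  using L2_bounded_mult[of b "\<lambda>_. 1" C] assms by (simp add: L2_def)

lemma L2_const: "(\<lambda>x. c) \<in> L2"
  by (rule L2_bounded[of _ "cmod c"]) auto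

lemma L2_mult_integrable:
  assumes f: "f \<in> L2" "g \<in> L2" shows "integrable U (\<lambda>x. f x * g x)"
proof (rule Bochner_Integration.integrable_bound)
  show "integrable U (\<lambda>x. (cmod (f x))\<^sup>2 + (cmod (g x))\<^sup>2)" using f[THEN L2_integrable_sq] by simp
  show "(\<lambda>x. f x * g x) \<in> borel_measurable U" using f by measurable
  have "cmod (f x * g x) \<le> (cmod (f x))\<^sup>2 + (cmod (g x))\<^sup>2" for x
    using sum_squares_bound[of "cmod (f x)" "cmod (g x)"] mult_nonneg_nonneg[OF norm_ge_zero norm_ge_zero, of "f x" "g x"]
    unfolding norm_mult by linarith
  then show "AE x in U. cmod (f x * g x) \<le> norm ((cmod (f x))\<^sup>2 + (cmod (g x))\<^sup>2)" by simp
qed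

lemma L2_integrable: "f \<in> L2 \<Longrightarrow> integrable U f"
  using L2_mult_integrable[of f "\<lambda>_. 1"] L2_const by simp

lemma L2_norm_sq: "(L2_norm f)\<^sup>2 = (LINT x|U. (cmod (f x))\<^sup>2)"
  unfolding L2_norm_def by (intro real_sqrt_pow2 integral_nonneg_AE) auto

lemma L2_norm_nonneg: "L2_norm f \<ge> 0"
  unfolding L2_norm_def by (intro real_sqrt_ge_zero integral_nonneg_AE) auto

lemma L2_norm_cong_AE:
  assumes "AE x in U. f x = g x" "f \<in> borel_measurable U" "g \<in> borel_measurable U"
  shows "L2_norm f = L2_norm g"
  unfolding L2_norm_def by (rule arg_cong[where f=sqrt], rule integral_cong_AE) (use assms in auto)

lemma L2_norm_cmod_eq: "(\<And>x. x \<in> {0..1} \<Longrightarrow> cmod (f x) = cmod (g x)) \<Longrightarrow> L2_norm f = L2_norm g"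
  unfolding L2_norm_def by (intro arg_cong[where f=sqrt] Bochner_Integration.integral_cong) auto

lemma L2_norm_eq_0:
  assumes f: "f \<in> L2" and "L2_norm f = 0" shows "AE x in U. f x = 0"
proof -
  have "(LINT x|U. (cmod (f x))\<^sup>2) = 0" using assms(2) L2_norm_sq[of f] by simp
  then show ?thesis using integral_nonneg_eq_0_iff_AE[OF L2_integrable_sq[OF f]] by simp
qed

lemma L2_Cauchy_Schwarz_norm:
  assumes f: "f \<in> L2" "g \<in> L2"
  shows "(LINT x|U. cmod (f x * g x)) \<le> L2_norm f * L2_norm g"
proof -
  note [measurable] = f[THEN L2_measurable]
  let ?B = "LINT x|U. cmod (f x * g x)"
  have B: "(\<integral>\<^sup>+x. ennreal (cmod (f x)) * ennreal (cmod (g x)) \<partial>U) = ennreal ?B"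
    using nn_integral_eq_integral[OF integrable_norm[OF L2_mult_integrable[OF f]]]
    by (simp add: norm_mult ennreal_mult)
  have F: "(\<integral>\<^sup>+x. ennreal (cmod (h x)) ^ 2 \<partial>U) = ennreal ((L2_norm h)\<^sup>2)" if "h \<in> L2" for h
    using nn_integral_eq_integral[OF L2_integrable_sq[OF that]] by (simp add: L2_norm_sq ennreal_power)
  have "ennreal ?B ^ 2 \<le> ennreal ((L2_norm f)\<^sup>2) * ennreal ((L2_norm g)\<^sup>2)"
    using Cauchy_Schwarz_nn_integral[of "\<lambda>x. ennreal (cmod (f x))" U "\<lambda>x. ennreal (cmod (g x))"]
    unfolding B F[OF f(1)] F[OF f(2)] by simp
  then have "ennreal (?B\<^sup>2) \<le> ennreal ((L2_norm f * L2_norm g)\<^sup>2)"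
    by (simp add: ennreal_power ennreal_mult[symmetric] power_mult_distrib)
  then have "?B\<^sup>2 \<le> (L2_norm f * L2_norm g)\<^sup>2" by (subst (asm) ennreal_le_iff) auto
  then show ?thesis by (rule power2_le_imp_le) (simp add: L2_norm_nonneg)
qed

lemma L2_Cauchy_Schwarz:
  assumes "f \<in> L2" "g \<in> L2"
  shows "cmod (LINT x|U. f x * g x) \<le> L2_norm f * L2_norm g"
  using integral_norm_bound[of U "\<lambda>x. f x * g x"] L2_Cauchy_Schwarz_norm[OF assms] by linarith

lemma nn_integral_L2: "h \<in> L2 \<Longrightarrow> (\<integral>\<^sup>+x. ennreal ((cmod (h x))\<^sup>2) \<partial>U) = ennreal ((L2_norm h)\<^sup>2)"
  using nn_integral_eq_integral[OF L2_integrable_sq] by (simp add: L2_norm_sq)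

text \<open>The Riesz-Fischer theorem. A subsequence with summable increments converges almost
  everywhere, and Fatou's lemma turns this into convergence in norm of the whole sequence.\<close>

lemma L2_complete:
  fixes f :: "nat \<Rightarrow> cfun"
  assumes f: "\<And>n. f n \<in> L2"
    and C: "\<And>e. e > 0 \<Longrightarrow> \<exists>N. \<forall>m\<ge>N. \<forall>n\<ge>N. L2_norm (\<lambda>x. f m x - f n x) < e"
  shows "\<exists>g\<in>L2. (\<lambda>n. L2_norm (\<lambda>x. f n x - g x)) \<longlonglongrightarrow> 0"
proof -
  have [measurable]: "f n \<in> borel_measurable U" for n using f by measurable
  have "\<forall>k. \<exists>N. \<forall>m\<ge>N. \<forall>n\<ge>N. L2_norm (\<lambda>x. f m x - f n x) < (1/2) ^ k" using C by simp
  then obtain R where R: "\<And>k m n. m \<ge> R k \<Longrightarrow> n \<ge> R k \<Longrightarrow> L2_norm (\<lambda>x. f m x - f n x) < (1/2) ^ k"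
    by metis
  define r where "r k = (\<Sum>i\<le>k. R i) + k" for k
  have r: "R k \<le> r k" "r k \<le> r (Suc k)" "k \<le> r k" for k
    unfolding r_def using member_le_sum[of k "{..k}" R] by auto
  define d where "d k x = f (r (Suc k)) x - f (r k) x" for k x
  have dL2: "d k \<in> L2" for k using L2_diff[OF f f] by (simp add: d_def[abs_def])
  note [measurable] = dL2[THEN L2_measurable]
  have dn: "L2_norm (d k) \<le> (1/2) ^ k" for k
    using R[of k "r (Suc k)" "r k"] r[of k] by (simp add: d_def[abs_def])
  have "L2_norm (\<lambda>_. 1) = 1" by (simp add: L2_norm_def measure_U)
  then have d1: "(LINT x|U. cmod (d k x)) \<le> (1/2) ^ k" for k
    using L2_Cauchy_Schwarz_norm[OF dL2 L2_const, of k 1] dn[of k] by simp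
  have "(\<integral>\<^sup>+x. (\<Sum>k. ennreal (cmod (d k x))) \<partial>U) = (\<Sum>k. \<integral>\<^sup>+x. ennreal (cmod (d k x)) \<partial>U)"
    by (rule nn_integral_suminf) measurable
  also have "\<dots> = (\<Sum>k. ennreal (LINT x|U. cmod (d k x)))"
    by (intro suminf_cong nn_integral_eq_integral integrable_norm L2_integrable dL2) auto
  also have "\<dots> \<le> (\<Sum>k. ennreal ((1/2) ^ k))" by (intro suminf_le ennreal_leI d1) auto
  also have "\<dots> = ennreal (\<Sum>k. (1/2) ^ k)" by (rule suminf_ennreal_eq) (auto intro!: summable_sums summable_geometric)
  also have "\<dots> < \<infinity>" by simp
  finally have "AE x in U. (\<Sum>k. ennreal (cmod (d k x))) \<noteq> \<infinity>" by (intro nn_integral_PInf_AE) auto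
  then have conv: "AE x in U. convergent (\<lambda>k. f (r k) x)"
  proof eventually_elim
    case (elim x)
    then have "summable (\<lambda>k. cmod (d k x))" by (intro summable_suminf_not_top) auto
    then have "summable (\<lambda>k. d k x)" by (rule summable_norm_cancel)
    then have "convergent (\<lambda>n. \<Sum>k<n. d k x)" by (simp add: summable_iff_convergent)
    moreover have "(\<Sum>k<n. d k x) = f (r n) x - f (r 0) x" for n
      unfolding d_def by (rule sum_lessThan_telescope)
    ultimately have "convergent (\<lambda>n. f (r n) x - f (r 0) x)" by simp
    from convergent_add[OF this convergent_const[of "f (r 0) x"]] show ?case by simp
  qed
  define g where "g x = lim (\<lambda>k. f (r k) x)" for x
  have [measurable]: "g \<in> borel_measurable U" unfolding g_def[abs_def] by measurable
  have lim: "AE x in U. (\<lambda>k. f (r k) x) \<longlonglongrightarrow> g x"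
    using conv by eventually_elim (simp add: g_def convergent_LIMSEQ_iff)
  have close: "(\<integral>\<^sup>+x. ennreal ((cmod (f n x - g x))\<^sup>2) \<partial>U) \<le> ennreal (e\<^sup>2)"
    if e: "e > 0" and N: "\<And>m. m \<ge> n \<Longrightarrow> L2_norm (\<lambda>x. f n x - f m x) < e" for n e
  proof -
    have "(\<integral>\<^sup>+x. ennreal ((cmod (f n x - g x))\<^sup>2) \<partial>U) = (\<integral>\<^sup>+x. liminf (\<lambda>k. ennreal ((cmod (f n x - f (r k) x))\<^sup>2)) \<partial>U)"
    proof (rule nn_integral_cong_AE)
      show "AE x in U. ennreal ((cmod (f n x - g x))\<^sup>2) = liminf (\<lambda>k. ennreal ((cmod (f n x - f (r k) x))\<^sup>2))"
        using lim
      proof eventually_elim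
        case (elim x)
        have "(\<lambda>k. ennreal ((cmod (f n x - f (r k) x))\<^sup>2)) \<longlonglongrightarrow> ennreal ((cmod (f n x - g x))\<^sup>2)"
          by (intro tendsto_ennrealI tendsto_intros elim)
        from lim_imp_Liminf[OF _ this] show ?case by simp
      qed
    qed
    also have "\<dots> \<le> liminf (\<lambda>k. \<integral>\<^sup>+x. ennreal ((cmod (f n x - f (r k) x))\<^sup>2) \<partial>U)"
      by (rule nn_integral_liminf) measurable
    also have "\<dots> \<le> ennreal (e\<^sup>2)"
    proof (rule Liminf_le)
      show "\<forall>\<^sub>F k in sequentially. (\<integral>\<^sup>+x. ennreal ((cmod (f n x - f (r k) x))\<^sup>2) \<partial>U) \<le> ennreal (e\<^sup>2)"
        using eventually_ge_at_top[of n]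
      proof eventually_elim
        case (elim k)
        then have "L2_norm (\<lambda>x. f n x - f (r k) x) < e" using r(3)[of k] by (intro N) simp
        then have "(L2_norm (\<lambda>x. f n x - f (r k) x))\<^sup>2 \<le> e\<^sup>2" by (intro power_mono) (auto simp: L2_norm_nonneg)
        then show ?case unfolding nn_integral_L2[OF L2_diff[OF f f]] by (rule ennreal_leI)
      qed
    qed simp
    finally show ?thesis .
  qed
  have fin: "(\<lambda>x. f n x - g x) \<in> L2"
    if e: "e > 0" and N: "\<And>m. m \<ge> n \<Longrightarrow> L2_norm (\<lambda>x. f n x - f m x) < e" for n e
    unfolding L2_def integrable_iff_bounded using close[OF that] by (auto simp: le_less_trans[OF _ ennreal_less_top])
  have small: "L2_norm (\<lambda>x. f n x - g x) \<le> e"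
    if e: "e > 0" and N: "\<And>m. m \<ge> n \<Longrightarrow> L2_norm (\<lambda>x. f n x - f m x) < e" for n e
  proof -
    have "ennreal ((L2_norm (\<lambda>x. f n x - g x))\<^sup>2) \<le> ennreal (e\<^sup>2)"
      using close[OF that] nn_integral_L2[OF fin[OF that]] by simp
    then have "(L2_norm (\<lambda>x. f n x - g x))\<^sup>2 \<le> e\<^sup>2" by (subst (asm) ennreal_le_iff) auto
    then show ?thesis by (rule power2_le_imp_le) (use e in simp)
  qed
  obtain N where N: "\<And>m n. m \<ge> N \<Longrightarrow> n \<ge> N \<Longrightarrow> L2_norm (\<lambda>x. f m x - f n x) < 1" using C[of 1] by auto
  have "(\<lambda>x. f N x - (f N x - g x)) \<in> L2" by (intro L2_diff f fin[of 1 N]) (use N in auto)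
  then have "g \<in> L2" by simp
  moreover have "(\<lambda>n. L2_norm (\<lambda>x. f n x - g x)) \<longlonglongrightarrow> 0"
  proof (rule LIMSEQ_I)
    fix e :: real assume e: "e > 0"
    obtain N where N: "\<And>m n. m \<ge> N \<Longrightarrow> n \<ge> N \<Longrightarrow> L2_norm (\<lambda>x. f m x - f n x) < e / 2"
      using C[of "e/2"] e by auto
    show "\<exists>no. \<forall>n\<ge>no. norm (L2_norm (\<lambda>x. f n x - g x) - 0) < e"
    proof (intro exI[of _ N] allI impI)
      fix n assume "N \<le> n"
      then have "L2_norm (\<lambda>x. f n x - g x) \<le> e / 2" using e N by (intro small) auto
      then show "norm (L2_norm (\<lambda>x. f n x - g x) - 0) < e" using e by (simp add: L2_norm_nonneg)
    qed
  qed
  ultimately show ?thesis by blast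
qed

section \<open>Primitives\<close>

lemma borel_measurable_U_continuous: "continuous_on {0..1} f \<Longrightarrow> f \<in> borel_measurable U"
  by (rule continuous_imp_measurable_on_sets_lebesgue) auto

lemma id_borel_measurable_U [measurable]: "(\<lambda>x. x) \<in> borel_measurable U"
  by (rule borel_measurable_U_continuous) (rule continuous_on_id)

lemma prim_eq:
  assumes "x \<in> {0..1}" shows "prim g x = (LINT t|U. indicator {0..x} t *\<^sub>R g t)"
proof -
  have "prim g x = (LINT t|lebesgue. indicator {0..x} t *\<^sub>R g t)"
    unfolding prim_def by (rule integral_restrict_space) simp
  also have "\<dots> = (LINT t|lebesgue. indicator {0..1} t *\<^sub>R (indicator {0..x} t *\<^sub>R g t))"
    using assms by (intro Bochner_Integration.integral_cong) (auto split: split_indicator)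
  also have "\<dots> = (LINT t|U. indicator {0..x} t *\<^sub>R g t)"
    by (rule integral_restrict_space[symmetric]) simp
  finally show ?thesis .
qed

lemma prim_0: "prim g 0 = 0"
  unfolding prim_def
  by (intro integral_eq_zero_null_sets null_setsI) 
     (auto simp: emeasure_restrict_space)

lemma prim_1: "prim g 1 = (LINT t|U. g t)"
  by (simp add: prim_def)

lemma integrable_indicator_U [simp, intro]:
  fixes g :: "real \<Rightarrow> 'b::{banach,second_countable_topology}"
  assumes "integrable U g" and [measurable]: "A \<in> sets borel"
  shows "integrable U (\<lambda>t. indicator A t *\<^sub>R g t)"
proof (rule Bochner_Integration.integrable_bound[OF assms(1)])
  show "(\<lambda>t. indicator A t *\<^sub>R g t) \<in> borel_measurable U" 
    using borel_measurable_integrable[OF assms(1), measurable] by measurable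
qed (auto split: split_indicator)

lemma prim_add: "integrable U g \<Longrightarrow> integrable U h \<Longrightarrow> x \<in> {0..1} \<Longrightarrow> prim (\<lambda>t. g t + h t) x = prim g x + prim h x"
  by (simp add: prim_eq scaleR_add_right)

lemma prim_scale: "x \<in> {0..1} \<Longrightarrow> prim (\<lambda>t. c * g t) x = c * prim g x"
  unfolding prim_def by (rule integral_mult_right_zero)

lemma prim_diff: "integrable U g \<Longrightarrow> integrable U h \<Longrightarrow> x \<in> {0..1} \<Longrightarrow> prim (\<lambda>t. g t - h t) x = prim g x - prim h x"
  by (simp add: prim_eq scaleR_diff_right)

lemma prim_cnj: "prim (\<lambda>t. cnj (g t)) x = cnj (prim g x)"
  unfolding prim_def by (rule Bochner_Integration.integral_cnj)

lemma prim_cong_AE: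
  assumes "AE t in U. g t = h t" "integrable U g" "integrable U h" "x \<in> {0..1}"
  shows "prim g x = prim h x"
  unfolding prim_eq[OF assms(4)] using assms
  by (intro integral_cong_AE) (auto intro: borel_measurable_integrable)

lemma prim_HK:
  assumes "integrable U g" "x \<in> {0..1}"
  shows "g integrable_on {0..x}" "prim g x = integral {0..x} g"
proof -
  have "set_integrable lebesgue {0..1} g" using assms(1) by (simp add: set_integrable_def integrable_restrict_space)
  then have "set_integrable lebesgue {0..x} g" by (rule set_integrable_subset) (use assms in auto)
  then have I: "integrable (lebesgue_on {0..x}) g" by (simp add: set_integrable_def integrable_restrict_space)
  show "g integrable_on {0..x}" by (rule integrable_on_lebesgue_on[OF I]) simp
  show "prim g x = integral {0..x} g" unfolding prim_def by (rule lebesgue_integral_eq_integral[OF I]) simp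
qed

lemma prim_continuous: "integrable U g \<Longrightarrow> continuous_on {0..1} (prim g)"
  using indefinite_integral_continuous_1[of g 0 1] prim_HK[of g]
  by (metis (no_types, lifting) atLeastAtMost_iff continuous_on_cong order_refl zero_le_one)

lemma continuous_bounded_U:
  fixes f :: cfun
  assumes "continuous_on {0..1} f" shows "\<exists>C. \<forall>x\<in>{0..1}. cmod (f x) \<le> C"
  using compact_imp_bounded[OF compact_continuous_image[OF assms]] unfolding bounded_iff by auto

lemma L2_continuous: "continuous_on {0..1} f \<Longrightarrow> f \<in> L2"
  using continuous_bounded_U[of f] L2_bounded[OF borel_measurable_U_continuous] by blast

lemma integrable_continuous_mult:
  assumes g: "integrable U g" and f: "continuous_on {0..1} f"
  shows "integrable U (\<lambda>x. f x * g x :: complex)"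
proof -
  obtain C where C: "\<And>x. x \<in> {0..1} \<Longrightarrow> cmod (f x) \<le> C" using continuous_bounded_U[OF f] by blast
  show ?thesis
  proof (rule Bochner_Integration.integrable_bound)
    show "integrable U (\<lambda>x. C * cmod (g x))" using g by simp
    show "(\<lambda>x. f x * g x) \<in> borel_measurable U"
      using borel_measurable_U_continuous[OF f] borel_measurable_integrable[OF g] by measurable
    show "AE x in U. cmod (f x * g x) \<le> norm (C * cmod (g x))"
    proof (rule AE_I2)
      fix x assume "x \<in> space U"
      then have "cmod (f x) \<le> C" using C by simp
      then have "cmod (f x) * cmod (g x) \<le> \<bar>C\<bar> * cmod (g x)" by (intro mult_right_mono) auto
      then show "cmod (f x * g x) \<le> norm (C * cmod (g x))" by (simp add: norm_mult abs_mult)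
    qed
  qed
qed

lemma prim_increment:
  assumes g: "integrable U g" and "0 \<le> x" "x \<le> y" "y \<le> 1"
  shows "prim g y - prim g x = (LINT t|U. indicator {x<..y} t *\<^sub>R g t)"
proof -
  have "prim g y - prim g x = (LINT t|U. indicator {0..y} t *\<^sub>R g t - indicator {0..x} t *\<^sub>R g t)"
    using assms by (simp add: prim_eq)
  also have "\<dots> = (LINT t|U. indicator {x<..y} t *\<^sub>R g t)"
    using assms by (intro Bochner_Integration.integral_cong) (auto split: split_indicator)
  finally show ?thesis .
qed

lemma prim_increment_norm:
  assumes g: "integrable U g" and "0 \<le> x" "x \<le> y" "y \<le> 1"
  shows "cmod (prim g y - prim g x) \<le> (LINT t|U. indicator {x<..y} t * cmod (g t))"
proof -
  have "cmod (prim g y - prim g x) \<le> (LINT t|U. norm (indicator {x<..y} t *\<^sub>R g t))"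
    unfolding prim_increment[OF assms] by (rule integral_norm_bound)
  then show ?thesis by simp
qed

lemma prim_increment_le:
  assumes g: "g \<in> L2" and xy: "0 \<le> x" "x \<le> y" "y \<le> 1"
  shows "cmod (prim g y - prim g x) \<le> sqrt (y - x) * L2_norm g"
proof -
  have i: "(\<lambda>t. complex_of_real (indicator {x<..y} t)) \<in> L2"
    by (rule L2_bounded[of _ 1], measurable)
  have "(LINT t|U. (cmod (complex_of_real (indicator {x<..y} t)))\<^sup>2) = (LINT t|U. indicator {x<..y} t *\<^sub>R 1)"
    by (intro Bochner_Integration.integral_cong) (auto split: split_indicator)
  also have "\<dots> = measure U ({x<..y} \<inter> space U)" by simp
  also have "{x<..y} \<inter> space U = {x<..y}" using xy by auto
  also have "measure U {x<..y} = y - x"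
    using xy by (subst measure_restrict_space) auto
  finally have n: "L2_norm (\<lambda>t. complex_of_real (indicator {x<..y} t)) = sqrt (y - x)"
    by (simp add: L2_norm_def)
  have "prim g y - prim g x = (LINT t|U. complex_of_real (indicator {x<..y} t) * g t)"
    unfolding prim_increment[OF L2_integrable[OF g] xy] by (simp add: scaleR_conv_of_real)
  then show ?thesis using L2_Cauchy_Schwarz[OF i g] by (simp add: n)
qed

text \<open>A function is determined almost everywhere by its primitive, by Lebesgue's differentiation
  theorem.\<close>

lemma prim_zero_imp_AE_zero:
  assumes g: "integrable U g" and z: "\<And>x. x \<in> {0..1} \<Longrightarrow> prim g x = 0"
  shows "AE x in U. g x = 0"
proof -
  define f where "f x = indicator {0..1} x *\<^sub>R g x" for x
  have "integrable lebesgue f" using g by (simp add: f_def[abs_def] integrable_restrict_space)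
  then have "f absolutely_integrable_on UNIV" by (simp add: set_integrable_def)
  then have "f integrable_on UNIV" by (rule set_lebesgue_integral_eq_integral)
  then have fi: "f integrable_on cbox a b" for a b by (rule integrable_on_subcbox) auto
  obtain N where N: "negligible N" and Ne: "\<And>x e. \<lbrakk>x \<notin> N; 0 < e\<rbrakk> \<Longrightarrow>
     \<exists>d>0. \<forall>h. 0 < h \<and> h < d \<longrightarrow> norm (integral (cbox x (x + h *\<^sub>R One)) f /\<^sub>R h ^ DIM(real) - f x) < e"
    using integrable_ccontinuous_explicit[OF fi] by blast
  have "g x = 0" if x: "x \<in> {0..<1}" "x \<notin> N" for x
  proof (rule ccontr)
    assume "g x \<noteq> 0"
    then obtain d where d: "d > 0" "\<And>h. 0 < h \<Longrightarrow> h < d \<Longrightarrow>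
        norm (integral (cbox x (x + h *\<^sub>R One)) f /\<^sub>R h ^ DIM(real) - f x) < norm (g x)"
      using Ne[OF x(2), of "norm (g x)"] by auto
    define h where "h = min (d/2) (1 - x)"
    have h: "0 < h" "h < d" "x + h \<le> 1" using d x by (auto simp: h_def)
    have "integral {x..x+h} f = integral {x..x+h} g"
      by (rule Henstock_Kurzweil_Integration.integral_cong) (use h x in \<open>auto simp: f_def\<close>)
    moreover have "integral {0..x} g + integral {x..x+h} g = integral {0..x+h} g"
      by (rule Henstock_Kurzweil_Integration.integral_combine) (use h x g in \<open>auto intro!: prim_HK(1)\<close>)
    moreover have "integral {0..x} g = 0" "integral {0..x+h} g = 0"
      using z[of x] z[of "x+h"] prim_HK(2)[OF g, of x] prim_HK(2)[OF g, of "x+h"] h x by auto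
    ultimately have "integral {x..x+h} f = 0" by simp
    then show False using d(2)[OF h(1,2)] x by (simp add: f_def)
  qed
  moreover have "N \<union> {1} \<in> null_sets lebesgue"
    using N negligible_iff_null_sets[of "N \<union> {1}"] by auto
  moreover have "x \<in> {0..<1} \<or> x = 1" if "x \<in> {0..1}" for x :: real using that by auto
  ultimately have "AE x in lebesgue. x \<in> {0..1} \<longrightarrow> g x = 0"
    by (intro AE_I'[of "N \<union> {1}"]) blast+
  then show ?thesis by (simp add: AE_restrict_space_iff)
qed

lemma UU_integrable_mult:
  fixes g h :: cfun
  assumes g: "integrable U g" and h: "integrable U h"
  shows "integrable (U \<Otimes>\<^sub>M U) (\<lambda>(s, t). g s * h t)"
proof (rule UU.Fubini_integrable)
  note [measurable] = borel_measurable_integrable[OF g] borel_measurable_integrable[OF h]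
  show "(\<lambda>(s, t). g s * h t) \<in> borel_measurable (U \<Otimes>\<^sub>M U)" by measurable
  show "integrable U (\<lambda>x. LINT y|U. norm (case (x, y) of (s, t) \<Rightarrow> g s * h t))"
    using g by (simp add: norm_mult)
  show "AE x in U. integrable U (\<lambda>y. case (x, y) of (s, t) \<Rightarrow> g s * h t)" using h by simp
qed

text \<open>The product rule for two primitives of merely integrable functions. By Fubini's theorem the
  product is an integral over the square \<open>[0,x]\<^sup>2\<close>, which is split along its diagonal.\<close>

lemma prim_mult:
  assumes g: "integrable U g" and h: "integrable U h" and x: "x \<in> {0..1}"
  shows "prim g x * prim h x = prim (\<lambda>t. g t * prim h t + prim g t * h t) x"
proof -
  define G where "G t = indicator {0..x} t *\<^sub>R g t" for t
  define H where "H t = indicator {0..x} t *\<^sub>R h t" for t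
  have GH: "integrable U G" "integrable U H" using g h by (simp_all add: G_def[abs_def] H_def[abs_def])
  note [measurable] = GH[THEN borel_measurable_integrable]
  note I = UU_integrable_mult[OF GH]
  have I1: "integrable (U \<Otimes>\<^sub>M U) (\<lambda>(s, t). if t \<le> s then G s * H t else 0)"
  proof (rule Bochner_Integration.integrable_bound[OF I])
    have [measurable]: "(\<lambda>p. fst p) \<in> borel_measurable (U \<Otimes>\<^sub>M U)" "(\<lambda>p. snd p) \<in> borel_measurable (U \<Otimes>\<^sub>M U)"
      using measurable_compose[OF measurable_fst id_borel_measurable_U] measurable_compose[OF measurable_snd id_borel_measurable_U] by auto
    have "(\<lambda>p. if snd p \<le> fst p then G (fst p) * H (snd p) else 0) \<in> borel_measurable (U \<Otimes>\<^sub>M U)" by measurable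
    then show "(\<lambda>(s, t). if t \<le> s then G s * H t else 0) \<in> borel_measurable (U \<Otimes>\<^sub>M U)" by (simp add: case_prod_unfold)
  qed auto
  have I2: "integrable (U \<Otimes>\<^sub>M U) (\<lambda>(s, t). if t \<le> s then 0 else G s * H t)"
    using Bochner_Integration.integrable_diff[OF I I1]
    by (rule Bochner_Integration.integrable_cong[THEN iffD1, rotated -1]) auto
  have J1: "integrable U (\<lambda>s. LINT t|U. (if t \<le> s then G s * H t else 0))"
    and J2: "integrable U (\<lambda>s. LINT t|U. (if t \<le> s then 0 else G s * H t))"
    using UU.integrable_fst[OF I1] UU.integrable_fst[OF I2] by auto
  have A1: "AE s in U. integrable U (\<lambda>t. if t \<le> s then G s * H t else 0)"
    and A2: "AE s in U. integrable U (\<lambda>t. if t \<le> s then 0 else G s * H t)"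
    using UU.AE_integrable_fst[OF I1] UU.AE_integrable_fst[OF I2] by auto
  have "prim g x * prim h x = (LINT s|U. G s) * (LINT t|U. H t)"
    unfolding prim_eq[OF x] G_def H_def ..
  also have "\<dots> = (LINT s|U. LINT t|U. G s * H t)" by simp
  also have "\<dots> = (LINT s|U. (LINT t|U. (if t \<le> s then G s * H t else 0)) + (LINT t|U. (if t \<le> s then 0 else G s * H t)))"
  proof (rule integral_cong_AE)
    show "AE s in U. (LINT t|U. G s * H t) = (LINT t|U. (if t \<le> s then G s * H t else 0)) + (LINT t|U. (if t \<le> s then 0 else G s * H t))"
      using A1 A2
    proof eventually_elim
      case (elim s)
      show ?case unfolding Bochner_Integration.integral_add[OF elim, symmetric]
        by (intro Bochner_Integration.integral_cong) auto
    qed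
    show "(\<lambda>s. (LINT t|U. (if t \<le> s then G s * H t else 0)) + (LINT t|U. (if t \<le> s then 0 else G s * H t))) \<in> borel_measurable U"
      using J1 J2 by (intro borel_measurable_integrable) simp
    show "(\<lambda>s. LINT t|U. G s * H t) \<in> borel_measurable U" by simp
  qed
  also have "\<dots> = (LINT s|U. LINT t|U. (if t \<le> s then G s * H t else 0)) + (LINT s|U. LINT t|U. (if t \<le> s then 0 else G s * H t))"
    by (rule Bochner_Integration.integral_add[OF J1 J2])
  also have "(LINT s|U. LINT t|U. (if t \<le> s then 0 else G s * H t)) = (LINT t|U. LINT s|U. (if t \<le> s then 0 else G s * H t))"
    using UU.Fubini_integral[OF I2] by simp
  also have "(LINT s|U. LINT t|U. (if t \<le> s then G s * H t else 0)) = prim (\<lambda>t. g t * prim h t) x"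
    unfolding prim_eq[OF x]
  proof (rule Bochner_Integration.integral_cong[OF refl])
    fix s assume "s \<in> space U" then have s: "s \<in> {0..1}" by simp
    show "(LINT t|U. (if t \<le> s then G s * H t else 0)) = indicator {0..x} s *\<^sub>R (g s * prim h s)"
    proof (cases "s \<le> x")
      case True
      have "(LINT t|U. (if t \<le> s then G s * H t else 0)) = (LINT t|U. g s * (indicator {0..s} t *\<^sub>R h t))"
        using s True by (intro Bochner_Integration.integral_cong) (auto simp: G_def H_def split: split_indicator)
      also have "\<dots> = g s * prim h s" unfolding prim_eq[OF s] by (rule integral_mult_right_zero)
      finally show ?thesis using s True by simp
    qed (simp add: G_def indicator_def cong: if_cong)
  qed
  also have "(LINT t|U. LINT s|U. (if t \<le> s then 0 else G s * H t)) = prim (\<lambda>t. prim g t * h t) x"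
    unfolding prim_eq[OF x]
  proof (rule Bochner_Integration.integral_cong[OF refl])
    fix t assume "t \<in> space U" then have t: "t \<in> {0..1}" by simp
    show "(LINT s|U. (if t \<le> s then 0 else G s * H t)) = indicator {0..x} t *\<^sub>R (prim g t * h t)"
    proof (cases "t \<le> x")
      case True
      have "AE s in lebesgue. s \<noteq> t" by (rule AE_I'[of "{t}"]) auto
      then have ne: "AE s in U. s \<noteq> t" by (subst AE_restrict_space_iff) (auto elim: eventually_mono)
      have "(LINT s|U. (if t \<le> s then 0 else G s * H t)) = (LINT s|U. (indicator {0..t} s *\<^sub>R g s) * h t)"
      proof (rule integral_cong_AE)
        show "(\<lambda>s. if t \<le> s then 0 else G s * H t) \<in> borel_measurable U" by measurable
        show "(\<lambda>s. (indicator {0..t} s *\<^sub>R g s) * h t) \<in> borel_measurable U"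
          using g by (intro borel_measurable_integrable) simp
        show "AE s in U. (if t \<le> s then 0 else G s * H t) = (indicator {0..t} s *\<^sub>R g s) * h t"
          using ne AE_space by eventually_elim (use t True in \<open>auto simp: G_def H_def split: split_indicator\<close>)
      qed
      also have "\<dots> = prim g t * h t" unfolding prim_eq[OF t] by (rule integral_mult_left_zero)
      finally show ?thesis using t True by simp
    qed (simp add: H_def indicator_def cong: if_cong)
  qed
  also have "prim (\<lambda>t. g t * prim h t) x + prim (\<lambda>t. prim g t * h t) x = prim (\<lambda>t. g t * prim h t + prim g t * h t) x"
    by (rule prim_add[symmetric, OF _ _ x])
      (use integrable_continuous_mult[OF g prim_continuous[OF h]] integrable_continuous_mult[OF h prim_continuous[OF g]] in \<open>simp_all add: mult.commute\<close>)
  finally show ?thesis .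
qed

section \<open>The Sobolev space as a Hilbert space\<close>

lemma has_wderiv_prim: "has_wderiv y g \<longleftrightarrow> g \<in> L2 \<and> (\<forall>x\<in>{0..1}. y x = y 0 + prim g x)"
  by (simp add: has_wderiv_def prim_def)

lemma sobolevD:
  assumes "y \<in> sobolev"
  shows "wderiv y \<in> L2" "\<And>x. x \<in> {0..1} \<Longrightarrow> y x = prim (wderiv y) x" "prim (wderiv y) 1 = 0"
    "\<And>x. x \<notin> {0..1} \<Longrightarrow> y x = 0" "y 0 = 0" "y 1 = 0"
proof -
  have "has_wderiv y (wderiv y)" unfolding wderiv_def using assms someI_ex[of "has_wderiv y"] by (auto simp: sobolev_def)
  with assms show "wderiv y \<in> L2" "\<And>x. x \<in> {0..1} \<Longrightarrow> y x = prim (wderiv y) x" "\<And>x. x \<notin> {0..1} \<Longrightarrow> y x = 0" "y 0 = 0" "y 1 = 0"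
    by (auto simp: has_wderiv_prim sobolev_def)
  from this(2)[of 1] this(5) show "prim (wderiv y) 1 = 0" by simp
qed

lemma sobolevI:
  assumes g: "g \<in> L2" and y: "\<And>x. x \<in> {0..1} \<Longrightarrow> y x = prim g x" "prim g 1 = 0" "\<And>x. x \<notin> {0..1} \<Longrightarrow> y x = 0"
  shows "y \<in> sobolev" and "AE x in U. wderiv y x = g x"
proof -
  have y0: "y 0 = 0" using y(1)[of 0] prim_0 by simp
  have "has_wderiv y g" using g y y0 by (auto simp: has_wderiv_prim)
  then show s: "y \<in> sobolev" using y y0 by (auto simp: sobolev_def)
  have "AE x in U. wderiv y x - g x = 0"
  proof (rule prim_zero_imp_AE_zero)
    show "integrable U (\<lambda>x. wderiv y x - g x)" using L2_integrable[OF g] L2_integrable[OF sobolevD(1)[OF s]] by simp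
    show "prim (\<lambda>x. wderiv y x - g x) x = 0" if "x \<in> {0..1}" for x
      using L2_integrable[OF g] L2_integrable[OF sobolevD(1)[OF s]] that sobolevD(2)[OF s that] y(1)[OF that]
      by (simp add: prim_diff)
  qed
  then show "AE x in U. wderiv y x = g x" by simp
qed

lemma sobolev_continuous: "y \<in> sobolev \<Longrightarrow> continuous_on {0..1} y"
  using prim_continuous[OF L2_integrable[OF sobolevD(1)]] sobolevD(2)
  by (metis (no_types, lifting) continuous_on_cong)

lemma sobolev_L2: "y \<in> sobolev \<Longrightarrow> y \<in> L2"
  by (intro L2_continuous sobolev_continuous)

lemma sobolev_holder:
  assumes y: "y \<in> sobolev" and "x \<in> {0..1}" "x' \<in> {0..1}"
  shows "cmod (y x - y x') \<le> sqrt \<bar>x - x'\<bar> * sob_norm y"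
proof -
  have "cmod (y b - y a) \<le> sqrt (b - a) * sob_norm y" if "0 \<le> a" "a \<le> b" "b \<le> 1" for a b
    using prim_increment_le[OF sobolevD(1)[OF y] that] sobolevD(2)[OF y, of a] sobolevD(2)[OF y, of b] that
    by (simp add: sob_norm_def)
  from this[of x x'] this[of x' x] assms(2,3) show ?thesis
    by (cases "x \<le> x'") (auto simp: norm_minus_commute abs_if)
qed

lemma sob_norm_nonneg: "sob_norm y \<ge> 0"
  by (simp add: sob_norm_def L2_norm_nonneg)

lemma sobolev_sup_le:
  assumes y: "y \<in> sobolev" shows "cmod (y x) \<le> sob_norm y"
proof (cases "x \<in> {0..1}")
  case True
  then have "sqrt x * sob_norm y \<le> 1 * sob_norm y" by (intro mult_right_mono) (auto simp: sob_norm_nonneg)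
  with sobolev_holder[OF y True, of 0] True show ?thesis by (simp add: sobolevD(5)[OF y])
qed (use sobolevD(4)[OF y] sob_norm_nonneg in auto)

lemma sobolev_add:
  assumes "y \<in> sobolev" "z \<in> sobolev"
  shows "(\<lambda>x. y x + z x) \<in> sobolev" "AE x in U. wderiv (\<lambda>x. y x + z x) x = wderiv y x + wderiv z x"
  using sobolevI[of "\<lambda>x. wderiv y x + wderiv z x" "\<lambda>x. y x + z x"] assms
  by (simp_all add: prim_add L2_integrable sobolevD L2_add)

lemma sobolev_scale:
  assumes "y \<in> sobolev"
  shows "(\<lambda>x. c * y x) \<in> sobolev" "AE x in U. wderiv (\<lambda>x. c * y x) x = c * wderiv y x"
  using sobolevI[of "\<lambda>x. c * wderiv y x" "\<lambda>x. c * y x"] assms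
  by (simp_all add: prim_scale sobolevD L2_scale)

lemma sobolev_cnj:
  assumes "y \<in> sobolev"
  shows "(\<lambda>x. cnj (y x)) \<in> sobolev" "AE x in U. wderiv (\<lambda>x. cnj (y x)) x = cnj (wderiv y x)"
  using sobolevI[of "\<lambda>x. cnj (wderiv y x)" "\<lambda>x. cnj (y x)"] assms
  by (simp_all add: prim_cnj sobolevD L2_cnj)

lemma sobolev_mult:
  assumes y: "y \<in> sobolev" and z: "z \<in> sobolev"
  shows "(\<lambda>x. y x * z x) \<in> sobolev" "AE x in U. wderiv (\<lambda>x. y x * z x) x = wderiv y x * z x + y x * wderiv z x"
proof -
  let ?g = "\<lambda>t. wderiv y t * z t + y t * wderiv z t"
  have L: "(\<lambda>t. wderiv y t * z t) \<in> L2" "(\<lambda>t. y t * wderiv z t) \<in> L2"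
    using L2_bounded_mult[OF borel_measurable_U_continuous[OF sobolev_continuous[OF z]] sobolevD(1)[OF y] sobolev_sup_le[OF z]]
      L2_bounded_mult[OF borel_measurable_U_continuous[OF sobolev_continuous[OF y]] sobolevD(1)[OF z] sobolev_sup_le[OF y]]
    by (simp_all add: mult.commute)
  have g: "?g \<in> L2" by (intro L2_add L)
  have eq: "y x * z x = prim ?g x" if x: "x \<in> {0..1}" for x
  proof -
    have "y x * z x = prim (wderiv y) x * prim (wderiv z) x" using sobolevD(2) y z x by simp
    also have "\<dots> = prim (\<lambda>t. wderiv y t * prim (wderiv z) t + prim (wderiv y) t * wderiv z t) x"
      using y z x by (intro prim_mult L2_integrable sobolevD)
    also have "\<dots> = prim ?g x"
      unfolding prim_eq[OF x] using sobolevD(2)[OF y] sobolevD(2)[OF z]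
      by (intro Bochner_Integration.integral_cong) auto
    finally show ?thesis .
  qed
  have g1: "prim ?g 1 = 0" using eq[of 1] sobolevD(6)[OF y] by simp
  show "(\<lambda>x. y x * z x) \<in> sobolev" "AE x in U. wderiv (\<lambda>x. y x * z x) x = ?g x"
    using sobolevI[OF g, of "\<lambda>x. y x * z x"] eq g1 sobolevD(4)[OF y] by auto
qed

lemma zero_in_sobolev: "(\<lambda>_. 0) \<in> sobolev"
  by (rule sobolevI[OF L2_const[of 0]]) (auto simp: prim_def)

text \<open>The Sobolev space as a type, so that the theory of real Hilbert spaces applies. Since its
  elements are honest functions, no quotient is needed. The real inner product is the real part
  of the complex one, and multiplication by complex numbers is a separate operation.\<close>

typedef sob = sobolev morphisms fn mk
  using zero_in_sobolev by blast

lemmas fn_sobolev [simp] = fn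
lemmas fn_mk [simp] = mk_inverse
lemmas mk_fn [simp] = fn_inverse

text \<open>The selected weak derivative; identities for it hold almost everywhere only.\<close>

definition D :: "sob \<Rightarrow> cfun" where "D u = wderiv (fn u)"

text \<open>Multiplication by a complex number.\<close>

definition scaleC :: "complex \<Rightarrow> sob \<Rightarrow> sob" where "scaleC c u = mk (\<lambda>x. c * fn u x)"

text \<open>The complex inner product \<open>\<integral> u' cnj v'\<close>, linear in the first argument.\<close>

definition cinner :: "sob \<Rightarrow> sob \<Rightarrow> complex" where "cinner u v = (LINT x|U. D u x * cnj (D v x))"

lemma sob_eqI: "(\<And>x. fn u x = fn v x) \<Longrightarrow> u = v"
  by (metis ext fn_inject)

lemma D_L2 [simp]: "D u \<in> L2" by (simp add: D_def sobolevD)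

lemma D_measurable [measurable]: "D u \<in> borel_measurable U" by (rule L2_measurable) simp

lemma cinner_integrable [simp]: "integrable U (\<lambda>x. D u x * cnj (D v x))"
  by (intro L2_mult_integrable L2_cnj D_L2)

lemma fn_scaleC [simp]: "fn (scaleC c u) = (\<lambda>x. c * fn u x)"
  by (simp add: scaleC_def sobolev_scale)

lemma D_scaleC: "AE x in U. D (scaleC c u) x = c * D u x"
  by (simp add: D_def sobolev_scale)

instantiation sob :: real_vector
begin
definition "0 = mk (\<lambda>_. 0)"
definition "u + v = mk (\<lambda>x. fn u x + fn v x)"
definition "- u = scaleC (-1) u"
definition "u - v = u + - (v :: sob)"
definition "r *\<^sub>R u = scaleC (complex_of_real r) u"
lemma fn_0 [simp]: "fn 0 = (\<lambda>_. 0)"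
  by (simp add: zero_sob_def zero_in_sobolev)
lemma fn_add [simp]: "fn (u + v) = (\<lambda>x. fn u x + fn v x)"
  by (simp add: plus_sob_def sobolev_add)
lemma fn_uminus [simp]: "fn (- u) = (\<lambda>x. - fn u x)"
  by (simp add: uminus_sob_def)
lemma fn_diff [simp]: "fn (u - v) = (\<lambda>x. fn u x - fn v x)"
  by (simp add: minus_sob_def)
lemma fn_scaleR [simp]: "fn (r *\<^sub>R u) = (\<lambda>x. complex_of_real r * fn u x)"
  by (simp add: scaleR_sob_def)

instance
proof
  fix u v w :: sob and a b :: real
  show "u + v + w = u + (v + w)" by (rule sob_eqI) (simp add: add.assoc)
  show "u + v = v + u" by (rule sob_eqI) (simp add: add.commute)
  show "0 + u = u" by (rule sob_eqI) simp
  show "- u + u = 0" by (rule sob_eqI) simp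
  show "u - v = u + - v" by (rule sob_eqI) simp
  show "a *\<^sub>R (u + v) = a *\<^sub>R u + a *\<^sub>R v" by (rule sob_eqI) (simp add: distrib_left)
  show "(a + b) *\<^sub>R u = a *\<^sub>R u + b *\<^sub>R u" by (rule sob_eqI) (simp add: distrib_right)
  show "a *\<^sub>R b *\<^sub>R u = (a * b) *\<^sub>R u" by (rule sob_eqI) (simp only: fn_scaleR of_real_mult mult.assoc)
  show "1 *\<^sub>R u = u" by (rule sob_eqI) simp
qed

end

lemma D_add: "AE x in U. D (u + v) x = D u x + D v x"
  using sobolev_add(2)[OF fn fn, of u v] by (simp add: D_def)

lemma cinner_add_left: "cinner (u + v) w = cinner u w + cinner v w"
proof -
  have "cinner (u + v) w = (LINT x|U. D u x * cnj (D w x) + D v x * cnj (D w x))"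
    unfolding cinner_def
  proof (rule integral_cong_AE)
    show "AE x in U. D (u + v) x * cnj (D w x) = D u x * cnj (D w x) + D v x * cnj (D w x)"
      using D_add[of u v] by eventually_elim (simp add: distrib_right)
  qed (auto intro: borel_measurable_integrable)
  then show ?thesis by (simp add: cinner_def)
qed

lemma cinner_scaleC_left: "cinner (scaleC c u) w = c * cinner u w"
proof -
  have "cinner (scaleC c u) w = (LINT x|U. c * (D u x * cnj (D w x)))"
    unfolding cinner_def
  proof (rule integral_cong_AE)
    show "AE x in U. D (scaleC c u) x * cnj (D w x) = c * (D u x * cnj (D w x))"
      using D_scaleC[of c u] by eventually_elim simp
  qed (auto intro: borel_measurable_integrable)
  then show ?thesis by (simp add: cinner_def)
qed

lemma cinner_commute: "cnj (cinner u v) = cinner v u"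
  unfolding cinner_def by (simp add: mult.commute flip: Bochner_Integration.integral_cnj)

lemma cinner_self: "cinner u u = complex_of_real ((L2_norm (D u))\<^sup>2)"
  unfolding cinner_def L2_norm_sq complex_norm_square[symmetric] by (rule integral_complex_of_real)

lemma eq_0_if_norm_0: assumes "L2_norm (D u) = 0" shows "u = 0"
proof -
  have "fn u x = 0" for x
    using sobolev_sup_le[OF fn, of u x] assms by (simp add: sob_norm_def D_def)
  then show ?thesis by (intro sob_eqI) simp
qed

lemma D_0: "L2_norm (D 0) = 0"
proof -
  have "scaleC 0 0 = (0::sob)" by (intro sob_eqI) simp
  then have "cinner 0 0 = 0" using cinner_scaleC_left[of 0 0 0] by simp
  then show ?thesis using cinner_self[of 0] by simp
qed

instantiation sob :: real_inner
begin
definition "inner u v = Re (cinner u v)"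
definition "norm u = sqrt (inner u (u :: sob))"
definition "sgn u = scaleC (complex_of_real (inverse (norm u))) u"
definition "dist u v = norm (u - v :: sob)"
definition [code del]: "(uniformity :: (sob \<times> sob) filter) = (INF e\<in>{0 <..}. principal {(x, y). dist x y < e})"
definition [code del]: "open (S :: sob set) = (\<forall>x\<in>S. \<forall>\<^sub>F (x', y) in uniformity. x' = x \<longrightarrow> y \<in> S)"


instance
proof
  fix u v w :: sob and a b r :: real and S :: "sob set"
  show "inner u v = inner v u" by (metis inner_sob_def cinner_commute complex_cnj(1) complex.sel(1) complex.collapse)
  show "inner (u + v) w = inner u w + inner v w" by (simp add: inner_sob_def cinner_add_left)
  show "inner (r *\<^sub>R u) v = r * inner u v" by (simp add: inner_sob_def scaleR_sob_def cinner_scaleC_left)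
  show "0 \<le> inner u u" by (simp add: inner_sob_def cinner_self)
  show "(inner u u = 0) = (u = 0)" using eq_0_if_norm_0[of u] D_0 by (auto simp: inner_sob_def cinner_self)
  show "norm u = sqrt (inner u u)" by (simp add: norm_sob_def)
  show "sgn u = u /\<^sub>R norm u" by (simp add: sgn_sob_def scaleR_sob_def)
  show "dist u v = norm (u - v)" by (simp add: dist_sob_def)
  show "uniformity = (INF e\<in>{0<..}. principal {(x, y::sob). dist x y < e})" by (simp add: uniformity_sob_def)
  show "open S = (\<forall>x\<in>S. \<forall>\<^sub>F (x', y) in uniformity. x' = x \<longrightarrow> y \<in> S)" by (simp add: open_sob_def)
qed

end

lemma norm_sob: "norm u = L2_norm (D u)" "norm u = sob_norm (fn u)"
  by (simp_all add: norm_sob_def inner_sob_def cinner_self L2_norm_nonneg sob_norm_def D_def)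

lemma D_diff: "AE x in U. D (u - v) x = D u x - D v x"
  using D_add[of u "scaleC (-1) v"] D_scaleC[of "-1" v] unfolding minus_sob_def uminus_sob_def by eventually_elim simp

instance sob :: complete_space
proof
  fix X :: "nat \<Rightarrow> sob" assume X: "Cauchy X"
  have nd: "norm (u - v) = L2_norm (\<lambda>x. D u x - D v x)" for u v
    unfolding norm_sob by (rule L2_norm_cong_AE[OF D_diff]) measurable
  have "\<exists>g\<in>L2. (\<lambda>n. L2_norm (\<lambda>x. D (X n) x - g x)) \<longlonglongrightarrow> 0"
  proof (rule L2_complete)
    fix e :: real assume "e > 0"
    with X show "\<exists>N. \<forall>m\<ge>N. \<forall>n\<ge>N. L2_norm (\<lambda>x. D (X m) x - D (X n) x) < e"
      unfolding Cauchy_iff nd by blast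
  qed simp
  then obtain g where g: "g \<in> L2" and lim: "(\<lambda>n. L2_norm (\<lambda>x. D (X n) x - g x)) \<longlonglongrightarrow> 0" by blast
  have "cmod (prim g 1) \<le> L2_norm (\<lambda>x. D (X n) x - g x)" for n
  proof -
    have "prim (\<lambda>x. D (X n) x - g x) 1 = - prim g 1"
      using sobolevD(3)[OF fn[of "X n"]] by (simp add: prim_diff L2_integrable g D_def[symmetric])
    then show ?thesis using prim_increment_le[OF L2_diff[OF D_L2[of "X n"] g], of 0 1] by (simp add: prim_0)
  qed
  then have "cmod (prim g 1) \<le> 0" by (intro LIMSEQ_le_const[OF lim]) auto
  then have g1: "prim g 1 = 0" by simp
  define y where "y x = (if x \<in> {0..1} then prim g x else 0)" for x
  have y: "y \<in> sobolev" "AE x in U. wderiv y x = g x"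
    by (rule sobolevI[OF g]; use g1 in \<open>auto simp: y_def\<close>)+
  define v where "v = mk y"
  have v: "AE x in U. D v x = g x" using y by (simp add: D_def v_def)
  have "norm (X n - v) = L2_norm (\<lambda>x. D (X n) x - g x)" for n
    unfolding nd
  proof (rule L2_norm_cong_AE)
    show "AE x in U. D (X n) x - D v x = D (X n) x - g x" using v by eventually_elim simp
  qed (use g in measurable)
  with lim have "(\<lambda>n. norm (X n - v)) \<longlonglongrightarrow> 0" by simp
  then have "X \<longlonglongrightarrow> v" by (rule LIM_zero_cancel[OF tendsto_norm_zero_cancel])
  then show "convergent X" by (rule convergentI)
qed

section \<open>The dual of the Sobolev space\<close>

lemma scaleC_add: "scaleC c (u + v) = scaleC c u + scaleC c v"
  by (rule sob_eqI) (simp add: distrib_left)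

lemma scaleC_scaleC: "scaleC c (scaleC d u) = scaleC (c * d) u"
  by (rule sob_eqI) (simp only: fn_scaleC mult.assoc)

lemma scaleC_1 [simp]: "scaleC 1 u = u" and scaleC_0 [simp]: "scaleC 0 u = 0" "scaleC c 0 = 0"
  and scaleR_scaleC: "r *\<^sub>R u = scaleC (complex_of_real r) u" and scaleC_minus: "scaleC (- c) u = - scaleC c u" "scaleC c (- u) = - scaleC c u"
  and scaleC_diff: "scaleC c (u - v) = scaleC c u - scaleC c v"
  by (rule sob_eqI, simp add: right_diff_distrib)+

lemma cinner_add_right: "cinner u (v + w) = cinner u v + cinner u w"
  using arg_cong[OF cinner_add_left[of v w u], of cnj] by (simp add: cinner_commute)

lemma cinner_scaleC_right: "cinner u (scaleC c w) = cnj c * cinner u w"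
  using arg_cong[OF cinner_scaleC_left[of c w u], of cnj] by (simp add: cinner_commute)

lemma cinner_minus: "cinner (- u) w = - cinner u w" "cinner u (- w) = - cinner u w"
  using cinner_scaleC_left[of "-1" u w] cinner_scaleC_right[of u "-1" w] by (simp_all add: scaleC_minus)

lemma cinner_diff: "cinner (u - v) w = cinner u w - cinner v w" "cinner w (u - v) = cinner w u - cinner w v"
  using cinner_add_left[of u "- v" w] cinner_add_right[of w u "- v"] by (simp_all add: cinner_minus)

lemma cinner_0 [simp]: "cinner 0 w = 0" "cinner w 0 = 0"
  using cinner_scaleC_left[of 0 0 w] cinner_scaleC_right[of w 0 0] by simp_all

lemma cinner_norm: "cinner u u = complex_of_real ((norm u)\<^sup>2)"
  by (simp add: cinner_self norm_sob)

lemma cinner_eq_0_iff [simp]: "cinner u u = 0 \<longleftrightarrow> u = 0"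
  by (simp add: cinner_norm)

lemma cinner_bound: "cmod (cinner u v) \<le> norm u * norm v"
proof -
  have "L2_norm (\<lambda>x. cnj (D v x)) = L2_norm (D v)" by (rule L2_norm_cmod_eq) simp
  then show ?thesis unfolding cinner_def norm_sob(1)
    using L2_Cauchy_Schwarz[OF D_L2[of u] L2_cnj[OF D_L2[of v]]] by simp
qed

lemma cinner_inner: "cinner u v = Complex (u \<bullet> v) (u \<bullet> scaleC \<i> v)"
  by (simp add: inner_sob_def cinner_scaleC_right complex_eq_iff)

lemma cinner_nondegenerate: "(\<And>z. cinner u z = cinner w z) \<Longrightarrow> u = w"
  using cinner_eq_0_iff[of "u - w"] by (simp add: cinner_diff)

lemma norm_scaleC: "norm (scaleC c u) = cmod c * norm u"
proof -
  have "cinner (scaleC c u) (scaleC c u) = (c * cnj c) * cinner u u" by (simp add: cinner_scaleC_left cinner_scaleC_right)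
  then have "complex_of_real ((norm (scaleC c u))\<^sup>2) = complex_of_real ((cmod c * norm u)\<^sup>2)"
    unfolding cinner_norm complex_norm_square[symmetric] by (simp add: power_mult_distrib)
  then have "(norm (scaleC c u))\<^sup>2 = (cmod c * norm u)\<^sup>2" by (simp only: of_real_eq_iff)
  then show ?thesis by (rule power2_eq_imp_eq) auto
qed

lemma bounded_linear_scaleC: "bounded_linear (scaleC c)"
  by (rule bounded_linear_intro[of _ "cmod c"]) (simp_all add: scaleC_add scaleR_scaleC scaleC_scaleC norm_scaleC mult.commute)

text \<open>The Riesz map. It is shown to be an isometric bijection of the Sobolev space onto its
  antidual, and the antidual to coincide with the completion \<^const>\<open>sobolev_dual\<close>.\<close>

definition functional_of :: "sob \<Rightarrow> functional" where
  "functional_of v = dirichlet (fn v)"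

lemma functional_of_fn [simp]: "functional_of v (fn z) = cinner v z"
  by (simp add: functional_of_def dirichlet_def cinner_def D_def)

lemma functional_of_outside: "z \<notin> sobolev \<Longrightarrow> functional_of v z = 0"
  by (simp add: functional_of_def dirichlet_def)

lemma sobolev_cases: obtains (sob) u where "z = fn u" | (outside) "z \<notin> sobolev"
  using fn_mk by metis

lemma functional_eqI:
  assumes "\<And>u. \<phi> (fn u) = \<psi> (fn u)" "\<And>z. z \<notin> sobolev \<Longrightarrow> \<phi> z = \<psi> z"
  shows "\<phi> = \<psi>"
proof
  fix z show "\<phi> z = \<psi> z" by (cases z rule: sobolev_cases) (auto simp: assms)
qed

lemma functional_of_diff: "functional_of (u - v) = functional_of u - functional_of v"
  by (rule functional_eqI) (auto simp: cinner_diff functional_of_outside)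

lemma functional_of_inject: "functional_of u = functional_of v \<longleftrightarrow> u = v"
  using cinner_nondegenerate functional_of_fn by metis

lemma antidualD:
  assumes "\<phi> \<in> antidual"
  shows "\<phi> (fn (u + v)) = \<phi> (fn u) + \<phi> (fn v)" "\<phi> (fn (scaleC c u)) = cnj c * \<phi> (fn u)"
    "\<exists>C. \<forall>u. cmod (\<phi> (fn u)) \<le> C * norm u" "z \<notin> sobolev \<Longrightarrow> \<phi> z = 0"
proof -
  obtain C where "\<forall>y\<in>sobolev. cmod (\<phi> y) \<le> C * sob_norm y" using assms by (auto simp: antidual_def)
  then have "\<forall>u. cmod (\<phi> (fn u)) \<le> C * norm u" by (simp add: norm_sob(2))
  then show "\<exists>C. \<forall>u. cmod (\<phi> (fn u)) \<le> C * norm u" by blast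
qed (use assms in \<open>auto simp: antidual_def plus_fun_def\<close>)

lemma antidualI:
  assumes "\<And>u v. \<phi> (fn (u + v)) = \<phi> (fn u) + \<phi> (fn v)" "\<And>c u. \<phi> (fn (scaleC c u)) = cnj c * \<phi> (fn u)"
    "\<And>u. cmod (\<phi> (fn u)) \<le> C * norm u" "\<And>z. z \<notin> sobolev \<Longrightarrow> \<phi> z = 0"
  shows "\<phi> \<in> antidual"
  unfolding antidual_def
proof (intro CollectI conjI)
  show "\<forall>y\<in>sobolev. \<forall>z\<in>sobolev. \<phi> (y + z) = \<phi> y + \<phi> z"
  proof (intro ballI)
    fix y z assume "y \<in> sobolev" "z \<in> sobolev"
    then show "\<phi> (y + z) = \<phi> y + \<phi> z" using assms(1)[of "mk y" "mk z"] by (simp add: plus_fun_def)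
  qed
  show "\<forall>c. \<forall>y\<in>sobolev. \<phi> (\<lambda>x. c * y x) = cnj c * \<phi> y"
  proof (intro allI ballI)
    fix c y assume "y \<in> sobolev"
    then show "\<phi> (\<lambda>x. c * y x) = cnj c * \<phi> y" using assms(2)[of c "mk y"] by simp
  qed
  show "\<exists>C. \<forall>y\<in>sobolev. cmod (\<phi> y) \<le> C * sob_norm y"
  proof (intro exI ballI)
    fix y assume "y \<in> sobolev"
    then show "cmod (\<phi> y) \<le> C * sob_norm y" using assms(3)[of "mk y"] by (simp add: norm_sob(2))
  qed
qed (use assms(4) in blast)

lemma antidual_eq: "antidual = range functional_of"
proof (intro equalityI subsetI)
  fix \<phi> assume \<phi>: "\<phi> \<in> antidual"
  define f where "f u = Re (\<phi> (fn u))" for u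
  obtain C where C: "\<And>u. cmod (\<phi> (fn u)) \<le> C * norm u" using antidualD(3)[OF \<phi>] by blast
  have "bounded_linear f"
  proof (rule bounded_linear_intro)
    show "norm (f u) \<le> norm u * C" for u
      using C[of u] abs_Re_le_cmod[of "\<phi> (fn u)"] by (simp add: f_def mult.commute)
  qed (simp_all only: f_def scaleR_scaleC antidualD[OF \<phi>], simp_all)
  then obtain v where v: "\<And>u. f u = v \<bullet> u" using riesz_representation by blast
  have "\<phi> = functional_of v"
  proof (rule functional_eqI)
    fix u
    have "Im (\<phi> (fn u)) = f (scaleC \<i> u)" unfolding f_def antidualD(2)[OF \<phi>] by simp
    then show "\<phi> (fn u) = functional_of v (fn u)"
      unfolding functional_of_fn cinner_inner v[symmetric] by (simp add: f_def complex_eq_iff)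
  qed (simp add: functional_of_outside antidualD(4)[OF \<phi>])
  then show "\<phi> \<in> range functional_of" by simp
next
  fix \<phi> assume "\<phi> \<in> range functional_of"
  then obtain v where v: "\<phi> = functional_of v" by blast
  show "\<phi> \<in> antidual" unfolding v
    by (rule antidualI[of _ "norm v"])
      (simp_all only: functional_of_fn cinner_add_right cinner_scaleC_right cinner_bound functional_of_outside not_False_eq_True)
qed

text \<open>The dual norm is a supremum over the unit sphere, which is thereby nonempty.\<close>

lemma exists_nonzero: "\<exists>u::sob. u \<noteq> 0"
proof -
  define g where "g x = 1 - 2 * complex_of_real x" for x
  have g: "g \<in> L2" unfolding g_def[abs_def] by (intro L2_continuous continuous_intros)
  define y where "y x = (if x \<in> {0..1} then prim g x else 0)" for x
  have p: "prim g x = complex_of_real (x - x\<^sup>2)" if "x \<in> {0..1}" for x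
  proof -
    have "(g has_integral (complex_of_real (x - x\<^sup>2) - complex_of_real (0 - 0\<^sup>2))) {0..x}"
    proof (rule fundamental_theorem_of_calculus)
      fix a :: real assume "a \<in> {0..x}"
      have "((\<lambda>x. x - x\<^sup>2) has_real_derivative (1 - 2 * a)) (at a within {0..x})"
        by (auto intro!: derivative_eq_intros)
      from has_vector_derivative_of_real[OF this]
      show "((\<lambda>x. complex_of_real (x - x\<^sup>2)) has_vector_derivative g a) (at a within {0..x})"
        by (simp add: g_def)
    qed (use that in simp)
    then show ?thesis using prim_HK(2)[OF L2_integrable[OF g] that] by (simp add: integral_unique)
  qed
  have y: "y \<in> sobolev" by (rule sobolevI[OF g]) (auto simp: y_def p)
  have "y (1/2) \<noteq> 0" by (simp add: y_def p power2_eq_square)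
  then have "mk y \<noteq> 0" using y by (metis fn_0 fn_mk)
  then show ?thesis by blast
qed

lemma dual_norm_functional_of: "dual_norm (functional_of v) = norm v"
proof -
  have "\<exists>w. norm w = 1 \<and> norm v = cmod (cinner v w)"
  proof (cases "v = 0")
    case True
    obtain u :: sob where "u \<noteq> 0" using exists_nonzero by blast
    then show ?thesis using True by (intro exI[of _ "sgn u"]) (simp add: norm_sgn)
  next
    case False
    then show ?thesis
      by (intro exI[of _ "sgn v"])
        (simp add: norm_scaleC sgn_div_norm scaleR_scaleC cinner_scaleC_right cinner_norm norm_mult norm_power norm_inverse power2_eq_square)
  qed
  then obtain w where w: "norm w = 1" "norm v = cmod (cinner v w)" by blast
  have le: "cmod (functional_of v z) \<le> norm v" if "z \<in> {z \<in> sobolev. sob_norm z = 1}" for z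
  proof -
    have "functional_of v z = cinner v (mk z)" using functional_of_fn[of v "mk z"] that by (simp del: functional_of_fn)
    then show ?thesis using cinner_bound[of v "mk z"] that by (simp add: norm_sob(2)[of "mk z"])
  qed
  have win: "fn w \<in> {z \<in> sobolev. sob_norm z = 1}" using w by (simp add: norm_sob(2)[symmetric])
  show ?thesis unfolding dual_norm_def
  proof (rule cSup_eq_maximum)
    show "norm v \<in> (\<lambda>z. cmod (functional_of v z)) ` {z \<in> sobolev. sob_norm z = 1}"
      by (rule image_eqI[OF _ win]) (simp add: w(2))
    show "a \<le> norm v" if "a \<in> (\<lambda>z. cmod (functional_of v z)) ` {z \<in> sobolev. sob_norm z = 1}" for a
      using that le by blast
  qed
qed

lemma L2_norm_le_sup:
  assumes "\<And>x. x \<in> {0..1} \<Longrightarrow> cmod (f x) \<le> C" "f \<in> L2" "C \<ge> 0"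
  shows "L2_norm f \<le> C"
proof -
  have "(LINT x|U. (cmod (f x))\<^sup>2) \<le> (LINT x|U. C\<^sup>2)"
    using assms by (intro integral_mono L2_integrable_sq power_mono) auto
  then have "(L2_norm f)\<^sup>2 \<le> C\<^sup>2" by (simp add: L2_norm_sq measure_U)
  then show ?thesis using assms(3) by (rule power2_le_imp_le)
qed

lemma embed_L2_fn: "embed_L2 f (fn z) = (LINT x|U. f x * cnj (fn z x))"
  by (simp add: embed_L2_def)

lemma embed_L2_bound:
  assumes f: "f \<in> L2" and C: "\<And>x. x \<in> {0..1} \<Longrightarrow> cmod (fn z x) \<le> C" and "C \<ge> 0"
  shows "cmod (embed_L2 f (fn z)) \<le> L2_norm f * C"
proof -
  have "cmod (embed_L2 f (fn z)) \<le> L2_norm f * L2_norm (\<lambda>x. cnj (fn z x))"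
    unfolding embed_L2_fn by (rule L2_Cauchy_Schwarz[OF f L2_cnj[OF sobolev_L2[OF fn]]])
  also have "\<dots> \<le> L2_norm f * C"
    using assms L2_cnj[OF sobolev_L2[OF fn]] by (intro mult_left_mono L2_norm_nonneg L2_norm_le_sup) auto
  finally show ?thesis .
qed

lemma fn_sup_le: "cmod (fn u x) \<le> norm u"
  using sobolev_sup_le[OF fn] by (simp add: norm_sob(2))

lemma embed_L2_antidual:
  assumes f: "f \<in> L2" shows "embed_L2 f \<in> antidual"
proof (rule antidualI)
  have i: "integrable U (\<lambda>x. f x * cnj (fn u x))" for u
    by (intro L2_mult_integrable L2_cnj f sobolev_L2 fn)
  show "embed_L2 f (fn (u + v)) = embed_L2 f (fn u) + embed_L2 f (fn v)" for u v
    unfolding embed_L2_fn using i by (simp add: distrib_left)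
  show "embed_L2 f (fn (scaleC c u)) = cnj c * embed_L2 f (fn u)" for c u
    unfolding embed_L2_fn using i by (simp add: mult.left_commute)
  show "cmod (embed_L2 f (fn u)) \<le> L2_norm f * norm u" for u
    by (rule embed_L2_bound[OF f fn_sup_le]) simp
qed (simp add: embed_L2_def)

lemma fn_eq_0_if_AE:
  assumes "AE x in U. fn u x = 0" shows "u = 0"
proof -
  have c: "continuous_on {0..1} (\<lambda>x. cmod (fn u x))" by (intro continuous_intros sobolev_continuous fn)
  have "(LINT x|U. cmod (fn u x)) = 0" by (rule integral_eq_zero_AE) (use assms in auto)
  then have "cmod (fn u x) = 0" if "x \<in> {0..1}" for x using integralL_eq_0_iff[OF c] that by simp
  moreover have "fn u x = 0" if "x \<notin> {0..1}" for x using sobolevD(4)[OF fn that] .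
  ultimately show ?thesis by (intro sob_eqI) auto
qed

lemma subspace_closure:
  fixes S :: "'a::real_normed_vector set"
  assumes "subspace S" shows "subspace (closure S)"
  unfolding subspace_def
proof (intro conjI ballI allI)
  show "0 \<in> closure S" using subspace_0[OF assms] closure_subset by blast
next
  fix x y assume "x \<in> closure S" "y \<in> closure S"
  then obtain a b where "\<And>n. a n \<in> S" "a \<longlonglongrightarrow> x" "\<And>n. b n \<in> S" "b \<longlonglongrightarrow> y" by (auto simp: closure_sequential)
  then show "x + y \<in> closure S" unfolding closure_sequential
    by (intro exI[of _ "\<lambda>n. a n + b n"]) (auto intro: tendsto_add subspace_add[OF assms])
next
  fix x and c :: real assume "x \<in> closure S"
  then obtain a where "\<And>n. a n \<in> S" "a \<longlonglongrightarrow> x" by (auto simp: closure_sequential)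
  then show "c *\<^sub>R x \<in> closure S" unfolding closure_sequential
    by (intro exI[of _ "\<lambda>n. c *\<^sub>R a n"]) (auto intro: tendsto_scaleR subspace_scale[OF assms])
qed

text \<open>Square integrable functions are dense in the antidual: a Sobolev function \<open>v\<close> that is
  orthogonal to the representatives of all of them is orthogonal to that of \<open>v\<close> itself, so that
  \<open>\<integral> v cnj v = 0\<close>.\<close>

lemma sobolev_dual_eq: "sobolev_dual = range functional_of"
proof -
  define S where "S = {w. \<exists>f\<in>L2. functional_of w = embed_L2 f}"
  have Sf: "\<exists>w\<in>S. functional_of w = embed_L2 f" if "f \<in> L2" for f
    using embed_L2_antidual[OF that] that unfolding antidual_eq S_def by (metis (mono_tags, lifting) mem_Collect_eq rangeE)
  have SI: "w \<in> S" if "f \<in> L2" "\<And>z. cinner w z = embed_L2 f (fn z)" for w f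
    unfolding S_def using that by (intro CollectI bexI[of _ f] functional_eqI) (auto simp: functional_of_outside embed_L2_def)
  have Se: "\<exists>f\<in>L2. \<forall>z. cinner w z = embed_L2 f (fn z)" if wS: "w \<in> S" for w
  proof -
    obtain f where f: "f \<in> L2" "functional_of w = embed_L2 f" using wS by (auto simp: S_def)
    then have "\<forall>z. cinner w z = embed_L2 f (fn z)" using functional_of_fn[of w] by simp
    with f show ?thesis by blast
  qed
  have i: "integrable U (\<lambda>x. f x * cnj (fn u x))" if "f \<in> L2" for u f
    by (intro L2_mult_integrable L2_cnj that sobolev_L2 fn)
  have "subspace S"
    unfolding subspace_def
  proof (intro conjI ballI allI)
    show "0 \<in> S" by (rule SI[OF L2_const[of 0]]) (simp add: embed_L2_fn)
    show "x + y \<in> S" if xy: "x \<in> S" "y \<in> S" for x y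
    proof -
      obtain f g where "f \<in> L2" "g \<in> L2" "\<And>z. cinner x z = embed_L2 f (fn z)" "\<And>z. cinner y z = embed_L2 g (fn z)"
        using xy[THEN Se] by blast
      then show ?thesis by (intro SI[OF L2_add[of f g]]) (auto simp: cinner_add_left embed_L2_fn distrib_right i)
    qed
    show "c *\<^sub>R x \<in> S" if x: "x \<in> S" for c x
    proof -
      obtain f where "f \<in> L2" "\<And>z. cinner x z = embed_L2 f (fn z)" using x[THEN Se] by blast
      then show ?thesis
        by (intro SI[OF L2_scale[of f "complex_of_real c"]]) (auto simp: scaleR_scaleC cinner_scaleC_left embed_L2_fn mult.assoc i)
    qed
  qed
  moreover have "v = 0" if v: "\<And>s. s \<in> closure S \<Longrightarrow> s \<bullet> v = 0" for v
  proof -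
    have f: "fn v \<in> L2" by (rule sobolev_L2[OF fn])
    obtain w where w: "w \<in> S" "functional_of w = embed_L2 (fn v)" using Sf[OF f] by blast
    have "cinner w v = (LINT x|U. fn v x * cnj (fn v x))" using functional_of_fn[of w v] w(2) by (simp add: embed_L2_fn)
    also have "\<dots> = complex_of_real ((L2_norm (fn v))\<^sup>2)"
      unfolding L2_norm_sq complex_norm_square[symmetric] by (rule integral_complex_of_real)
    finally have "(L2_norm (fn v))\<^sup>2 = w \<bullet> v" by (simp add: inner_sob_def)
    also have "\<dots> = 0" using v w(1) closure_subset by blast
    finally show ?thesis using L2_norm_eq_0[OF f] fn_eq_0_if_AE by simp
  qed
  ultimately have dense: "closure S = UNIV" by (intro closed_subspace_eq_UNIV subspace_closure) auto
  have "functional_of v \<in> sobolev_dual" for v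
    unfolding sobolev_dual_def antidual_eq
  proof (intro CollectI conjI allI impI)
    fix e :: real assume "e > 0"
    moreover have "v \<in> closure S" using dense by simp
    ultimately obtain w where w: "w \<in> S" "dist w v < e" using closure_approachable by blast
    then obtain f where "f \<in> L2" "functional_of w = embed_L2 f" by (auto simp: S_def)
    moreover have "dual_norm (functional_of v - functional_of w) < e"
      using w(2) by (simp add: functional_of_diff[symmetric] dual_norm_functional_of dist_norm norm_minus_commute)
    ultimately show "\<exists>f\<in>L2. dual_norm (functional_of v - embed_L2 f) < e" by metis
  qed simp
  moreover have "sobolev_dual \<subseteq> range functional_of" using antidual_eq by (auto simp: sobolev_dual_def)
  ultimately show ?thesis by auto
qed

section \<open>The operator of the weight\<close>

text \<open>The product \<open>cnj y z\<close>, to which the weight is applied.\<close>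

definition cmul :: "sob \<Rightarrow> sob \<Rightarrow> sob" where
  "cmul y z = mk (\<lambda>x. cnj (fn y x) * fn z x)"

lemma fn_cmul [simp]: "fn (cmul y z) = (\<lambda>x. cnj (fn y x) * fn z x)"
  unfolding cmul_def by (rule fn_mk[OF sobolev_mult(1)[OF sobolev_cnj(1)[OF fn] fn]])

lemma D_cmul: "AE x in U. D (cmul y z) x = cnj (D y x) * fn z x + cnj (fn y x) * D z x"
  using sobolev_mult(2)[OF sobolev_cnj(1)[OF fn[of y]] fn[of z]] sobolev_cnj(2)[OF fn[of y]]
  unfolding D_def fn_cmul by eventually_elim simp

lemma cmul_linear:
  "cmul (y + y') z = cmul y z + cmul y' z" "cmul (scaleC c y) z = scaleC (cnj c) (cmul y z)"
  "cmul y (z + z') = cmul y z + cmul y z'" "cmul y (scaleC c z) = scaleC c (cmul y z)"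
  by (rule sob_eqI, simp add: distrib_left distrib_right mult.left_commute)+

lemma norm_cmul_le: "norm (cmul y z) \<le> 2 * norm y * norm z"
proof -
  let ?h = "\<lambda>x. 2 * (norm z)\<^sup>2 * (cmod (D y x))\<^sup>2 + 2 * (norm y)\<^sup>2 * (cmod (D z x))\<^sup>2"
  have "(norm (cmul y z))\<^sup>2 = (LINT x|U. (cmod (D (cmul y z) x))\<^sup>2)" by (simp add: norm_sob(1) L2_norm_sq)
  also have "\<dots> \<le> (LINT x|U. ?h x)"
  proof (rule integral_mono_AE)
    show "AE x in U. (cmod (D (cmul y z) x))\<^sup>2 \<le> ?h x"
      using D_cmul[of y z]
    proof eventually_elim
      case (elim x)
      define a where "a = cmod (D y x) * norm z"
      define b where "b = norm y * cmod (D z x)"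
      have "cmod (D (cmul y z) x) \<le> a + b"
        unfolding elim a_def b_def
        by (rule order_trans[OF norm_triangle_ineq])
          (auto simp: norm_mult intro!: add_mono mult_mono fn_sup_le)
      then have "(cmod (D (cmul y z) x))\<^sup>2 \<le> (a + b)\<^sup>2" by (intro power_mono) auto
      also have "\<dots> \<le> 2 * a\<^sup>2 + 2 * b\<^sup>2" using sum_squares_bound[of a b] by (simp add: power2_sum)
      finally show ?case by (simp add: a_def b_def power_mult_distrib mult_ac)
    qed
  qed (use L2_integrable_sq[OF D_L2] in auto)
  also have "\<dots> = (2 * norm y * norm z)\<^sup>2"
    using L2_integrable_sq[OF D_L2] by (simp add: L2_norm_sq[symmetric] norm_sob(1)[symmetric] power_mult_distrib)
  finally show ?thesis by (rule power2_le_imp_le) simp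
qed

lemma weight_fn: "weight \<rho> (fn y) (fn z) = \<rho> (fn (cmul y z))"
  by (simp add: weight_def)

text \<open>A weight as in the theorem.\<close>

locale real_weight =
  fixes \<rho> :: functional
  assumes dual: "\<rho> \<in> sobolev_dual" and real: "real_functional \<rho>"
begin

lemma rho_ex: "\<exists>v. \<rho> = functional_of v"
  using dual sobolev_dual_eq by blast

text \<open>The operator of the weight: \<open>cinner (K y) z\<close> is the weight form, so that \<open>T_pencil \<rho> l\<close>
  corresponds to \<open>1 - l K\<close> under the Riesz map. Such a vector exists by \<open>cinner_K\<close> and is unique
  by \<open>cinner_nondegenerate\<close>.\<close>

definition K :: "sob \<Rightarrow> sob" where
  "K y = (SOME w. \<forall>z. cinner w z = \<rho> (fn (cmul y z)))"

lemma rho_cinner: "\<exists>v. \<forall>u. \<rho> (fn u) = cinner v u"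
  using rho_ex functional_of_fn by metis

lemma cinner_K: "cinner (K y) z = \<rho> (fn (cmul y z))"
proof -
  obtain v where v: "\<rho> = functional_of v" using rho_ex by blast
  define \<psi> where "\<psi> z = (if z \<in> sobolev then cinner v (cmul y (mk z)) else 0)" for z
  have "\<psi> \<in> antidual"
  proof (rule antidualI)
    show "cmod (\<psi> (fn u)) \<le> (norm v * (2 * norm y)) * norm u" for u
    proof -
      have "norm v * norm (cmul y u) \<le> norm v * (2 * norm y * norm u)"
        by (intro mult_left_mono norm_cmul_le) simp
      with cinner_bound[of v "cmul y u"] show ?thesis by (simp add: \<psi>_def mult.assoc)
    qed
    show "\<psi> (fn (u + v)) = \<psi> (fn u) + \<psi> (fn v)" for u v
      unfolding \<psi>_def using fn mk_fn by (simp only: if_True cmul_linear cinner_add_right)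
    show "\<psi> (fn (scaleC c u)) = cnj c * \<psi> (fn u)" for c u
      unfolding \<psi>_def using fn mk_fn by (simp only: if_True cmul_linear cinner_scaleC_right)
  qed (simp add: \<psi>_def)
  then obtain w where "\<psi> = functional_of w" using antidual_eq by blast
  then have "\<forall>z. cinner w z = \<rho> (fn (cmul y z))"
    unfolding v functional_of_fn by (metis \<psi>_def fn functional_of_fn mk_fn)
  then show ?thesis unfolding K_def by (rule someI2[where Q = "\<lambda>w. cinner w z = _"]) blast
qed

lemma rho_linear: "\<rho> (fn (u + w)) = \<rho> (fn u) + \<rho> (fn w)" "\<rho> (fn (scaleC c u)) = cnj c * \<rho> (fn u)"
proof -
  obtain v where "\<rho> = functional_of v" using rho_ex by blast
  then show "\<rho> (fn (u + w)) = \<rho> (fn u) + \<rho> (fn w)" "\<rho> (fn (scaleC c u)) = cnj c * \<rho> (fn u)"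
    by (simp_all only: functional_of_fn cinner_add_right cinner_scaleC_right)
qed

lemma K_add: "K (y + y') = K y + K y'" and K_scaleC: "K (scaleC c y) = scaleC c (K y)"
  by (rule cinner_nondegenerate, simp only: cinner_K cmul_linear rho_linear cinner_add_left cinner_scaleC_left complex_cnj_cnj)+

lemma K_bounded_linear: "bounded_linear K"
proof -
  obtain v where v: "\<And>u. \<rho> (fn u) = cinner v u" using rho_cinner by blast
  show ?thesis
  proof (rule bounded_linear_intro)
    fix y
    have "(norm (K y))\<^sup>2 = cmod (cinner (K y) (K y))" by (simp add: cinner_norm norm_power)
    also have "\<dots> = cmod (cinner v (cmul y (K y)))" unfolding cinner_K v ..
    also have "\<dots> \<le> norm v * (2 * norm y * norm (K y))"
      by (rule order_trans[OF cinner_bound]) (intro mult_left_mono norm_cmul_le norm_ge_zero)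
    finally have "norm (K y) * norm (K y) \<le> (norm y * (2 * norm v)) * norm (K y)" by (simp add: power2_eq_square mult_ac)
    then show "norm (K y) \<le> norm y * (2 * norm v)"
      by (cases "K y = 0") auto
  qed (simp_all add: K_add K_scaleC scaleR_scaleC)
qed

text \<open>Reality of the weight, extended from real functions to complex ones by splitting into real
  and imaginary parts.\<close>

lemma rho_cnj: "\<rho> (\<lambda>x. cnj (fn u x)) = cnj (\<rho> (fn u))"
proof -
  define c where "c = mk (\<lambda>x. cnj (fn u x))"
  have fc: "fn c = (\<lambda>x. cnj (fn u x))" by (simp add: c_def sobolev_cnj)
  define a where "a = scaleC (1/2) (u + c)"
  define b where "b = scaleC (1/(2*\<i>)) (u + scaleC (-1) c)"
  have "fn a x = complex_of_real (Re (fn u x))" "fn b x = complex_of_real (Im (fn u x))" for x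
    by (simp_all add: a_def b_def fc complex_eq_iff)
  then have R: "\<rho> (fn a) \<in> \<real>" "\<rho> (fn b) \<in> \<real>"
    using real fn unfolding real_functional_def by (metis Reals_of_real)+
  have "u = a + scaleC \<i> b" "c = a + scaleC (- \<i>) b"
    by (rule sob_eqI, simp add: a_def b_def fc field_simps)+
  then have "\<rho> (fn u) = \<rho> (fn a) - \<i> * \<rho> (fn b)" "\<rho> (fn c) = \<rho> (fn a) + \<i> * \<rho> (fn b)"
    by (metis rho_linear complex_cnj_i complex_cnj_minus minus_minus diff_conv_add_uminus mult_minus_left)+
  then show ?thesis using R unfolding fc[symmetric] by (auto elim!: Reals_cases)
qed

lemma K_selfadjoint: "cinner (K y) z = cinner y (K z)"
proof -
  have "fn (cmul y z) = (\<lambda>x. cnj (fn (cmul z y) x))" by (simp add: mult.commute)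
  then have "cinner (K y) z = cnj (cinner (K z) y)" unfolding cinner_K by (simp only: rho_cnj)
  then show ?thesis by (simp add: cinner_commute)
qed

text \<open>Up to a small error in the dual norm the weight is a square integrable function \<open>f\<close>, for which
  \<open>\<integral> f y cnj z\<close> is controlled by the supremum of \<open>y\<close> and the norm of \<open>z\<close>; and a bounded
  sequence, being equicontinuous, has a uniformly convergent subsequence.\<close>

lemma K_compact: "compact_op K"
  unfolding compact_op_def
proof (intro allI impI)
  fix s :: "nat \<Rightarrow> sob" assume "bounded (range s)"
  then obtain R where R: "R > 0" "\<And>n. norm (s n) \<le> R" unfolding bounded_pos by auto
  obtain v where v: "\<rho> = functional_of v" using rho_ex by blast
  have "\<exists>g k. continuous_on {0..1} g \<and> strict_mono (k :: nat \<Rightarrow> nat) \<and>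
      (\<forall>e>0. \<exists>N. \<forall>n x. n \<ge> N \<and> x \<in> {0..1} \<longrightarrow> norm (fn (s (k n)) x - g x) < e)"
  proof (rule Arzela_Ascoli[of "{0..1::real}" "\<lambda>n. fn (s n)" R])
    show "norm (fn (s n) x) \<le> R" for n x using fn_sup_le[of "s n" x] R(2)[of n] by linarith
    fix x e :: real assume x: "x \<in> {0..1}" and e: "e > 0"
    show "\<exists>d>0. \<forall>n y. y \<in> {0..1} \<and> norm (x - y) < d \<longrightarrow> norm (fn (s n) x - fn (s n) y) < e"
    proof (intro exI conjI allI impI)
      show "(e / R)\<^sup>2 > 0" using e R by simp
      fix n y assume y: "y \<in> {0..1} \<and> norm (x - y) < (e / R)\<^sup>2"
      have "norm (fn (s n) x - fn (s n) y) \<le> sqrt \<bar>x - y\<bar> * norm (s n)"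
        using sobolev_holder[OF fn x] y by (simp add: norm_sob(2))
      also have "\<dots> \<le> sqrt \<bar>x - y\<bar> * R" using R by (intro mult_left_mono) auto
      also have "sqrt \<bar>x - y\<bar> < e / R" using y e R by (intro real_less_lsqrt) auto
      then have "sqrt \<bar>x - y\<bar> * R < e" using R by (simp add: field_simps)
      finally show "norm (fn (s n) x - fn (s n) y) < e" .
    qed
  qed (rule compact_Icc, blast)
  then obtain g k where k: "strict_mono (k :: nat \<Rightarrow> nat)"
    and g: "\<And>e. e > 0 \<Longrightarrow> \<exists>N. \<forall>n x. n \<ge> N \<and> x \<in> {0..1} \<longrightarrow> norm (fn (s (k n)) x - g x) < e" by blast
  interpret K: bounded_linear K by (rule K_bounded_linear)
  have "Cauchy (\<lambda>n. K (s (k n)))"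
    unfolding Cauchy_iff
  proof (intro allI impI)
    fix e :: real assume e: "e > 0"
    define e' where "e' = e / (8 * R)"
    have e': "e' > 0" using e R by (simp add: e'_def)
    obtain f where f: "f \<in> L2" "dual_norm (\<rho> - embed_L2 f) < e'"
      using dual e' unfolding sobolev_dual_def by blast
    obtain w where w: "embed_L2 f = functional_of w" using embed_L2_antidual[OF f(1)] antidual_eq by blast
    have vw: "norm (v - w) < e'" using f(2) unfolding v w functional_of_diff[symmetric] dual_norm_functional_of .
    define \<delta> where "\<delta> = e / (4 * (L2_norm f + 1))"
    have Lf: "L2_norm f \<ge> 0" by (rule L2_norm_nonneg)
    have \<delta>: "\<delta> > 0" using e Lf by (simp add: \<delta>_def)
    obtain N where N: "\<And>n x. n \<ge> N \<Longrightarrow> x \<in> {0..1} \<Longrightarrow> norm (fn (s (k n)) x - g x) < \<delta>" using g[OF \<delta>] by blast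
    show "\<exists>M. \<forall>m\<ge>M. \<forall>n\<ge>M. norm (K (s (k m)) - K (s (k n))) < e"
    proof (intro exI[of _ N] allI impI)
      fix m n assume mn: "m \<ge> N" "n \<ge> N"
      define u where "u = s (k m) - s (k n)"
      define t where "t = K u"
      have u: "cmod (fn u x) \<le> 2 * \<delta>" if "x \<in> {0..1}" for x
        using N[OF mn(1) that] N[OF mn(2) that] norm_triangle_ineq4[of "fn (s (k m)) x - g x" "fn (s (k n)) x - g x"]
        by (simp add: u_def)
      have nu: "norm u \<le> 2 * R" unfolding u_def using norm_triangle_ineq4[of "s (k m)" "s (k n)"] R(2)[of "k m"] R(2)[of "k n"] by linarith
      have "(norm t)\<^sup>2 = cmod (cinner t t)" by (simp add: cinner_norm norm_power)
      also have "cinner t t = cinner v (cmul u t)" using cinner_K[of u t] functional_of_fn[of v] unfolding t_def[symmetric] v[symmetric] by metis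
      also have "\<dots> = cinner (v - w) (cmul u t) + embed_L2 f (fn (cmul u t))"
        unfolding w functional_of_fn by (simp add: cinner_diff)
      also have "cmod \<dots> \<le> e' * (2 * (2 * R) * norm t) + L2_norm f * (2 * \<delta> * norm t)"
      proof (rule order_trans[OF norm_triangle_ineq], rule add_mono)
        show "cmod (cinner (v - w) (cmul u t)) \<le> e' * (2 * (2 * R) * norm t)"
        proof (rule order_trans[OF cinner_bound], rule mult_mono)
          have "2 * norm u * norm t \<le> 2 * (2 * R) * norm t" using nu by (intro mult_right_mono) auto
          with norm_cmul_le[of u t] show "norm (cmul u t) \<le> 2 * (2 * R) * norm t" by linarith
        qed (use vw e' in auto)
        show "cmod (embed_L2 f (fn (cmul u t))) \<le> L2_norm f * (2 * \<delta> * norm t)"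
        proof (rule embed_L2_bound[OF f(1)])
          show "cmod (fn (cmul u t) x) \<le> 2 * \<delta> * norm t" if "x \<in> {0..1}" for x
            using u[OF that] fn_sup_le[of t x] \<delta> by (simp add: norm_mult mult_mono)
        qed (use \<delta> in auto)
      qed
      finally have "norm t * norm t \<le> (4 * R * e' + 2 * L2_norm f * \<delta>) * norm t"
        by (simp add: power2_eq_square algebra_simps)
      then have "norm t \<le> 4 * R * e' + 2 * L2_norm f * \<delta> \<or> t = 0" by (cases "t = 0") auto
      moreover have "4 * R * e' = e / 2" using R by (simp add: e'_def)
      moreover have "2 * L2_norm f * \<delta> < e / 2"
        using e Lf unfolding \<delta>_def by (simp add: field_simps)
      ultimately have "norm t < e" using e by (elim disjE) (linarith, simp)
      then show "norm (K (s (k m)) - K (s (k n))) < e" by (simp add: t_def u_def K.diff)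
    qed
  qed
  then have "convergent (\<lambda>n. K (s (k n)))" by (rule Cauchy_convergent)
  with k show "\<exists>r. strict_mono r \<and> convergent (\<lambda>n. K (s (r n)))" by blast
qed

lemma T_pencil_fn: "T_pencil \<rho> l (fn y) = functional_of (y - scaleC l (K y))"
proof (rule functional_eqI)
  show "T_pencil \<rho> l (fn y) (fn z) = functional_of (y - scaleC l (K y)) (fn z)" for z
    using functional_of_fn[of y z, unfolded functional_of_def]
    by (simp only: pencil_def weight_fn cinner_K[symmetric] functional_of_fn cinner_diff cinner_scaleC_left)
  show "z \<notin> sobolev \<Longrightarrow> T_pencil \<rho> l (fn y) z = functional_of (y - scaleC l (K y)) z" for z
    by (simp add: pencil_def weight_def dirichlet_def functional_of_outside)
qed

end

section \<open>One-dimensional eigenspaces\<close>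

text \<open>Gronwall's lemma with an integrable coefficient: \<open>m\<close> vanishes step by step on intervals over
  which the integral of \<open>a\<close> is less than \<open>1/2\<close>.\<close>

lemma gronwall_zero:
  fixes m a :: "real \<Rightarrow> real"
  assumes a: "integrable U a" "\<And>t. t \<in> {0..1} \<Longrightarrow> a t \<ge> 0"
    and m: "continuous_on {0..1} m" "\<And>t. t \<in> {0..1} \<Longrightarrow> m t \<ge> 0" "m 0 = 0"
    and le: "\<And>x y. 0 \<le> x \<Longrightarrow> x \<le> y \<Longrightarrow> y \<le> 1 \<Longrightarrow> m y - m x \<le> (LINT t|U. indicator {x<..y} t * (a t * m t))"
    and x: "x \<in> {0..1}"
  shows "m x = 0"
proof -
  define A where "A = prim (\<lambda>t. complex_of_real (a t))"
  have ac: "integrable U (\<lambda>t. complex_of_real (a t))" using a(1) by simp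
  have "uniformly_continuous_on {0..1} A"
    unfolding A_def by (intro compact_uniformly_continuous prim_continuous ac compact_Icc)
  then obtain d where d: "d > 0" "\<And>x y. x \<in> {0..1} \<Longrightarrow> y \<in> {0..1} \<Longrightarrow> dist y x < d \<Longrightarrow> dist (A y) (A x) < 1/2"
    unfolding uniformly_continuous_on_def by (meson half_gt_zero zero_less_one)
  have inc: "(LINT t|U. indicator {x<..y} t * a t) < 1/2" if xy: "0 \<le> x" "x \<le> y" "y \<le> 1" "y - x < d" for x y
  proof -
    have "A y - A x = complex_of_real (LINT t|U. indicator {x<..y} t * a t)"
      unfolding A_def prim_increment[OF ac xy(1-3)] integral_complex_of_real[symmetric]
      by (simp add: scaleR_conv_of_real)
    then have "\<bar>LINT t|U. indicator {x<..y} t * a t\<bar> = dist (A y) (A x)"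
      by (simp add: dist_norm)
    also have "\<dots> < 1/2" using xy by (intro d) (auto simp: dist_real_def)
    finally show ?thesis by simp
  qed
  have step: "\<forall>t\<in>{p..q}. m t = 0" if pq: "0 \<le> p" "p \<le> q" "q \<le> 1" "q - p < d" and mp: "m p = 0" for p q
  proof -
    have "continuous_on {p..q} m" using pq by (intro continuous_on_subset[OF m(1)]) auto
    then obtain s where s: "s \<in> {p..q}" "\<And>t. t \<in> {p..q} \<Longrightarrow> m t \<le> m s"
      using continuous_attains_sup[of "{p..q}" m] pq by fastforce
    have sp: "0 \<le> p" "p \<le> s" "s \<le> 1" "s - p < d" using s pq by auto
    have ms: "m s \<ge> 0" using m(2) sp by simp
    have i: "integrable U (\<lambda>t. indicator {p<..s} t * a t)"
      using integrable_indicator_U[OF a(1), of "{p<..s}"] by simp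
    have "m s \<le> (LINT t|U. indicator {p<..s} t * (a t * m t))" using le[OF sp(1-3)] mp by simp
    also have "\<dots> \<le> (LINT t|U. m s * (indicator {p<..s} t * a t))"
    proof (rule integral_mono')
      show "integrable U (\<lambda>t. m s * (indicator {p<..s} t * a t))" using i by simp
      fix t assume "t \<in> space U"
      then have t: "t \<in> {0..1}" by simp
      show "0 \<le> m s * (indicator {p<..s} t * a t)" using a(2)[OF t] ms by (simp split: split_indicator)
      show "indicator {p<..s} t * (a t * m t) \<le> m s * (indicator {p<..s} t * a t)"
        using a(2)[OF t] s(2)[of t] s(1) by (auto simp: mult.commute intro!: mult_left_mono split: split_indicator)
    qed
    also have "\<dots> = m s * (LINT t|U. indicator {p<..s} t * a t)" by simp
    also have "\<dots> \<le> m s * (1/2)" using inc[OF sp] ms by (intro mult_left_mono) auto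
    finally have "m s = 0" using ms by simp
    with s(2) m(2) pq show ?thesis by (metis antisym atLeastAtMost_iff order_trans)
  qed
  obtain n where n: "1 / real (Suc n) < d" using d(1) by (rule nat_approx_posE)
  have "\<forall>t\<in>{0..real k / real (Suc n)}. m t = 0" if "k \<le> Suc n" for k
    using that
  proof (induction k)
    case 0 then show ?case using m(3) by simp
  next
    case (Suc k)
    define p q where pq: "p = real k / real (Suc n)" "q = real (Suc k) / real (Suc n)"
    have IH: "\<forall>t\<in>{0..p}. m t = 0" using Suc unfolding pq by simp
    have "q - p = 1 / real (Suc n)" unfolding pq by (simp add: field_simps)
    moreover have "0 \<le> p" "p \<le> q" "q \<le> 1" using Suc(2) unfolding pq by (auto simp: divide_simps)
    ultimately have "\<forall>t\<in>{p..q}. m t = 0" using n IH by (intro step) auto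
    with IH show ?case unfolding pq[symmetric] by (metis atLeastAtMost_iff linear)
  qed
  from this[of "Suc n"] x show ?thesis by simp
qed

text \<open>If the weight is \<open>z \<mapsto> \<integral> w cnj z'\<close>, that is \<open>- w'\<close> in the sense of distributions, the
  equation \<open>- y'' = l \<rho> y\<close> can be integrated once: \<open>y' - l w y + l \<integral>\<^sub>0\<^sup>x w y' = c\<close>. The constant \<open>c\<close>
  plays the role of the derivative at \<open>0\<close>.\<close>

definition first_integral :: "cfun \<Rightarrow> complex \<Rightarrow> sob \<Rightarrow> complex \<Rightarrow> bool" where
  "first_integral w l y c \<longleftrightarrow>
     (AE x in U. D y x = c + l * (w x * fn y x - prim (\<lambda>t. w t * D y t) x))"

text \<open>Uniqueness in the initial value problem: Gronwall's lemma is applied to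
  \<open>|y| + |\<integral>\<^sub>0\<^sup>x w y'|\<close>.\<close>

lemma first_integral_zero:
  assumes w: "w \<in> L2" and y: "first_integral w l y 0"
  shows "y = 0"
proof -
  define h where "h t = w t * D y t" for t
  define P where "P = prim h"
  have h: "integrable U h" unfolding h_def[abs_def] by (intro L2_mult_integrable w D_L2)
  define m where "m t = cmod (fn y t) + cmod (P t)" for t
  define a where "a t = (1 + cmod (w t)) * (cmod l * (1 + cmod (w t)))" for t
  have Py: "continuous_on {0..1} (fn y)" "continuous_on {0..1} P"
    unfolding P_def by (intro sobolev_continuous fn prim_continuous h)+
  have mc: "continuous_on {0..1} m" unfolding m_def by (intro continuous_intros Py)
  have wi: "integrable U (\<lambda>t. cmod (w t))" "integrable U (\<lambda>t. (cmod (w t))\<^sup>2)"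
    using L2_integrable[OF w] L2_integrable_sq[OF w] by auto
  have "integrable U (\<lambda>t. cmod l * (1 + 2 * cmod (w t) + (cmod (w t))\<^sup>2))" using wi by simp
  also have "(\<lambda>t. cmod l * (1 + 2 * cmod (w t) + (cmod (w t))\<^sup>2)) = a"
    by (rule ext) (simp add: a_def algebra_simps power2_eq_square)
  finally have ai: "integrable U a" .
  have am: "integrable U (\<lambda>t. a t * m t)"
  proof -
    have "integrable U (\<lambda>t. complex_of_real (m t) * complex_of_real (a t))"
      using ai mc by (intro integrable_continuous_mult) (auto intro!: continuous_intros)
    from integrable_Re[OF this] show ?thesis by (simp add: mult.commute)
  qed
  have bound: "AE t in U. cmod (D y t) + cmod (h t) \<le> a t * m t"
    using y unfolding first_integral_def
  proof eventually_elim
    case (elim t)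
    have "cmod (D y t) = cmod l * cmod (w t * fn y t - P t)" 
      using elim by (simp add: norm_mult P_def h_def[abs_def])
    also have "\<dots> \<le> cmod l * (cmod (w t) * cmod (fn y t) + cmod (P t))"
      by (intro mult_left_mono order_trans[OF norm_triangle_ineq4]) (auto simp: norm_mult)
    also have "\<dots> \<le> cmod l * ((1 + cmod (w t)) * m t)"
      by (intro mult_left_mono) (auto simp: m_def algebra_simps)
    finally have "(1 + cmod (w t)) * cmod (D y t) \<le> (1 + cmod (w t)) * (cmod l * ((1 + cmod (w t)) * m t))"
      by (intro mult_left_mono) auto
    then show ?case by (simp add: a_def h_def norm_mult algebra_simps)
  qed
  have m0: "m x = 0" if "x \<in> {0..1}" for x
  proof (rule gronwall_zero[OF ai _ mc _ _ _ that])
    show "a t \<ge> 0" "m t \<ge> 0" for t by (simp_all add: a_def m_def)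
    show "m 0 = 0" by (simp add: m_def P_def prim_0 sobolevD(5)[OF fn])
    fix x x' :: real assume xx: "0 \<le> x" "x \<le> x'" "x' \<le> 1"
    have Di: "integrable U (D y)" by (intro L2_integrable D_L2)
    have "fn y x' - fn y x = prim (D y) x' - prim (D y) x"
      using sobolevD(2)[OF fn[of y], of x] sobolevD(2)[OF fn[of y], of x'] xx by (simp add: D_def)
    then have 1: "cmod (fn y x' - fn y x) \<le> (LINT t|U. indicator {x<..x'} t * cmod (D y t))"
      using prim_increment_norm[OF Di xx] by simp
    have 2: "cmod (P x' - P x) \<le> (LINT t|U. indicator {x<..x'} t * cmod (h t))"
      unfolding P_def by (rule prim_increment_norm[OF h xx])
    have i: "integrable U (\<lambda>t. indicator {x<..x'} t * cmod (D y t))" "integrable U (\<lambda>t. indicator {x<..x'} t * cmod (h t))"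
      "integrable U (\<lambda>t. indicator {x<..x'} t * (a t * m t))"
      using integrable_indicator_U[OF integrable_norm[OF Di], of "{x<..x'}"] integrable_indicator_U[OF integrable_norm[OF h], of "{x<..x'}"]
        integrable_indicator_U[OF am, of "{x<..x'}"] by simp_all
    have "m x' - m x \<le> cmod (fn y x' - fn y x) + cmod (P x' - P x)"
      unfolding m_def using norm_triangle_ineq2[of "fn y x'" "fn y x"] norm_triangle_ineq2[of "P x'" "P x"] by linarith
    also have "\<dots> \<le> (LINT t|U. indicator {x<..x'} t * cmod (D y t) + indicator {x<..x'} t * cmod (h t))"
      using 1 2 i by simp
    also have "\<dots> \<le> (LINT t|U. indicator {x<..x'} t * (a t * m t))"
    proof (rule integral_mono_AE)
      show "AE t in U. indicator {x<..x'} t * cmod (D y t) + indicator {x<..x'} t * cmod (h t) \<le> indicator {x<..x'} t * (a t * m t)"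
        using bound by eventually_elim (auto split: split_indicator)
    qed (use i in auto)
    finally show "m x' - m x \<le> (LINT t|U. indicator {x<..x'} t * (a t * m t))" .
  qed
  have "fn y x = 0" if "x \<in> {0..1}" for x
    using m0[OF that] unfolding m_def by (smt (verit) norm_ge_zero norm_le_zero_iff)
  moreover have "fn y x = 0" if "x \<notin> {0..1}" for x by (rule sobolevD(4)[OF fn that])
  ultimately show ?thesis by (intro sob_eqI) auto
qed

lemma first_integral_comb:
  assumes w: "w \<in> L2" and y: "first_integral w l y c" and z: "first_integral w l z d"
  shows "first_integral w l (y - scaleC k z) (c - k * d)"
proof -
  have D: "AE x in U. D (y - scaleC k z) x = D y x - k * D z x"
    using D_diff[of y "scaleC k z"] D_scaleC[of k z] by eventually_elim simp
  have i: "integrable U (\<lambda>t. w t * D u t)" for u by (intro L2_mult_integrable w D_L2)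
  have p: "prim (\<lambda>t. w t * D (y - scaleC k z) t) x = prim (\<lambda>t. w t * D y t) x - k * prim (\<lambda>t. w t * D z t) x"
    if x: "x \<in> {0..1}" for x
  proof -
    have "prim (\<lambda>t. w t * D (y - scaleC k z) t) x = prim (\<lambda>t. w t * D y t - k * (w t * D z t)) x"
    proof (rule prim_cong_AE[OF _ i _ x])
      show "AE t in U. w t * D (y - scaleC k z) t = w t * D y t - k * (w t * D z t)"
        using D
      proof eventually_elim
        case (elim t)
        show ?case unfolding elim by (simp add: algebra_simps)
      qed
      show "integrable U (\<lambda>t. w t * D y t - k * (w t * D z t))" using i by simp
    qed
    also have "\<dots> = prim (\<lambda>t. w t * D y t) x - prim (\<lambda>t. k * (w t * D z t)) x"
      by (rule prim_diff[OF i _ x]) (use i in simp)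
    also have "prim (\<lambda>t. k * (w t * D z t)) x = k * prim (\<lambda>t. w t * D z t) x" by (rule prim_scale[OF x])
    finally show ?thesis .
  qed
  show ?thesis
    using D y z AE_space unfolding first_integral_def
  proof eventually_elim
    case (elim x)
    then have "x \<in> {0..1}" by simp
    show ?case unfolding elim(1) p[OF \<open>x \<in> {0..1}\<close>] elim(2) elim(3) by (simp add: algebra_simps)
  qed
qed

text \<open>The lemma of du Bois-Reymond.\<close>

lemma orthogonal_derivatives_const:
  assumes q: "q \<in> L2" and orth: "\<And>z. (LINT x|U. q x * cnj (D z x)) = 0"
  shows "AE x in U. q x = prim q 1"
proof -
  define c where "c = prim q 1"
  define g where "g x = q x - c" for x
  have g: "g \<in> L2" unfolding g_def[abs_def] by (intro L2_diff q L2_const)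
  have qi: "integrable U q" by (rule L2_integrable[OF q])
  have g1: "prim g 1 = 0"
    using qi by (simp add: g_def[abs_def] prim_1 measure_U c_def)
  define y where "y x = (if x \<in> {0..1} then prim g x else 0)" for x
  have y: "y \<in> sobolev" "AE x in U. wderiv y x = g x"
    by (rule sobolevI[OF g]; use g1 in \<open>auto simp: y_def\<close>)+
  have [measurable]: "q \<in> borel_measurable U" "g \<in> borel_measurable U" using q g by auto
  have cg: "(\<lambda>x. cnj (g x)) \<in> L2" by (rule L2_cnj[OF g])
  have "(LINT x|U. q x * cnj (g x)) = (LINT x|U. q x * cnj (D (mk y) x))"
  proof (rule integral_cong_AE)
    show "AE x in U. q x * cnj (g x) = q x * cnj (D (mk y) x)"
      using y(2) by eventually_elim (simp add: D_def y(1))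
  qed (auto intro!: borel_measurable_integrable L2_mult_integrable q L2_cnj g)
  then have "(LINT x|U. q x * cnj (g x)) = 0" by (simp add: orth)
  moreover have "(LINT x|U. c * cnj (g x)) = 0" using g1 by (simp add: prim_1)
  ultimately have "(LINT x|U. q x * cnj (g x) - c * cnj (g x)) = 0"
    using L2_mult_integrable[OF q cg] L2_integrable[OF cg] by simp
  also have "(LINT x|U. q x * cnj (g x) - c * cnj (g x)) = complex_of_real ((L2_norm g)\<^sup>2)"
    unfolding L2_norm_sq integral_complex_of_real[symmetric] complex_norm_square
    by (simp add: g_def algebra_simps)
  finally have "L2_norm g = 0" by simp
  from L2_norm_eq_0[OF g this] show ?thesis by (simp add: g_def c_def)
qed

context real_weight
begin

lemma eigenvector_first_integral:
  "\<exists>w\<in>L2. \<forall>y l. y = scaleC l (K y) \<longrightarrow> (\<exists>c. first_integral w l y c)"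
proof -
  obtain v where v: "\<And>u. \<rho> (fn u) = cinner v u" using rho_cinner by blast
  have "\<exists>c. first_integral (D v) l y c" if y: "y = scaleC l (K y)" for y l
  proof -
    define h where "h t = D v t * D y t" for t
    define P where "P = prim h"
    have h: "integrable U h" unfolding h_def[abs_def] by (intro L2_mult_integrable D_L2)
    have Pc: "continuous_on {0..1} P" unfolding P_def by (rule prim_continuous[OF h])
    have PL: "P \<in> L2" by (rule L2_continuous[OF Pc])
    have vy: "(\<lambda>x. D v x * fn y x) \<in> L2"
      using L2_bounded_mult[OF borel_measurable_U_continuous[OF sobolev_continuous[OF fn]] D_L2 fn_sup_le]
      by (simp add: mult.commute)
    define q where "q x = D y x - l * (D v x * fn y x - P x)" for x
    have q: "q \<in> L2" unfolding q_def[abs_def] by (intro L2_diff L2_scale D_L2 vy PL)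
    have "(LINT x|U. q x * cnj (D z x)) = 0" for z
    proof -
      have dz: "(\<lambda>x. cnj (D z x)) \<in> L2" by (intro L2_cnj D_L2)
      have zc: "continuous_on {0..1} (\<lambda>x. cnj (fn z x))" by (intro continuous_intros sobolev_continuous fn)
      have i: "integrable U (\<lambda>x. h x * cnj (fn z x))" "integrable U (\<lambda>x. P x * cnj (D z x))"
        "integrable U (\<lambda>x. D v x * fn y x * cnj (D z x))" "integrable U (\<lambda>x. D y x * cnj (D z x))"
        using integrable_continuous_mult[OF h zc] L2_mult_integrable[OF PL dz] L2_mult_integrable[OF vy dz]
        by (simp_all add: mult.commute)
      have fz: "cnj (fn z x) = prim (\<lambda>t. cnj (D z t)) x" if "x \<in> {0..1}" for x
        using sobolevD(2)[OF fn[of z] that] by (simp add: prim_cnj D_def)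
      have "prim h 1 * prim (\<lambda>t. cnj (D z t)) 1 = prim (\<lambda>t. h t * prim (\<lambda>t. cnj (D z t)) t + P t * cnj (D z t)) 1"
        unfolding P_def by (intro prim_mult h L2_integrable dz) simp
      also have "\<dots> = (LINT t|U. h t * cnj (fn z t) + P t * cnj (D z t))"
        unfolding prim_1 by (intro Bochner_Integration.integral_cong) (auto simp: fz)
      also have "prim (\<lambda>t. cnj (D z t)) 1 = 0" using fz[of 1] sobolevD(6)[OF fn] by simp
      finally have parts: "(LINT t|U. h t * cnj (fn z t)) = - (LINT t|U. P t * cnj (D z t))"
        using i by (simp add: eq_neg_iff_add_eq_0)
      have "cinner y z = l * cinner v (cmul y z)" using arg_cong[OF y, of "\<lambda>u. cinner u z"] by (simp only: cinner_scaleC_left cinner_K v)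
      also have "cinner v (cmul y z) = (LINT x|U. h x * cnj (fn z x) + D v x * fn y x * cnj (D z x))"
        unfolding cinner_def
      proof (rule integral_cong_AE)
        show "AE x in U. D v x * cnj (D (cmul y z) x) = h x * cnj (fn z x) + D v x * fn y x * cnj (D z x)"
          using D_cmul[of y z] by eventually_elim (simp add: h_def algebra_simps)
        show "(\<lambda>x. h x * cnj (fn z x) + D v x * fn y x * cnj (D z x)) \<in> borel_measurable U"
          using i by (intro borel_measurable_integrable) simp
      qed (auto intro!: borel_measurable_integrable)
      also have "\<dots> = (LINT x|U. D v x * fn y x * cnj (D z x)) - (LINT t|U. P t * cnj (D z t))"
        using i parts by simp
      finally have "cinner y z - l * ((LINT x|U. D v x * fn y x * cnj (D z x)) - (LINT t|U. P t * cnj (D z t))) = 0" by simp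
      also have "cinner y z - l * ((LINT x|U. D v x * fn y x * cnj (D z x)) - (LINT t|U. P t * cnj (D z t)))
          = (LINT x|U. D y x * cnj (D z x) - l * (D v x * fn y x * cnj (D z x) - P x * cnj (D z x)))"
        using i unfolding cinner_def by simp
      also have "\<dots> = (LINT x|U. q x * cnj (D z x))"
        by (intro Bochner_Integration.integral_cong) (auto simp: q_def algebra_simps)
      finally show ?thesis .
    qed
    from orthogonal_derivatives_const[OF q this] obtain c where "AE x in U. q x = c" by blast
    then have "first_integral (D v) l y c"
      unfolding first_integral_def by eventually_elim (simp add: q_def P_def h_def[abs_def] diff_eq_eq)
    then show ?thesis by blast
  qed
  then show ?thesis using D_L2 by blast
qed

text \<open>A suitable combination of two eigenvectors has a vanishing constant in the integrated
  equation and is therefore zero.\<close>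

lemma eigenspace_one_dimensional:
  assumes y: "y = scaleC l (K y)" and z: "z = scaleC l (K z)" "z \<noteq> 0"
  shows "\<exists>k. y = scaleC k z"
proof -
  obtain w where w: "w \<in> L2" "\<And>y. y = scaleC l (K y) \<Longrightarrow> \<exists>c. first_integral w l y c"
    using eigenvector_first_integral by blast
  obtain c d where cd: "first_integral w l y c" "first_integral w l z d" using w(2)[OF y] w(2)[OF z(1)] by blast
  have "d \<noteq> 0" using first_integral_zero[OF w(1)] cd(2) z(2) by blast
  then have "first_integral w l (y - scaleC (c / d) z) 0"
    using first_integral_comb[OF w(1) cd, of "c / d"] by simp
  then have "y = scaleC (c / d) z" using first_integral_zero[OF w(1)] by fastforce
  then show ?thesis by blast
qed

end

section \<open>Dimension counts, spectrum and index of inertia\<close>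

lemma edim_span_independent:
  assumes "finite B" "cfun.independent B"
  shows "edim (cfun.span B) = enat (card B)"
proof -
  have "\<exists>F. finite F \<and> F \<subseteq> cfun.span B \<and> cfun.span B \<subseteq> cfun.span F"
    using assms(1) cfun.span_superset by blast
  then show ?thesis unfolding edim_def using cfun.dim_span_eq_card_independent[OF assms(2)] by simp
qed

text \<open>Passing to the kernel of a linear functional lowers the dimension by at most one.\<close>

lemma edim_le_kernel:
  assumes M: "cfun.subspace M"
    and f: "\<And>y z. y \<in> M \<Longrightarrow> z \<in> M \<Longrightarrow> f (y + z) = f y + f z" "\<And>c y. y \<in> M \<Longrightarrow> f (\<lambda>x. c * y x) = (c * f y :: complex)"
  shows "edim M \<le> edim {y \<in> M. f y = 0} + 1"
proof (cases "\<exists>F. finite F \<and> F \<subseteq> {y \<in> M. f y = 0} \<and> {y \<in> M. f y = 0} \<subseteq> cfun.span F")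
  case False
  then have "edim {y \<in> M. f y = 0} = \<infinity>" unfolding edim_def by (subst if_not_P) auto
  then show ?thesis by simp
next
  case True
  let ?N = "{y \<in> M. f y = 0}"
  have e: "edim ?N = enat (cfun.dim ?N)" unfolding edim_def using True by simp
  obtain F where F: "finite F" "F \<subseteq> ?N" "?N \<subseteq> cfun.span F" using True by blast
  obtain B where B: "B \<subseteq> ?N" "cfun.independent B" "?N \<subseteq> cfun.span B" "card B = cfun.dim ?N"
    using cfun.basis_exists by blast
  have finB: "finite B"
    using cfun.independent_span_bound[OF F(1) B(2)] B(1) F(3) by blast
  have "\<exists>F. finite F \<and> F \<subseteq> M \<and> M \<subseteq> cfun.span F \<and> card F \<le> card B + 1"
  proof (cases "\<forall>y\<in>M. f y = 0")
    case True
    then show ?thesis using B finB by (intro exI[of _ B]) auto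
  next
    case False
    then obtain m where m: "m \<in> M" "f m \<noteq> 0" by blast
    have "M \<subseteq> cfun.span (insert m B)"
    proof
      fix y assume y: "y \<in> M"
      define k where "k = - (f y / f m)"
      have km: "(\<lambda>x. k * m x) \<in> M" using cfun.subspace_scale[OF M m(1)] .
      have "f (y + (\<lambda>x. k * m x)) = f y + k * f m" by (simp only: f(1)[OF y km] f(2)[OF m(1)])
      also have "\<dots> = 0" using m(2) by (simp add: k_def)
      finally have "y + (\<lambda>x. k * m x) \<in> ?N" using cfun.subspace_add[OF M y km] by blast
      then have s: "y + (\<lambda>x. k * m x) \<in> cfun.span B" using B(3) by blast
      have "y - (\<lambda>x. (- k) * m x) = y + (\<lambda>x. k * m x)" by (rule ext) simp
      with s show "y \<in> cfun.span (insert m B)" unfolding cfun.span_breakdown_eq by metis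
    qed
    then show ?thesis using B finB m by (intro exI[of _ "insert m B"]) (auto simp: card_insert_if)
  qed
  then obtain G where G: "finite G" "G \<subseteq> M" "M \<subseteq> cfun.span G" "card G \<le> card B + 1" by blast
  have "edim M = enat (cfun.dim M)" unfolding edim_def using G by auto
  moreover have "cfun.dim M \<le> cfun.dim ?N + 1" using cfun.dim_le_card[OF G(3,1)] G(4) B(4) by simp
  ultimately show ?thesis unfolding e by (simp add: one_enat_def)
qed

lemma edim_le_functionals:
  assumes "finite I" "cfun.subspace M"
    and "\<And>i y z. i \<in> I \<Longrightarrow> y \<in> M \<Longrightarrow> z \<in> M \<Longrightarrow> f i (y + z) = f i y + f i z"
    and "\<And>i c y. i \<in> I \<Longrightarrow> y \<in> M \<Longrightarrow> f i (\<lambda>x. c * y x) = (c * f i y :: complex)"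
    and "\<And>y. y \<in> M \<Longrightarrow> (\<And>i. i \<in> I \<Longrightarrow> f i y = 0) \<Longrightarrow> y = 0"
  shows "edim M \<le> enat (card I)"
  using assms
proof (induction I arbitrary: M rule: finite_induct)
  case empty
  have "y = 0" if "y \<in> M" for y by (rule empty.prems(4)[OF that]) simp
  then have M: "M = {0}" using cfun.subspace_0[OF empty.prems(1)] by blast
  have "edim (cfun.span {}) = enat (card ({} :: cfun set))" by (rule edim_span_independent) (use cfun.independent_empty in auto)
  then show ?case by (simp add: M)
next
  case (insert i I)
  let ?N = "{y \<in> M. f i y = 0}"
  have N: "cfun.subspace ?N"
    unfolding cfun.subspace_def
  proof (intro conjI ballI allI)
    have "f i (\<lambda>x. 0 * (0::cfun) x) = 0 * f i 0" by (intro insert.prems cfun.subspace_0) auto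
    then show "0 \<in> ?N" using cfun.subspace_0[OF insert.prems(1)] by (simp add: zero_fun_def)
    show "x + y \<in> ?N" if "x \<in> ?N" "y \<in> ?N" for x y
      using that insert.prems(2)[of i x y] cfun.subspace_add[OF insert.prems(1)] by (auto simp: plus_fun_def)
    show "(\<lambda>x. c * y x) \<in> ?N" if "y \<in> ?N" for c y
      using that insert.prems(3)[of i y c] cfun.subspace_scale[OF insert.prems(1)] by auto
  qed
  have "edim M \<le> edim ?N + 1"
    by (rule edim_le_kernel[OF insert.prems(1) insert.prems(2)[of i] insert.prems(3)[of i]]) auto
  also have "edim ?N \<le> enat (card I)"
  proof (rule insert.IH[OF N])
    show "y = 0" if "y \<in> ?N" "\<And>j. j \<in> I \<Longrightarrow> f j y = 0" for y
      by (rule insert.prems(4)) (use that in auto)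
  qed (use insert.prems in auto)
  then have "edim ?N + 1 \<le> enat (card I) + 1" by (rule add_right_mono)
  also have "\<dots> = enat (card (insert i I))" using insert.hyps by (simp add: one_enat_def)
  finally show ?case .
qed

lemma fn_eq_0: "fn u = 0 \<longleftrightarrow> u = 0"
  using fn_inject[of u 0] by (simp add: zero_fun_def)

lemma subspace_sobolev: "cfun.subspace sobolev"
  unfolding cfun.subspace_def
  using zero_in_sobolev sobolev_add(1) sobolev_scale(1) by (auto simp: zero_fun_def plus_fun_def)

context real_weight
begin

text \<open>Eigenvalues of the pencil, expressed through \<open>K\<close>.\<close>

definition eigen :: "complex \<Rightarrow> bool" where
  "eigen l \<longleftrightarrow> (\<exists>y. y \<noteq> 0 \<and> y = scaleC l (K y))"

lemma T_pencil_eq_0: "T_pencil \<rho> l (fn y) = 0 \<longleftrightarrow> y = scaleC l (K y)"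
proof -
  have z: "(0::functional) = functional_of 0" by (rule functional_eqI) (auto simp: functional_of_outside)
  show ?thesis unfolding T_pencil_fn z functional_of_inject by simp
qed

lemma kernel_eq: "kernel (T_pencil \<rho> l) = fn ` {y. y = scaleC l (K y)}"
proof (intro equalityI subsetI)
  fix y assume "y \<in> kernel (T_pencil \<rho> l)"
  then have y: "y \<in> sobolev" "T_pencil \<rho> l (fn (mk y)) = 0" by (auto simp: kernel_def)
  then have "mk y = scaleC l (K (mk y))" by (simp only: T_pencil_eq_0)
  with y(1) show "y \<in> fn ` {y. y = scaleC l (K y)}" by (metis (mono_tags, lifting) fn_mk image_eqI mem_Collect_eq)
qed (auto simp: kernel_def T_pencil_eq_0)

lemma K_0 [simp]: "K 0 = 0"
  using K_scaleC[of 0 0] by simp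

lemma eigenvalues_eq: "eigenvalues (T_pencil \<rho>) = {l. eigen l}"
proof -
  have "kernel (T_pencil \<rho> l) \<noteq> {0} \<longleftrightarrow> eigen l" for l
  proof -
    define P where "P y \<longleftrightarrow> y = scaleC l (K y)" for y
    have "P 0" by (simp add: P_def)
    have "inj fn" by (simp add: inj_def fn_inject)
    from inj_image_eq_iff[OF this, of "{y. P y}" "{0}"]
    have "kernel (T_pencil \<rho> l) = {0} \<longleftrightarrow> {y. P y} = {0}"
      unfolding kernel_eq P_def by (simp add: zero_fun_def)
    also have "\<dots> \<longleftrightarrow> (\<forall>y. P y \<longrightarrow> y = 0)" using \<open>P 0\<close> by auto
    also have "\<dots> \<longleftrightarrow> \<not> eigen l" unfolding eigen_def P_def by (simp add: imp_conv_disj disj_commute)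
    finally show ?thesis by simp
  qed
  then show ?thesis by (auto simp: eigenvalues_def)
qed

lemma cinner_K_real: "cinner (K y) y = complex_of_real (K y \<bullet> y)"
proof -
  have "cnj (cinner (K y) y) = cinner (K y) y" by (simp add: cinner_commute K_selfadjoint)
  then show ?thesis by (simp add: inner_sob_def complex_eq_iff)
qed

lemma K_sym: "K x \<bullet> y = x \<bullet> K y"
  by (simp add: inner_sob_def K_selfadjoint)

lemma eigen_quadratic:
  assumes "y = scaleC l (K y)"
  shows "complex_of_real ((norm y)\<^sup>2) = l * complex_of_real (K y \<bullet> y)"
  using arg_cong[OF assms, of "\<lambda>u. cinner u y"] by (simp add: cinner_norm cinner_scaleC_left cinner_K_real)

lemma eigen_real:
  assumes "eigen l" shows "l = complex_of_real (Re l)" "Re l \<noteq> 0"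
proof -
  obtain y where y: "y \<noteq> 0" "y = scaleC l (K y)" using assms eigen_def by blast
  define r where "r = K y \<bullet> y"
  have e: "complex_of_real ((norm y)\<^sup>2) = l * complex_of_real r" using eigen_quadratic[OF y(2)] by (simp add: r_def)
  have "r \<noteq> 0" using e y(1) by auto
  then have l: "l = complex_of_real ((norm y)\<^sup>2 / r)" using e by (simp add: field_simps)
  show "l = complex_of_real (Re l)" by (subst (2) l) (simp add: l)
  show "Re l \<noteq> 0" using y(1) \<open>r \<noteq> 0\<close> by (simp add: l)
qed

lemma eigen_form:
  assumes "eigen l" "y = scaleC l (K y)"
  shows "weight \<rho> (fn y) (fn y) = complex_of_real ((norm y)\<^sup>2 / Re l)"
proof -
  have "(norm y)\<^sup>2 = Re l * (K y \<bullet> y)"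
    using eigen_quadratic[OF assms(2)] eigen_real(1)[OF assms(1)] by (metis of_real_eq_iff of_real_mult)
  then have "K y \<bullet> y = (norm y)\<^sup>2 / Re l" using eigen_real(2)[OF assms(1)] by (simp add: field_simps)
  then show ?thesis unfolding weight_fn cinner_K[symmetric] cinner_K_real by simp
qed

lemma root_space_eq:
  assumes l: "eigen l"
  shows "root_space dirichlet (weight \<rho>) l = kernel (T_pencil \<rho> l)"
proof (intro equalityI subsetI)
  fix y assume "y \<in> kernel (T_pencil \<rho> l)"
  then have "y \<in> sobolev" "T_pencil \<rho> l y = 0" by (auto simp: kernel_def)
  then show "y \<in> root_space dirichlet (weight \<rho>) l"
    unfolding root_space_def by (intro CollectI exI[of _ "0::nat"] exI[of _ "\<lambda>_. y"]) simp
next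
  have W: "weight \<rho> (fn u) = functional_of (K u)" for u
  proof (rule functional_eqI)
    show "weight \<rho> (fn u) (fn z) = functional_of (K u) (fn z)" for z unfolding weight_fn functional_of_fn cinner_K ..
  qed (simp add: weight_def functional_of_outside)
  have l0: "cnj l = l" using eigen_real(1)[OF l] by (metis complex_cnj_complex_of_real)
  \<comment> \<open>An associated vector would make the weight form vanish on the eigenvector.\<close>
  have no_assoc: "u = 0" if u: "u = scaleC l (K u)" and v: "v - scaleC l (K v) = K u" for u v
  proof -
    have "cinner (K u) u = cinner v u - l * cinner (K v) u" unfolding v[symmetric] by (simp add: cinner_diff cinner_scaleC_left)
    also have "cinner (K v) u = cinner v (K u)" by (rule K_selfadjoint)
    also have "l * \<dots> = cinner v (scaleC l (K u))" by (simp add: cinner_scaleC_right l0)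
    also have "scaleC l (K u) = u" using u by simp
    finally have "K u \<bullet> u = 0" by (simp add: cinner_K_real)
    then show ?thesis using eigen_quadratic[OF u] by simp
  qed
  fix y assume "y \<in> root_space dirichlet (weight \<rho>) l"
  then obtain k c where c: "\<And>j. j \<le> k \<Longrightarrow> c j \<in> sobolev" "T_pencil \<rho> l (c 0) = 0"
    "\<And>j. j < k \<Longrightarrow> T_pencil \<rho> l (c (Suc j)) = weight \<rho> (c j)" "y = c k" unfolding root_space_def by blast
  define d where "d j = mk (c j)" for j
  have d: "fn (d j) = c j" if "j \<le> k" for j using c(1)[OF that] by (simp add: d_def)
  have d0: "d 0 = scaleC l (K (d 0))" using c(2) T_pencil_eq_0[of l "d 0"] d[of 0] by simp
  have dS: "d (Suc j) - scaleC l (K (d (Suc j))) = K (d j)" if "j < k" for j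
    using c(3)[OF that] d[of j] d[of "Suc j"] that T_pencil_fn[of l "d (Suc j)"] W[of "d j"] functional_of_inject by simp
  have "d j = scaleC l (K (d j))" if "j \<le> k" for j
    using that
  proof (induction j)
    case 0 then show ?case using d0 by simp
  next
    case (Suc j)
    then have "d j = 0" using no_assoc[OF _ dS[of j]] by simp
    then show ?case using dS[of j] Suc by simp
  qed
  then have "fn (d k) \<in> kernel (T_pencil \<rho> l)" unfolding kernel_eq by blast
  then show "y \<in> kernel (T_pencil \<rho> l)" using c(4) d[of k] by simp
qed

lemma alg_mult_eigen:
  assumes l: "eigen l" shows "alg_mult dirichlet (weight \<rho>) l = 1"
proof -
  obtain y where y: "y \<noteq> 0" "y = scaleC l (K y)" using l eigen_def by blast
  have "kernel (T_pencil \<rho> l) = cfun.span {fn y}"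
    unfolding kernel_eq cfun.span_singleton
  proof (intro equalityI subsetI)
    fix z assume "z \<in> fn ` {y. y = scaleC l (K y)}"
    then obtain u where u: "z = fn u" "u = scaleC l (K u)" by blast
    then obtain k where "u = scaleC k y" using eigenspace_one_dimensional[OF u(2) y(2,1)] by blast
    then show "z \<in> range (\<lambda>k x. k * fn y x)" using u by auto
  next
    fix z assume "z \<in> range (\<lambda>k x. k * fn y x)"
    then obtain k where "z = fn (scaleC k y)" by auto
    moreover have "scaleC k y = scaleC l (K (scaleC k y))" using y(2) by (simp only: K_scaleC scaleC_scaleC mult.commute) (metis scaleC_scaleC)
    ultimately show "z \<in> fn ` {y. y = scaleC l (K y)}" by blast
  qed
  moreover have "fn y \<noteq> 0" using y(1) fn_inject[of y 0] by (auto simp: zero_fun_def)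
  then have "cfun.independent {fn y}" by simp
  ultimately show ?thesis
    unfolding alg_mult_def root_space_eq[OF l] using edim_span_independent[of "{fn y}"] by (simp add: one_enat_def)
qed

lemma compact_op_lK: "compact_op (\<lambda>y. scaleC l (K y))"
  unfolding compact_op_def
proof (intro allI impI)
  fix s :: "nat \<Rightarrow> sob" assume "bounded (range s)"
  then obtain r x where "strict_mono r" "(\<lambda>n. K (s (r n))) \<longlonglongrightarrow> x"
    using K_compact unfolding compact_op_def convergent_def by blast
  then show "\<exists>r. strict_mono r \<and> convergent (\<lambda>n. scaleC l (K (s (r n))))"
    unfolding convergent_def using bounded_linear.tendsto[OF bounded_linear_scaleC] by blast
qed

lemma bounded_linear_lK: "bounded_linear (\<lambda>y. scaleC l (K y))"
  by (rule bounded_linear_compose[OF bounded_linear_scaleC K_bounded_linear])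

lemma boundedly_invertible_if_not_eigen:
  assumes l: "\<not> eigen l" shows "boundedly_invertible (T_pencil \<rho> l)"
proof -
  define S where "S y = y - scaleC l (K y)" for y
  have Sl: "bounded_linear S" unfolding S_def[abs_def]
    by (intro bounded_linear_sub bounded_linear_ident bounded_linear_lK)
  have "\<And>v. scaleC l (K v) = v \<Longrightarrow> v = 0" using l unfolding eigen_def by metis
  from compact_op_bounded_below[OF bounded_linear_lK compact_op_lK this]
  obtain c where c: "c > 0" "\<And>x. c * norm x \<le> norm (S x)" unfolding S_def by blast
  have "bij S"
  proof (rule bounded_below_dense_range_bij[OF Sl c])
    fix v assume v: "\<And>x. S x \<bullet> v = 0"
    have "cinner x (v - scaleC (cnj l) (K v)) = 0" for x
    proof -
      have "S (scaleC (- \<i>) x) = scaleC (- \<i>) (S x)" 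
        unfolding S_def K_scaleC scaleC_diff scaleC_scaleC by (simp add: mult.commute)
      then have "Re (- \<i> * cinner (S x) v) = 0" using v[of "scaleC (- \<i>) x"] by (simp only: inner_sob_def cinner_scaleC_left)
      then have "cinner (S x) v = 0" using v[of x] by (simp add: inner_sob_def complex_eq_iff)
      then show ?thesis by (simp add: S_def cinner_diff cinner_scaleC_left cinner_scaleC_right K_selfadjoint)
    qed
    then have "v - scaleC (cnj l) (K v) = 0" using cinner_eq_0_iff by blast
    then have e: "v = scaleC (cnj l) (K v)" by simp
    show "v = 0"
    proof (rule ccontr)
      assume "v \<noteq> 0"
      then have ev: "eigen (cnj l)" using e eigen_def by blast
      from eigen_real(1)[OF ev] have "l = cnj l" by (simp add: complex_eq_iff)
      with ev l show False by simp
    qed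
  qed
  have T: "T_pencil \<rho> l (fn y) = functional_of (S y)" for y by (simp add: T_pencil_fn S_def)
  have bij: "bij_betw (T_pencil \<rho> l) sobolev sobolev_dual"
    unfolding bij_betw_def
  proof
    show "inj_on (T_pencil \<rho> l) sobolev"
    proof (rule inj_onI)
      fix x y assume xy: "x \<in> sobolev" "y \<in> sobolev" "T_pencil \<rho> l x = T_pencil \<rho> l y"
      then have "functional_of (S (mk x)) = functional_of (S (mk y))" using T[of "mk x"] T[of "mk y"] by simp
      then have "mk x = mk y" using \<open>bij S\<close> by (simp add: functional_of_inject bij_is_inj inj_eq)
      then show "x = y" using xy by (metis fn_mk)
    qed
    have sob: "sobolev = range fn" using fn_mk fn by (metis UNIV_I image_iff subsetI subset_antisym)
    have "T_pencil \<rho> l ` range fn = functional_of ` range S" unfolding image_image T ..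
    then show "T_pencil \<rho> l ` sobolev = sobolev_dual"
      unfolding sob sobolev_dual_eq bij_is_surj[OF \<open>bij S\<close>] .
  qed
  show ?thesis
    unfolding boundedly_invertible_def
  proof (intro conjI bij exI[of _ "1 / c"] ballI)
    fix \<phi> assume "\<phi> \<in> sobolev_dual"
    then obtain y where y: "y \<in> sobolev" "\<phi> = T_pencil \<rho> l y" using bij by (metis bij_betw_imp_surj_on imageE)
    have inv: "inv_into sobolev (T_pencil \<rho> l) \<phi> = y"
      using y bij by (simp add: bij_betw_def inv_into_f_f)
    have "dual_norm \<phi> = norm (S (mk y))" using T[of "mk y"] y by (simp add: dual_norm_functional_of)
    moreover have "sob_norm y = norm (mk y)" using y by (simp add: norm_sob(2))
    ultimately show "sob_norm (inv_into sobolev (T_pencil \<rho> l) \<phi>) \<le> 1 / c * dual_norm \<phi>"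
      unfolding inv using c(2)[of "mk y"] c(1) by (simp add: field_simps)
  qed
qed

text \<open>A choice of a normalised eigenvector; arbitrary if \<open>\<mu>\<close> is not an eigenvalue.\<close>

definition unit_eigenvector :: "real \<Rightarrow> sob" where
  "unit_eigenvector \<mu> = (SOME y. norm y = 1 \<and> y = scaleC (complex_of_real \<mu>) (K y))"

lemma unit_eigenvector:
  assumes "eigen (complex_of_real \<mu>)"
  shows "norm (unit_eigenvector \<mu>) = 1"
    "unit_eigenvector \<mu> = scaleC (complex_of_real \<mu>) (K (unit_eigenvector \<mu>))"
    "K (unit_eigenvector \<mu>) = scaleC (complex_of_real (1 / \<mu>)) (unit_eigenvector \<mu>)" "\<mu> \<noteq> 0"
proof -
  obtain y where y: "y \<noteq> 0" "y = scaleC (complex_of_real \<mu>) (K y)" using assms eigen_def by blast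
  have "scaleC (complex_of_real \<mu>) (K (sgn y)) = scaleC (complex_of_real (inverse (norm y))) (scaleC (complex_of_real \<mu>) (K y))"
    by (simp only: sgn_div_norm scaleR_scaleC K_scaleC scaleC_scaleC mult.commute)
  also have "\<dots> = sgn y" unfolding y(2)[symmetric] sgn_div_norm scaleR_scaleC ..
  finally have "sgn y = scaleC (complex_of_real \<mu>) (K (sgn y))" ..
  then have "norm (sgn y) = 1 \<and> sgn y = scaleC (complex_of_real \<mu>) (K (sgn y))" using y(1) by (simp add: norm_sgn)
  from someI[of "\<lambda>y. norm y = 1 \<and> y = scaleC (complex_of_real \<mu>) (K y)", OF this]
  show 1: "norm (unit_eigenvector \<mu>) = 1"
    "unit_eigenvector \<mu> = scaleC (complex_of_real \<mu>) (K (unit_eigenvector \<mu>))" unfolding unit_eigenvector_def by auto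
  show m: "\<mu> \<noteq> 0" using eigen_real(2)[OF assms] by simp
  have "scaleC (complex_of_real (1 / \<mu>)) (unit_eigenvector \<mu>)
      = scaleC (complex_of_real (1 / \<mu>)) (scaleC (complex_of_real \<mu>) (K (unit_eigenvector \<mu>)))" using 1(2) by simp
  also have "\<dots> = K (unit_eigenvector \<mu>)" unfolding scaleC_scaleC using m by simp
  finally show "K (unit_eigenvector \<mu>) = scaleC (complex_of_real (1 / \<mu>)) (unit_eigenvector \<mu>)" ..
qed

lemma unit_eigenvector_orthogonal:
  assumes "eigen (complex_of_real \<mu>)" "eigen (complex_of_real \<nu>)" "\<mu> \<noteq> \<nu>"
  shows "cinner (unit_eigenvector \<mu>) (unit_eigenvector \<nu>) = 0"
proof -
  let ?x = "cinner (unit_eigenvector \<mu>) (unit_eigenvector \<nu>)"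
  have "complex_of_real (1/\<mu>) * ?x = complex_of_real (1/\<nu>) * ?x"
    using K_selfadjoint[of "unit_eigenvector \<mu>" "unit_eigenvector \<nu>"]
    unfolding unit_eigenvector(3)[OF assms(1)] unit_eigenvector(3)[OF assms(2)] by (simp add: cinner_scaleC_left cinner_scaleC_right)
  moreover have "complex_of_real (1/\<mu>) \<noteq> complex_of_real (1/\<nu>)"
    using assms(3) unit_eigenvector(4)[OF assms(1)] unit_eigenvector(4)[OF assms(2)] unfolding of_real_eq_iff by simp
  ultimately show ?thesis by (metis mult_right_cancel)
qed

lemma finite_eigenvalues: "finite {\<mu>. \<bar>\<mu>\<bar> \<le> R \<and> eigen (complex_of_real \<mu>)}"
proof (cases "R > 0")
  case True
  show ?thesis
  proof (rule compact_op_orthonormal_finite[OF K_compact, of "1 / R" _ unit_eigenvector "\<lambda>\<mu>. 1 / \<mu>"])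
    fix \<mu> \<nu> assume m: "\<mu> \<in> {\<mu>. \<bar>\<mu>\<bar> \<le> R \<and> eigen (complex_of_real \<mu>)}" and n: "\<nu> \<in> {\<mu>. \<bar>\<mu>\<bar> \<le> R \<and> eigen (complex_of_real \<mu>)}" "\<mu> \<noteq> \<nu>"
    then show "unit_eigenvector \<mu> \<bullet> unit_eigenvector \<nu> = 0" by (simp add: inner_sob_def unit_eigenvector_orthogonal)
  next
    fix \<mu> assume m: "\<mu> \<in> {\<mu>. \<bar>\<mu>\<bar> \<le> R \<and> eigen (complex_of_real \<mu>)}"
    then show "norm (unit_eigenvector \<mu>) = 1" "K (unit_eigenvector \<mu>) = (1 / \<mu>) *\<^sub>R unit_eigenvector \<mu>"
      using unit_eigenvector[of \<mu>] by (simp_all add: scaleR_scaleC)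
    show "1 / R \<le> \<bar>1 / \<mu>\<bar>" using m unit_eigenvector(4)[of \<mu>] by (auto simp: abs_divide intro!: divide_left_mono)
  qed (use True in simp)
next
  case False
  then have "{\<mu>. \<bar>\<mu>\<bar> \<le> R \<and> eigen (complex_of_real \<mu>)} \<subseteq> {0}" by auto
  then show ?thesis by (rule finite_subset) simp
qed

text \<open>The quadratic form of \<open>1 - l K\<close>, that is, of the pencil at the real point \<open>l\<close>.\<close>

definition quad_form :: "real \<Rightarrow> sob \<Rightarrow> real" where "quad_form l u = (norm u)\<^sup>2 - l * (K u \<bullet> u)"

lemma T_pencil_form: "T_pencil \<rho> (complex_of_real l) (fn u) (fn u) = complex_of_real (quad_form l u)"
  unfolding T_pencil_fn functional_of_fn by (simp add: cinner_diff cinner_scaleC_left cinner_K_real cinner_norm quad_form_def)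

text \<open>The eigenvalues strictly between \<open>0\<close> and \<open>l\<close>, for either sign of \<open>l\<close>.\<close>

definition eigset :: "real \<Rightarrow> real set" where
  "eigset l = {\<mu>. 0 < \<mu> / l \<and> \<mu> / l < 1 \<and> eigen (complex_of_real \<mu>)}"

lemma eigset_finite: "finite (eigset l)"
proof (rule finite_subset[OF _ finite_eigenvalues[of "\<bar>l\<bar>"]])
  show "eigset l \<subseteq> {\<mu>. \<bar>\<mu>\<bar> \<le> \<bar>l\<bar> \<and> eigen (complex_of_real \<mu>)}"
    unfolding eigset_def by (auto simp: zero_less_divide_iff divide_less_eq_1)
qed

text \<open>On an eigenvector for \<open>\<mu>\<close> the form equals \<open>(1 - l / \<mu>)\<close> times the squared norm. The
  eigenvectors for distinct eigenvalues are orthogonal both for the inner product and for the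
  form, so these values add up on their span. Independence is proved in the same induction over
  the set of eigenvalues, since each step needs the new eigenvector to be orthogonal to the span
  of the others.\<close>

lemma negative_span:
  assumes "finite F" "\<And>\<mu>. \<mu> \<in> F \<Longrightarrow> eigen (complex_of_real \<mu>)" "\<And>\<mu>. \<mu> \<in> F \<Longrightarrow> 1 - l / \<mu> \<le> - \<epsilon>"
  shows "cfun.independent ((fn \<circ> unit_eigenvector) ` F) \<and> card ((fn \<circ> unit_eigenvector) ` F) = card F \<and>
    (\<forall>u. fn u \<in> cfun.span ((fn \<circ> unit_eigenvector) ` F) \<longrightarrow>
       quad_form l u \<le> - \<epsilon> * (norm u)\<^sup>2 \<and> (\<forall>\<nu>. \<nu> \<notin> F \<longrightarrow> eigen (complex_of_real \<nu>) \<longrightarrow> cinner u (unit_eigenvector \<nu>) = 0))"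
  using assms
proof (induction F rule: finite_induct)
  case empty
  show ?case using cfun.independent_empty by (auto simp: quad_form_def fn_eq_0)
next
  case (insert \<mu> F)
  let ?B = "(fn \<circ> unit_eigenvector) ` F"
  define e where "e = unit_eigenvector \<mu>"
  have \<mu>: "eigen (complex_of_real \<mu>)" using insert by simp
  note e = unit_eigenvector[OF \<mu>, folded e_def]
  have IH: "cfun.independent ?B" "card ?B = card F"
    "\<And>u. fn u \<in> cfun.span ?B \<Longrightarrow> quad_form l u \<le> - \<epsilon> * (norm u)\<^sup>2"
    "\<And>u \<nu>. fn u \<in> cfun.span ?B \<Longrightarrow> \<nu> \<notin> F \<Longrightarrow> eigen (complex_of_real \<nu>) \<Longrightarrow> cinner u (unit_eigenvector \<nu>) = 0"
    using insert by auto
  have cee: "cinner e e = 1" using e(1) by (simp add: cinner_norm)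
  have nin: "fn e \<notin> cfun.span ?B"
    using IH(4)[of e \<mu>] insert.hyps(2) \<mu> cee by (auto simp: e_def)
  have ins: "(fn \<circ> unit_eigenvector) ` insert \<mu> F = insert (fn e) ?B" by (simp add: e_def)
  have "cfun.independent (insert (fn e) ?B)" by (rule cfun.independent_insertI[OF nin IH(1)])
  moreover have "card (insert (fn e) ?B) = card (insert \<mu> F)"
    using insert.hyps IH(2) nin cfun.span_base[of "fn e" ?B] by (subst card_insert_disjoint) auto
  moreover have "quad_form l u \<le> - \<epsilon> * (norm u)\<^sup>2 \<and> (\<forall>\<nu>. \<nu> \<notin> insert \<mu> F \<longrightarrow> eigen (complex_of_real \<nu>) \<longrightarrow> cinner u (unit_eigenvector \<nu>) = 0)"
    if u: "fn u \<in> cfun.span (insert (fn e) ?B)" for u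
  proof -
    obtain k where k: "fn u - (\<lambda>x. k * fn e x) \<in> cfun.span ?B" using u unfolding cfun.span_breakdown_eq by blast
    define v where "v = u - scaleC k e"
    have v: "fn v \<in> cfun.span ?B" using k by (simp add: v_def fun_diff_def)
    have u: "u = v + scaleC k e" by (simp add: v_def)
    have ve: "cinner v e = 0" unfolding e_def by (rule IH(4)[OF v insert.hyps(2) \<mu>])
    have Kve: "cinner (K v) e = 0" unfolding K_selfadjoint e(3) cinner_scaleC_right ve by simp
    have "v \<bullet> scaleC k e = 0" "scaleC k e \<bullet> v = 0"
      using ve cinner_commute[of v e] by (simp_all add: inner_sob_def cinner_scaleC_right cinner_scaleC_left)
    moreover have "(norm (v + scaleC k e))\<^sup>2 = (norm v)\<^sup>2 + v \<bullet> scaleC k e + scaleC k e \<bullet> v + (norm (scaleC k e))\<^sup>2"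
      by (simp add: power2_norm_eq_inner inner_add_left inner_add_right)
    ultimately have n: "(norm u)\<^sup>2 = (norm v)\<^sup>2 + (cmod k)\<^sup>2" unfolding u by (simp add: norm_scaleC e(1))
    have "K v \<bullet> scaleC k e = 0" "K (scaleC k e) \<bullet> v = 0"
      using Kve cinner_commute[of e v] ve by (simp_all add: inner_sob_def cinner_scaleC_right cinner_scaleC_left K_scaleC e(3))
    moreover have "K (scaleC k e) \<bullet> scaleC k e = (cmod k)\<^sup>2 / \<mu>"
    proof -
      have "cinner (K (scaleC k e)) (scaleC k e) = complex_of_real ((cmod k)\<^sup>2 / \<mu>)"
        unfolding K_scaleC e(3) cinner_scaleC_left cinner_scaleC_right cee
        using complex_norm_square[of k] by (simp add: mult.commute)
      then show ?thesis by (simp add: inner_sob_def)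
    qed
    ultimately have "K u \<bullet> u = K v \<bullet> v + (cmod k)\<^sup>2 / \<mu>"
      unfolding u by (simp add: K_add inner_add_left inner_add_right)
    then have "quad_form l u = quad_form l v + (cmod k)\<^sup>2 * (1 - l / \<mu>)" by (simp add: quad_form_def n algebra_simps)
    also have "\<dots> \<le> - \<epsilon> * (norm v)\<^sup>2 + (cmod k)\<^sup>2 * (- \<epsilon>)"
      using insert.prems by (intro add_mono mult_left_mono IH(3) v) auto
    also have "\<dots> = - \<epsilon> * (norm u)\<^sup>2" by (simp add: n algebra_simps)
    finally have "quad_form l u \<le> - \<epsilon> * (norm u)\<^sup>2" .
    moreover have "cinner u (unit_eigenvector \<nu>) = 0" if "\<nu> \<notin> insert \<mu> F" "eigen (complex_of_real \<nu>)" for \<nu>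
      unfolding u cinner_add_left cinner_scaleC_left
      using IH(4)[OF v, of \<nu>] unit_eigenvector_orthogonal[OF \<mu> that(2)] that by (simp add: e_def)
    ultimately show ?thesis by blast
  qed
  ultimately show ?case unfolding ins by blast
qed

text \<open>Otherwise the variational principle on the orthogonal complement would produce an
  eigenvector there whose eigenvalue \<open>l / \<kappa>\<close> lies between \<open>0\<close> and \<open>l\<close>, hence a multiple of one
  of the excluded eigenvectors.\<close>

lemma nonnegative_complement:
  assumes l: "l \<noteq> 0" and y: "\<And>\<mu>. \<mu> \<in> eigset l \<Longrightarrow> cinner y (unit_eigenvector \<mu>) = 0"
  shows "quad_form l y \<ge> 0"
proof (rule ccontr)
  assume neg: "\<not> ?thesis"
  define A where "A u = scaleC (complex_of_real l) (K u)" for u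
  define W where "W = {w. \<forall>\<mu>\<in>eigset l. cinner w (unit_eigenvector \<mu>) = 0}"
  have "\<exists>\<kappa>>1. \<exists>v\<in>W. v \<noteq> 0 \<and> A v = \<kappa> *\<^sub>R v"
  proof (rule compact_selfadjoint_eigenvector)
    show "bounded_linear A" unfolding A_def[abs_def] by (rule bounded_linear_lK)
    show "compact_op A" unfolding A_def[abs_def] by (rule compact_op_lK)
    show "A x \<bullet> y = x \<bullet> A y" for x y unfolding A_def scaleR_scaleC[symmetric] by (simp add: K_sym)
    show "subspace W" unfolding subspace_def W_def by (auto simp: cinner_add_left cinner_scaleC_left scaleR_scaleC)
    have "closed {w. cinner w e = 0}" for e
    proof -
      have "{w. cinner w e = 0} = {w. w \<bullet> e = 0} \<inter> {w. w \<bullet> scaleC \<i> e = 0}" by (auto simp: cinner_inner complex_eq_iff)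
      then show ?thesis by (auto intro!: closed_Int closed_Collect_eq continuous_intros)
    qed
    then have "closed (\<Inter>\<mu>\<in>eigset l. {w. cinner w (unit_eigenvector \<mu>) = 0})" by auto
    also have "(\<Inter>\<mu>\<in>eigset l. {w. cinner w (unit_eigenvector \<mu>) = 0}) = W" by (auto simp: W_def)
    finally show "closed W" .
    show "A w \<in> W" if "w \<in> W" for w
    proof -
      have "cinner (A w) (unit_eigenvector \<mu>) = 0" if m: "\<mu> \<in> eigset l" for \<mu>
      proof -
        have "eigen (complex_of_real \<mu>)" using m by (simp add: eigset_def)
        then show ?thesis using \<open>w \<in> W\<close> m
          unfolding A_def cinner_scaleC_left K_selfadjoint by (simp add: unit_eigenvector(3) cinner_scaleC_right W_def)
      qed
      then show ?thesis by (simp add: W_def)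
    qed
    show "y \<in> W" using y by (simp add: W_def)
    show "y \<bullet> y < A y \<bullet> y" using neg unfolding A_def scaleR_scaleC[symmetric] by (simp add: quad_form_def power2_norm_eq_inner)
  qed
  then obtain \<kappa> v where v: "\<kappa> > 1" "v \<in> W" "v \<noteq> 0" "A v = \<kappa> *\<^sub>R v" by blast
  define \<mu> where "\<mu> = l / \<kappa>"
  have "scaleC (complex_of_real \<mu>) (K v) = scaleC (complex_of_real (1 / \<kappa>)) (A v)"
    unfolding A_def scaleC_scaleC by (simp add: \<mu>_def)
  also have "\<dots> = v" unfolding v(4) scaleR_scaleC scaleC_scaleC using v(1) by simp
  finally have e: "v = scaleC (complex_of_real \<mu>) (K v)" ..
  then have eig: "eigen (complex_of_real \<mu>)" using v(3) eigen_def by blast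
  moreover have "\<mu> / l = 1 / \<kappa>" using l by (simp add: \<mu>_def)
  ultimately have m: "\<mu> \<in> eigset l" using v(1) by (simp add: eigset_def)
  have "unit_eigenvector \<mu> \<noteq> 0" using unit_eigenvector(1)[OF eig] by auto
  then obtain k where k: "v = scaleC k (unit_eigenvector \<mu>)"
    using eigenspace_one_dimensional[OF e unit_eigenvector(2)[OF eig]] by blast
  have "cinner v (unit_eigenvector \<mu>) = 0" using v(2) m by (simp add: W_def)
  then have "k = 0" unfolding k cinner_scaleC_left using unit_eigenvector(1)[OF eig] by (simp add: cinner_norm)
  with k v(3) show False by simp
qed

text \<open>The span of the eigenvectors is a negative subspace of the right dimension, and a
  negative subspace on which all the functionals \<open>y \<mapsto> cinner y (unit_eigenvector \<mu>)\<close> vanish is zero.\<close>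

lemma ind_eq:
  assumes l: "l \<noteq> 0"
  shows "ind (T_pencil \<rho> (complex_of_real l)) = enat (card (eigset l))"
proof (rule antisym)
  show "ind (T_pencil \<rho> (complex_of_real l)) \<le> enat (card (eigset l))"
    unfolding ind_def
  proof (rule SUP_least)
    fix M assume "M \<in> {M. cfun.subspace M \<and> M \<subseteq> sobolev \<and>
       (\<exists>\<epsilon>>0. \<forall>y\<in>M. T_pencil \<rho> (complex_of_real l) y y \<le> complex_of_real (- \<epsilon> * (sob_norm y)\<^sup>2))}"
    then obtain \<epsilon> where M: "cfun.subspace M" "M \<subseteq> sobolev" and \<epsilon>: "\<epsilon> > 0"
      "\<And>y. y \<in> M \<Longrightarrow> T_pencil \<rho> (complex_of_real l) y y \<le> complex_of_real (- \<epsilon> * (sob_norm y)\<^sup>2)" by blast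
    show "edim M \<le> enat (card (eigset l))"
    proof (rule edim_le_functionals[OF eigset_finite M(1), where f = "\<lambda>\<mu> y. cinner (mk y) (unit_eigenvector \<mu>)"])
      fix y z assume "y \<in> M" "z \<in> M"
      then have s: "y \<in> sobolev" "z \<in> sobolev" using M(2) by auto
      have "mk (y + z) = mk y + mk z" using s by (simp add: plus_sob_def plus_fun_def)
      then show "cinner (mk (y + z)) (unit_eigenvector \<mu>) = cinner (mk y) (unit_eigenvector \<mu>) + cinner (mk z) (unit_eigenvector \<mu>)" for \<mu>
        by (simp only: cinner_add_left)
    next
      fix y c assume "y \<in> M"
      then have s: "y \<in> sobolev" using M(2) by auto
      have "mk (\<lambda>x. c * y x) = scaleC c (mk y)" using s by (simp add: scaleC_def)
      then show "cinner (mk (\<lambda>x. c * y x)) (unit_eigenvector \<mu>) = c * cinner (mk y) (unit_eigenvector \<mu>)" for \<mu>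
        by (simp only: cinner_scaleC_left)
    next
      fix y assume y: "y \<in> M" and o: "\<And>\<mu>. \<mu> \<in> eigset l \<Longrightarrow> cinner (mk y) (unit_eigenvector \<mu>) = 0"
      have s: "fn (mk y) = y" using y M(2) by (intro fn_mk) auto
      have "complex_of_real (quad_form l (mk y)) \<le> complex_of_real (- \<epsilon> * (norm (mk y))\<^sup>2)"
        using \<epsilon>(2)[OF y] T_pencil_form[of l "mk y"] unfolding s norm_sob(2) by simp
      then have "quad_form l (mk y) \<le> - \<epsilon> * (norm (mk y))\<^sup>2" by (simp add: less_eq_complex_def)
      with nonnegative_complement[OF l o] have "\<epsilon> * (norm (mk y))\<^sup>2 \<le> 0" by simp
      then have "mk y = 0" using \<epsilon>(1) by (simp add: mult_le_0_iff)
      then show "y = 0" using fn_eq_0[of "mk y"] unfolding s by blast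
    qed
  qed
next
  let ?B = "(fn \<circ> unit_eigenvector) ` eigset l"
  let ?M = "cfun.span ?B"
  \<comment> \<open>The element \<open>1\<close> keeps the minimum defined when there are no eigenvalues.\<close>
  define \<epsilon> where "\<epsilon> = Min (insert 1 ((\<lambda>\<mu>. l / \<mu> - 1) ` eigset l))"
  have fin: "finite (insert 1 ((\<lambda>\<mu>. l / \<mu> - 1) ` eigset l))" using eigset_finite by simp
  have pos: "l / \<mu> - 1 > 0" if "\<mu> \<in> eigset l" for \<mu>
  proof -
    have "0 < \<mu> / l" "\<mu> / l < 1" using that by (auto simp: eigset_def)
    then have "1 < inverse (\<mu> / l)" by (rule one_less_inverse)
    then show ?thesis by (simp add: inverse_divide)
  qed
  have \<epsilon>0: "\<epsilon> > 0" unfolding \<epsilon>_def using pos by (subst Min_gr_iff[OF fin]) auto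
  have \<epsilon>1: "1 - l / \<mu> \<le> - \<epsilon>" if "\<mu> \<in> eigset l" for \<mu>
  proof -
    have "\<epsilon> \<le> l / \<mu> - 1" unfolding \<epsilon>_def by (rule Min_le[OF fin]) (use that in blast)
    then show ?thesis by simp
  qed
  have N: "cfun.independent ?B" "card ?B = card (eigset l)"
    "\<And>u. fn u \<in> ?M \<Longrightarrow> quad_form l u \<le> - \<epsilon> * (norm u)\<^sup>2"
    using negative_span[OF eigset_finite[of l] _ \<epsilon>1] by (auto simp: eigset_def)
  have "?M \<subseteq> sobolev" by (rule cfun.span_minimal[OF _ subspace_sobolev]) auto
  have "T_pencil \<rho> (complex_of_real l) y y \<le> complex_of_real (- \<epsilon> * (sob_norm y)\<^sup>2)" if y: "y \<in> ?M" for y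
  proof -
    have s: "fn (mk y) = y" using y \<open>?M \<subseteq> sobolev\<close> by (intro fn_mk) auto
    have "quad_form l (mk y) \<le> - \<epsilon> * (sob_norm y)\<^sup>2" using N(3)[of "mk y"] y unfolding norm_sob(2) s by simp
    then show ?thesis using T_pencil_form[of l "mk y"] unfolding s by (simp add: less_eq_complex_def)
  qed
  then have "?M \<in> {M. cfun.subspace M \<and> M \<subseteq> sobolev \<and>
       (\<exists>\<epsilon>>0. \<forall>y\<in>M. T_pencil \<rho> (complex_of_real l) y y \<le> complex_of_real (- \<epsilon> * (sob_norm y)\<^sup>2))}"
    using \<epsilon>0 \<open>?M \<subseteq> sobolev\<close> cfun.subspace_span by blast
  from SUP_upper[OF this, of edim] show "enat (card (eigset l)) \<le> ind (T_pencil \<rho> (complex_of_real l))"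
    unfolding ind_def using edim_span_independent[OF _ N(1)] N(2) eigset_finite by simp
qed

lemma spectrum_eigen: "l \<in> spectrum (T_pencil \<rho>) \<Longrightarrow> eigen l"
  using boundedly_invertible_if_not_eigen by (auto simp: spectrum_def)

lemma spectrum_isolated:
  assumes l: "l \<in> spectrum (T_pencil \<rho>)" shows "l isolated_in spectrum (T_pencil \<rho>)"
proof -
  let ?S = "spectrum (T_pencil \<rho>) \<inter> ball l 1"
  have "?S \<subseteq> complex_of_real ` {\<mu>. \<bar>\<mu>\<bar> \<le> cmod l + 1 \<and> eigen (complex_of_real \<mu>)}"
  proof
    fix k assume k: "k \<in> ?S"
    then have e: "eigen k" using spectrum_eigen by simp
    have "cmod k \<le> cmod l + 1" using k norm_triangle_ineq2[of k l] by (simp add: dist_norm norm_minus_commute)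
    then have "\<bar>Re k\<bar> \<le> cmod l + 1" using abs_Re_le_cmod[of k] by linarith
    then show "k \<in> complex_of_real ` {\<mu>. \<bar>\<mu>\<bar> \<le> cmod l + 1 \<and> eigen (complex_of_real \<mu>)}"
      using e eigen_real(1)[OF e] by (intro image_eqI[of k _ "Re k"]) auto
  qed
  then have "finite ?S" by (rule finite_subset) (intro finite_imageI finite_eigenvalues)
  then have "open (ball l 1 - (?S - {l}))" by (intro open_Diff finite_imp_closed) auto
  moreover have "(ball l 1 - (?S - {l})) \<inter> spectrum (T_pencil \<rho>) = {l}" using l by auto
  ultimately show ?thesis unfolding isolated_in_def using l by blast
qed

lemma purely_discrete: "purely_discrete_spectrum dirichlet (weight \<rho>)"
  unfolding purely_discrete_spectrum_def
  using spectrum_isolated spectrum_eigen alg_mult_eigen by (auto simp: eigenvalues_eq)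

lemma definite_type:
  assumes m: "eigen \<mu>"
  shows "Re \<mu> > 0 \<Longrightarrow> positive_type dirichlet (weight \<rho>) \<mu>" "Re \<mu> < 0 \<Longrightarrow> negative_type dirichlet (weight \<rho>) \<mu>"
proof -
  have k: "\<exists>u. y = fn u \<and> weight \<rho> y y = complex_of_real ((sob_norm y)\<^sup>2 / Re \<mu>)" if "y \<in> kernel (T_pencil \<rho> \<mu>)" for y
    using that eigen_form[OF m] unfolding kernel_eq norm_sob(2) by blast
  show "positive_type dirichlet (weight \<rho>) \<mu>" if "Re \<mu> > 0"
    unfolding positive_type_def
    using m that k by (auto simp: eigenvalues_eq less_eq_complex_def intro!: exI[of _ "1 / Re \<mu>"] dest!: k)
  show "negative_type dirichlet (weight \<rho>) \<mu>" if "Re \<mu> < 0"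
    unfolding negative_type_def
    using m that k by (auto simp: eigenvalues_eq less_eq_complex_def intro!: exI[of _ "- 1 / Re \<mu>"] dest!: k)
qed

end

theorem mainTheorem2:
  fixes \<rho> :: functional
  assumes "\<rho> \<in> sobolev_dual" and "real_functional \<rho>"
  shows "purely_discrete_spectrum dirichlet (weight \<rho>) \<and>
    (\<forall>\<mu>\<in>eigenvalues (T_pencil \<rho>). simple_eigenvalue dirichlet (weight \<rho>) \<mu>) \<and>
    (\<forall>\<mu>\<in>eigenvalues (T_pencil \<rho>). Re \<mu> > 0 \<longrightarrow> positive_type dirichlet (weight \<rho>) \<mu>) \<and>
    (\<forall>\<mu>\<in>eigenvalues (T_pencil \<rho>). Re \<mu> < 0 \<longrightarrow> negative_type dirichlet (weight \<rho>) \<mu>) \<and>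
    (\<forall>l::real. l > 0 \<longrightarrow>
       finite {\<mu>\<in>{0<..<l}. complex_of_real \<mu> \<in> eigenvalues (T_pencil \<rho>)} \<and>
       enat (card {\<mu>\<in>{0<..<l}. complex_of_real \<mu> \<in> eigenvalues (T_pencil \<rho>)}) =
         ind (T_pencil \<rho> (complex_of_real l))) \<and>
    (\<forall>l::real. l < 0 \<longrightarrow>
       finite {\<mu>\<in>{l<..<0}. complex_of_real \<mu> \<in> eigenvalues (T_pencil \<rho>)} \<and>
       enat (card {\<mu>\<in>{l<..<0}. complex_of_real \<mu> \<in> eigenvalues (T_pencil \<rho>)}) =
         ind (T_pencil \<rho> (complex_of_real l)))"
proof -
  interpret real_weight \<rho> by unfold_locales (rule assms)+
  have pos: "{\<mu>\<in>{0<..<l}. complex_of_real \<mu> \<in> eigenvalues (T_pencil \<rho>)} = eigset l" if "l > 0" for l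
    using that by (auto simp: eigset_def eigenvalues_eq zero_less_divide_iff divide_less_eq_1)
  have neg: "{\<mu>\<in>{l<..<0}. complex_of_real \<mu> \<in> eigenvalues (T_pencil \<rho>)} = eigset l" if "l < 0" for l
    using that by (auto simp: eigset_def eigenvalues_eq zero_less_divide_iff divide_less_eq_1)
  show ?thesis
  proof (intro conjI ballI allI impI)
    show "purely_discrete_spectrum dirichlet (weight \<rho>)" by (rule purely_discrete)
    fix \<mu> assume m: "\<mu> \<in> eigenvalues (T_pencil \<rho>)"
    then have e: "eigen \<mu>" by (simp add: eigenvalues_eq)
    show "simple_eigenvalue dirichlet (weight \<rho>) \<mu>"
      unfolding simple_eigenvalue_def using m alg_mult_eigen[OF e] by simp
    show "Re \<mu> > 0 \<Longrightarrow> positive_type dirichlet (weight \<rho>) \<mu>" "Re \<mu> < 0 \<Longrightarrow> negative_type dirichlet (weight \<rho>) \<mu>"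
      by (rule definite_type[OF e]; assumption)+
  next
    fix l :: real assume l: "l > 0"
    show "finite {\<mu>\<in>{0<..<l}. complex_of_real \<mu> \<in> eigenvalues (T_pencil \<rho>)}"
      "enat (card {\<mu>\<in>{0<..<l}. complex_of_real \<mu> \<in> eigenvalues (T_pencil \<rho>)}) = ind (T_pencil \<rho> (complex_of_real l))"
      unfolding pos[OF l] using eigset_finite ind_eq[of l] l by simp_all
  next
    fix l :: real assume l: "l < 0"
    show "finite {\<mu>\<in>{l<..<0}. complex_of_real \<mu> \<in> eigenvalues (T_pencil \<rho>)}"
      "enat (card {\<mu>\<in>{l<..<0}. complex_of_real \<mu> \<in> eigenvalues (T_pencil \<rho>)}) = ind (T_pencil \<rho> (complex_of_real l))"
      unfolding neg[OF l] using eigset_finite ind_eq[of l] l by simp_all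
  qed
qed

end
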